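(* For every (external) natural number $k$, $\mathsf{RCA}^*_0+\mathrm{Tot}(F_k)$ proves: for every deterministic transition relation $R\subseteq\mathbb{N}^2$, if $R$ is bounded by $F_k$ then there exist $T_0,\dots,T_{k+1}\subseteq\mathbb{N}^2$ such that $R^+\subseteq T_0\cup\dots\cup T_{k+1}$ and each $T_i$ is bounded by $F_0$.
   Context: $\mathsf{RCA}^*_0$ is second-order arithmetic with exponentiation, $\Delta^0_0$-induction and $\Delta^0_1$-comprehension. $F_0(x)=x+1$, $F_{n+1}(x)=F_n^{(x+1)}(x)$; $\mathrm{Tot}(F_k)$ states that $F_k$ is total. A transition relation is deterministic if it is generated by a transition function (each state has at most one successor). $R^+$ is the transitive closure of $R$. A relation $Q$ is bounded by $g$ if every finite $Q$-decreasing sequence $\langle a_0,\dots,a_{l-1}\rangle$ ($a_{i+1}\,Q\,a_i$ for all $i$) has $l\le g(a_0)$.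
   Formalization: The transitive closure R⁺ is assumed to exist as a set; the base theory does not prove this, and if R⁺ is read merely as a definable class the claim fails, e.g. in the ω-model of computable sets. *)

theory Defs
  imports Main
begin

section \<open>The language of second-order arithmetic with exponentiation\<close>

text \<open>Two sorts of de Bruijn variables: \<open>V i\<close> is the number variable bound by the \<open>i\<close>-th enclosing
  number quantifier, and the \<open>nat\<close> argument of \<open>Mem\<close> refers to the enclosing set quantifiers in the
  same way; the two index spaces are independent. Set equality is not primitive.\<close>

datatype tm =
    V nat
  | Zero (\<open>\<^bold>0\<close>)
  | One (\<open>\<^bold>1\<close>)
  | Add tm tm (infixl \<open>\<^bold>+\<close> 65)
  | Mul tm tm (infixl \<open>\<^bold>*\<close> 70)
  | Exp tm tm (infixr \<open>\<^bold>^\<close> 80)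

datatype fm =
    Fal
  | Eq tm tm (infix \<open>\<^bold>=\<close> 50)
  | Less tm tm (infix \<open>\<^bold><\<close> 50)
  | Mem tm nat (infix \<open>\<^bold>\<in>\<close> 50)
  | Imp fm fm (infixr \<open>\<^bold>\<longrightarrow>\<close> 25)
  | All fm
  | AllS fm

abbreviation Neg :: "fm \<Rightarrow> fm" (\<open>\<^bold>\<not> _\<close> [40] 40) where
  "\<^bold>\<not> \<phi> \<equiv> \<phi> \<^bold>\<longrightarrow> Fal"
abbreviation And :: "fm \<Rightarrow> fm \<Rightarrow> fm" (infixr \<open>\<^bold>\<and>\<close> 35) where
  "\<phi> \<^bold>\<and> \<psi> \<equiv> \<^bold>\<not> (\<phi> \<^bold>\<longrightarrow> \<^bold>\<not> \<psi>)"
abbreviation Or :: "fm \<Rightarrow> fm \<Rightarrow> fm" (infixr \<open>\<^bold>\<or>\<close> 30) where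
  "\<phi> \<^bold>\<or> \<psi> \<equiv> \<^bold>\<not> \<phi> \<^bold>\<longrightarrow> \<psi>"
abbreviation Iff :: "fm \<Rightarrow> fm \<Rightarrow> fm" (infixr \<open>\<^bold>\<longleftrightarrow>\<close> 25) where
  "\<phi> \<^bold>\<longleftrightarrow> \<psi> \<equiv> (\<phi> \<^bold>\<longrightarrow> \<psi>) \<^bold>\<and> (\<psi> \<^bold>\<longrightarrow> \<phi>)"
abbreviation Ex :: "fm \<Rightarrow> fm" where "Ex \<phi> \<equiv> \<^bold>\<not> All (\<^bold>\<not> \<phi>)"
abbreviation ExS :: "fm \<Rightarrow> fm" where "ExS \<phi> \<equiv> \<^bold>\<not> AllS (\<^bold>\<not> \<phi>)"
abbreviation Le :: "tm \<Rightarrow> tm \<Rightarrow> fm" (infix \<open>\<^bold>\<le>\<close> 50) where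
  "t \<^bold>\<le> u \<equiv> t \<^bold>< u \<^bold>\<or> t \<^bold>= u"

definition Conj :: "fm list \<Rightarrow> fm" where "Conj \<phi>s = foldr And \<phi>s (\<^bold>\<not> Fal)"
definition Disj :: "fm list \<Rightarrow> fm" where "Disj \<phi>s = foldr Or \<phi>s Fal"

subsection \<open>Simultaneous capture-avoiding substitution\<close>

primrec tsub :: "(nat \<Rightarrow> tm) \<Rightarrow> tm \<Rightarrow> tm" where
  "tsub \<sigma> (V i) = \<sigma> i"
| "tsub \<sigma> \<^bold>0 = \<^bold>0"
| "tsub \<sigma> \<^bold>1 = \<^bold>1"
| "tsub \<sigma> (t \<^bold>+ u) = tsub \<sigma> t \<^bold>+ tsub \<sigma> u"
| "tsub \<sigma> (t \<^bold>* u) = tsub \<sigma> t \<^bold>* tsub \<sigma> u"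
| "tsub \<sigma> (t \<^bold>^ u) = tsub \<sigma> t \<^bold>^ tsub \<sigma> u"

definition shift :: "tm \<Rightarrow> nat \<Rightarrow> tm" (infixl \<open>\<up>\<close> 90) where
  "t \<up> n = tsub (\<lambda>i. V (i + n)) t"

primrec sub :: "(nat \<Rightarrow> tm) \<Rightarrow> (nat \<Rightarrow> nat) \<Rightarrow> fm \<Rightarrow> fm" where
  "sub \<sigma> \<rho> Fal = Fal"
| "sub \<sigma> \<rho> (t \<^bold>= u) = (tsub \<sigma> t \<^bold>= tsub \<sigma> u)"
| "sub \<sigma> \<rho> (t \<^bold>< u) = (tsub \<sigma> t \<^bold>< tsub \<sigma> u)"
| "sub \<sigma> \<rho> (t \<^bold>\<in> X) = (tsub \<sigma> t \<^bold>\<in> \<rho> X)"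
| "sub \<sigma> \<rho> (\<phi> \<^bold>\<longrightarrow> \<psi>) = (sub \<sigma> \<rho> \<phi> \<^bold>\<longrightarrow> sub \<sigma> \<rho> \<psi>)"
| "sub \<sigma> \<rho> (All \<phi>) = All (sub (case_nat (V 0) (\<lambda>i. \<sigma> i \<up> 1)) \<rho> \<phi>)"
| "sub \<sigma> \<rho> (AllS \<phi>) = AllS (sub \<sigma> (case_nat 0 (\<lambda>i. Suc (\<rho> i))) \<phi>)"

definition inst :: "tm \<Rightarrow> fm \<Rightarrow> fm" where "inst t \<phi> = sub (case_nat t V) id \<phi>"
definition instS :: "nat \<Rightarrow> fm \<Rightarrow> fm" where "instS X \<phi> = sub V (case_nat X id) \<phi>"
definition lift :: "fm \<Rightarrow> fm" where "lift \<phi> = sub (\<lambda>i. V (Suc i)) id \<phi>"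
definition liftS :: "fm \<Rightarrow> fm" where "liftS \<phi> = sub V Suc \<phi>"

section \<open>Derivability\<close>

text \<open>Classical natural deduction for two-sorted logic with equality. Axioms of \<open>T\<close> may contain free
  variables. They are not lifted by the generalization rules, so an axiom counts as its universal
  closure; the hypotheses \<open>\<Gamma>\<close> are lifted and hence subject to the eigenvariable condition.\<close>

inductive derives :: "fm set \<Rightarrow> fm list \<Rightarrow> fm \<Rightarrow> bool" for T where
  Ax: "\<phi> \<in> T \<Longrightarrow> derives T \<Gamma> \<phi>"
| Hyp: "\<phi> \<in> set \<Gamma> \<Longrightarrow> derives T \<Gamma> \<phi>"
| ImpI: "derives T (\<phi> # \<Gamma>) \<psi> \<Longrightarrow> derives T \<Gamma> (\<phi> \<^bold>\<longrightarrow> \<psi>)"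
| ImpE: "derives T \<Gamma> (\<phi> \<^bold>\<longrightarrow> \<psi>) \<Longrightarrow> derives T \<Gamma> \<phi> \<Longrightarrow> derives T \<Gamma> \<psi>"
| Raa: "derives T ((\<^bold>\<not> \<phi>) # \<Gamma>) Fal \<Longrightarrow> derives T \<Gamma> \<phi>"
| AllI: "derives T (map lift \<Gamma>) \<phi> \<Longrightarrow> derives T \<Gamma> (All \<phi>)"
| AllE: "derives T \<Gamma> (All \<phi>) \<Longrightarrow> derives T \<Gamma> (inst t \<phi>)"
| AllSI: "derives T (map liftS \<Gamma>) \<phi> \<Longrightarrow> derives T \<Gamma> (AllS \<phi>)"
| AllSE: "derives T \<Gamma> (AllS \<phi>) \<Longrightarrow> derives T \<Gamma> (instS X \<phi>)"
| EqRefl: "derives T \<Gamma> (t \<^bold>= t)"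
| EqSubst: "derives T \<Gamma> (t \<^bold>= u) \<Longrightarrow> derives T \<Gamma> (inst t \<phi>) \<Longrightarrow> derives T \<Gamma> (inst u \<phi>)"

definition proves :: "fm set \<Rightarrow> fm \<Rightarrow> bool" (infix \<open>\<turnstile>\<close> 20) where
  "(T \<turnstile> \<phi>) \<longleftrightarrow> derives T [] \<phi>"

section \<open>The theory \<open>RCA\<^sup>*\<^sub>0\<close>\<close>

definition BAll :: "tm \<Rightarrow> fm \<Rightarrow> fm" where "BAll t \<phi> = All (V 0 \<^bold>< t \<up> 1 \<^bold>\<longrightarrow> \<phi>)"
definition BEx :: "tm \<Rightarrow> fm \<Rightarrow> fm" where "BEx t \<phi> = Ex (V 0 \<^bold>< t \<up> 1 \<^bold>\<and> \<phi>)"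

inductive delta0 :: "fm \<Rightarrow> bool" where
  "delta0 Fal"
| "delta0 (t \<^bold>= u)"
| "delta0 (t \<^bold>< u)"
| "delta0 (t \<^bold>\<in> X)"
| "delta0 \<phi> \<Longrightarrow> delta0 \<psi> \<Longrightarrow> delta0 (\<phi> \<^bold>\<longrightarrow> \<psi>)"
| "delta0 \<phi> \<Longrightarrow> delta0 (BAll t \<phi>)"
| "delta0 \<phi> \<Longrightarrow> delta0 (BEx t \<phi>)"

definition basic_axioms :: "fm set" where
  "basic_axioms =
    {\<^bold>\<not> (V 0 \<^bold>+ \<^bold>1 \<^bold>= \<^bold>0),
     V 0 \<^bold>+ \<^bold>1 \<^bold>= V 1 \<^bold>+ \<^bold>1 \<^bold>\<longrightarrow> V 0 \<^bold>= V 1,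
     V 0 \<^bold>+ \<^bold>0 \<^bold>= V 0,
     V 0 \<^bold>+ (V 1 \<^bold>+ \<^bold>1) \<^bold>= (V 0 \<^bold>+ V 1) \<^bold>+ \<^bold>1,
     V 0 \<^bold>* \<^bold>0 \<^bold>= \<^bold>0,
     V 0 \<^bold>* (V 1 \<^bold>+ \<^bold>1) \<^bold>= V 0 \<^bold>* V 1 \<^bold>+ V 0,
     \<^bold>\<not> (V 0 \<^bold>< \<^bold>0),
     V 0 \<^bold>< V 1 \<^bold>+ \<^bold>1 \<^bold>\<longleftrightarrow> V 0 \<^bold>\<le> V 1,
     V 0 \<^bold>^ \<^bold>0 \<^bold>= \<^bold>1,
     V 0 \<^bold>^ (V 1 \<^bold>+ \<^bold>1) \<^bold>= V 0 \<^bold>^ V 1 \<^bold>* V 0}"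

definition delta0_induction :: "fm set" where
  "delta0_induction =
    {inst \<^bold>0 \<phi> \<^bold>\<and> All (\<phi> \<^bold>\<longrightarrow> sub (case_nat (V 0 \<^bold>+ \<^bold>1) (\<lambda>i. V (Suc i))) id \<phi>) \<^bold>\<longrightarrow> All \<phi> | \<phi>. delta0 \<phi>}"

text \<open>\<open>Ex \<theta>\<close> is a \<open>\<Sigma>\<^sup>0\<^sub>1\<close> and \<open>All \<eta>\<close> a \<open>\<Pi>\<^sup>0\<^sub>1\<close> formula about the number \<open>V 0\<close>; lifting the set variables of
  \<open>Ex \<theta>\<close> makes the new set non-free in it.\<close>

definition delta1_comprehension :: "fm set" where
  "delta1_comprehension =
    {All (Ex \<theta> \<^bold>\<longleftrightarrow> All \<eta>) \<^bold>\<longrightarrow> ExS (All (V 0 \<^bold>\<in> 0 \<^bold>\<longleftrightarrow> liftS (Ex \<theta>))) | \<theta> \<eta>. delta0 \<theta> \<and> delta0 \<eta>}"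

definition RCA0star :: "fm set" where
  "RCA0star = basic_axioms \<union> delta0_induction \<union> delta1_comprehension"

section \<open>Coding of pairs and finite sequences\<close>

text \<open>The pairing \<open>(i,j) = (i+j)\<^sup>2 + i\<close> is injective but not onto.\<close>

definition Pr :: "tm \<Rightarrow> tm \<Rightarrow> tm" where "Pr t u = (t \<^bold>+ u) \<^bold>* (t \<^bold>+ u) \<^bold>+ t"

text \<open>A number \<open>c\<close> codes the finite set of positions of the ones in its binary expansion:
  \<open>t\<close> belongs to it iff \<open>c = (2q+1)2\<^sup>t + r\<close> for some \<open>q\<close> and some \<open>r < 2\<^sup>t\<close>.\<close>

definition Elem :: "tm \<Rightarrow> tm \<Rightarrow> fm" where
  "Elem t c = (let two = \<^bold>1 \<^bold>+ \<^bold>1 in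
    BEx (c \<^bold>+ \<^bold>1) (BEx (two \<^bold>^ t \<up> 1)
      (c \<up> 2 \<^bold>= (two \<^bold>* V 1 \<^bold>+ \<^bold>1) \<^bold>* two \<^bold>^ t \<up> 2 \<^bold>+ V 0)))"

text \<open>A finite sequence is coded by the finite set of pairs \<open>(i,a)\<close>, where \<open>a\<close> is its \<open>i\<close>-th entry.
  All entries of a code \<open>s\<close> are smaller than \<open>s\<close>, so they may be quantified below \<open>s\<close>.\<close>

definition Entry :: "tm \<Rightarrow> tm \<Rightarrow> tm \<Rightarrow> fm" where "Entry s i a = Elem (Pr i a) s"

definition IsSeq :: "tm \<Rightarrow> tm \<Rightarrow> fm" where
  "IsSeq s l =
    (BAll s (Elem (V 0) (s \<up> 1) \<^bold>\<longrightarrow> BEx (l \<up> 1) (BEx (s \<up> 2) (V 2 \<^bold>= Pr (V 1) (V 0)))) \<^bold>\<and>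
     BAll l (BEx (s \<up> 1) (Entry (s \<up> 2) (V 1) (V 0) \<^bold>\<and>
       BAll (s \<up> 2) (Entry (s \<up> 3) (V 2) (V 0) \<^bold>\<longrightarrow> V 0 \<^bold>= V 1))))"

section \<open>The functions \<open>F\<^sub>k\<close>\<close>

text \<open>\<open>Graph n t u\<close> says \<open>F\<^sub>n(t) = u\<close>; for \<open>n + 1\<close> there is a sequence of length \<open>t + 2\<close> from \<open>t\<close> to \<open>u\<close> in
  which every entry is the \<open>F\<^sub>n\<close>-value of its predecessor.\<close>

primrec Graph :: "nat \<Rightarrow> tm \<Rightarrow> tm \<Rightarrow> fm" where
  "Graph 0 t u = (u \<^bold>= t \<^bold>+ \<^bold>1)"
| "Graph (Suc n) t u = Ex (
     IsSeq (V 0) (t \<up> 1 \<^bold>+ \<^bold>1 \<^bold>+ \<^bold>1) \<^bold>\<and> Entry (V 0) \<^bold>0 (t \<up> 1) \<^bold>\<and> Entry (V 0) (t \<up> 1 \<^bold>+ \<^bold>1) (u \<up> 1) \<^bold>\<and>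
     BAll (t \<up> 1 \<^bold>+ \<^bold>1) (BAll (V 1) (BAll (V 2)
       (Entry (V 3) (V 2) (V 1) \<^bold>\<and> Entry (V 3) (V 2 \<^bold>+ \<^bold>1) (V 0) \<^bold>\<longrightarrow> Graph n (V 1) (V 0)))))"

definition Tot :: "nat \<Rightarrow> fm" where "Tot k = All (Ex (Graph k (V 1) (V 0)))"

section \<open>Relations\<close>

text \<open>A relation is a set of coded pairs; \<open>y Q x\<close> is \<open>Pr y x \<^bold>\<in> Q\<close>. A step of a transition relation
  leads from \<open>x\<close> to \<open>y\<close> with \<open>y R x\<close>, so that runs are decreasing sequences.\<close>

definition IsRel :: "nat \<Rightarrow> fm" where
  "IsRel Q = All (V 0 \<^bold>\<in> Q \<^bold>\<longrightarrow> Ex (Ex (V 2 \<^bold>= Pr (V 1) (V 0))))"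

definition Deterministic :: "nat \<Rightarrow> fm" where
  "Deterministic R = All (All (All (Pr (V 1) (V 2) \<^bold>\<in> R \<^bold>\<and> Pr (V 0) (V 2) \<^bold>\<in> R \<^bold>\<longrightarrow> V 1 \<^bold>= V 0)))"

definition Decreasing :: "nat \<Rightarrow> tm \<Rightarrow> tm \<Rightarrow> fm" where
  "Decreasing Q s l = (IsSeq s l \<^bold>\<and>
     BAll l (BAll (s \<up> 1) (BAll (s \<up> 2)
       (Entry (s \<up> 3) (V 2) (V 1) \<^bold>\<and> Entry (s \<up> 3) (V 2 \<^bold>+ \<^bold>1) (V 0) \<^bold>\<longrightarrow> Pr (V 0) (V 1) \<^bold>\<in> Q))))"

text \<open>In the scope of the three quantifiers \<open>V 2\<close> is the sequence, \<open>V 1\<close> its length and \<open>V 0\<close> its first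
  entry; the bound is \<open>F\<^sub>k\<close>.\<close>

definition BoundedBy :: "nat \<Rightarrow> nat \<Rightarrow> fm" where
  "BoundedBy k Q = All (All (All (Decreasing Q (V 2) (V 1) \<^bold>\<and> Entry (V 2) \<^bold>0 (V 0) \<^bold>\<longrightarrow>
     Ex (Graph k (V 1) (V 0) \<^bold>\<and> V 2 \<^bold>\<le> V 0))))"

text \<open>\<open>P = R\<^sup>+\<close>: for \<open>x = V 3\<close> and \<open>y = V 2\<close>, \<open>y P x\<close> iff some \<open>R\<close>-decreasing sequence of length at least two
  leads from \<open>x\<close> to \<open>y\<close>. This \<open>\<Sigma>\<^sup>0\<^sub>1\<close> condition need not define a set in \<open>RCA\<^sup>*\<^sub>0\<close>, so \<open>R\<^sup>+\<close>, being a relation,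
  is a second-order object \<open>P\<close> with this property.\<close>

definition IsTransClosure :: "nat \<Rightarrow> nat \<Rightarrow> fm" where
  "IsTransClosure P R = (IsRel P \<^bold>\<and> All (All (Pr (V 0) (V 1) \<^bold>\<in> P \<^bold>\<longleftrightarrow>
     Ex (Ex (Decreasing R (V 1) (V 0 \<^bold>+ \<^bold>1 \<^bold>+ \<^bold>1) \<^bold>\<and> Entry (V 1) \<^bold>0 (V 3) \<^bold>\<and> Entry (V 1) (V 0 \<^bold>+ \<^bold>1) (V 2))))))"

definition CoveredBy :: "nat \<Rightarrow> nat list \<Rightarrow> fm" where
  "CoveredBy P Ts = All (V 0 \<^bold>\<in> P \<^bold>\<longrightarrow> Disj (map (\<lambda>i. V 0 \<^bold>\<in> i) Ts))"

end

(* By completeness it suffices to work in a countable model M of RCA*_0 + Tot(F_k). There let m(x) be the number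
   of steps that a run can still make from x, so m(x) < F_k(x). Write F_n^j for the j-th iterate and let
   rho_1(x), ..., rho_k(x) be the lexicographically greatest digits with
   F_{k-1}^{rho_1}(F_{k-2}^{rho_2}(... F_0^{rho_k}(x))) <= m(x), or all 0 if there are none; the bound on m
   gives rho_i(x) <= x. If y comes after x, then y < x, or some rho_i decreases, or all of them are 0 and
   m(y) < m(x) <= x. This splits R^+ into k+2 relations, each with a rank that decreases and is at most x.
   Since m need not be computable, it is replaced by a Delta^0_1 upper bound that has the same properties. *)

theory Submission
  imports Defs "HOL-Library.Countable_Set"
begin

section \<open>Substitution\<close>

text \<open>Only bounded formulas admit induction, and \<open>Tot k\<close> yields the iterates
  \<open>F_i^j(x)\<close> for \<open>i < k\<close> only up to \<open>j = x + 1\<close>. So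
  iterations live inside coded sequences, and a digit above \<open>x\<close> could not even be
  compared. The same limit makes the digits useful: a rank \<open>r\<close> with \<open>r x\<close>
  at most \<open>x\<close> that drops at every step allows at most \<open>x + 1 = F_0(x)\<close>
  entries. The digits need not decrease lexicographically as one rank. Suppose \<open>x < y\<close>
  and the potential does not grow. Monotonicity of the iterates then shows that at each level the
  digit drops or stays, and if it stays, the potential left for the next level does not grow. The
  identity, which serves the case \<open>y < x\<close>, and the minimum of potential and argument
  are the two ranks beyond the \<open>k\<close> digits. The substitute for \<open>m(x)\<close> is
  the minimum of \<open>F_k(x') - 1 - d\<close>, where \<open>d\<close> is the length of a run from
  \<open>x'\<close> to \<open>x\<close> and \<open>x'\<close> is at most \<open>x\<close>. It is
  computable because R^+ is given as a set: membership says whether a search for a run succeeds, and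
  since R is deterministic and bounded, the length found is unique. The restriction on
  \<open>x'\<close> keeps the search bounded and is harmless, since the potential has to drop only
  when \<open>y > x\<close>.\<close>

lemma tsub_tsub: "tsub \<sigma>' (tsub \<sigma> t) = tsub (\<lambda>i. tsub \<sigma>' (\<sigma> i)) t"
  by (induction t) auto

lemma tsub_V [simp]: "tsub V t = t"
  by (induction t) auto

lemma tsub_shift: "tsub \<sigma> (t \<up> n) = tsub (\<lambda>i. \<sigma> (i + n)) t"
  by (simp add: shift_def tsub_tsub)

lemma shift_tsub: "tsub \<sigma> t \<up> n = tsub (\<lambda>i. \<sigma> i \<up> n) t"
  by (simp add: shift_def tsub_tsub)

lemma V_shift [simp]: "V i \<up> n = V (i + n)"
  by (simp add: shift_def)

lemma case_nat_V [simp]: "case_nat (V 0) (\<lambda>i. V (Suc i)) = V"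
  by (auto split: nat.split)

lemma case_nat_id [simp]: "case_nat 0 Suc = (\<lambda>i. i)"
  by (auto split: nat.split)

text \<open>Under a binder both substitutions are lifted, and the lifted ones compose to the lift of
  the composite. As \<open>inst\<close>, \<open>instS\<close>, \<open>lift\<close> and
  \<open>liftS\<close> are substitutions, the commutation laws below reduce to comparing two maps on
  variables.\<close>

lemma sub_sub: "sub \<sigma>' \<rho>' (sub \<sigma> \<rho> \<phi>) = sub (\<lambda>i. tsub \<sigma>' (\<sigma> i)) (\<lambda>i. \<rho>' (\<rho> i)) \<phi>"
proof (induction \<phi> arbitrary: \<sigma> \<rho> \<sigma>' \<rho>')
  case (All \<phi>)
  have "(\<lambda>i. tsub (case_nat (V 0) (\<lambda>i. \<sigma>' i \<up> Suc 0)) (case_nat (V 0) (\<lambda>i. \<sigma> i \<up> Suc 0) i))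
    = case_nat (V 0) (\<lambda>i. tsub \<sigma>' (\<sigma> i) \<up> Suc 0)"
    by (auto simp: tsub_shift shift_tsub split: nat.split)
  then show ?case using All by simp
next
  case (AllS \<phi>)
  have "(\<lambda>i. case_nat 0 (\<lambda>i. Suc (\<rho>' i)) (case_nat 0 (\<lambda>i. Suc (\<rho> i)) i)) = case_nat 0 (\<lambda>i. Suc (\<rho>' (\<rho> i)))"
    by (auto split: nat.split)
  then show ?case using AllS by simp
qed (auto simp: tsub_tsub)

lemma sub_V [simp]: "sub V (\<lambda>i. i) \<phi> = \<phi>" "sub V id \<phi> = \<phi>"
proof -
  show "sub V (\<lambda>i. i) \<phi> = \<phi>" by (induction \<phi>) auto
  then show "sub V id \<phi> = \<phi>" by (simp add: id_def)
qed

lemma sub_lift: "sub (case_nat (V 0) (\<lambda>i. \<sigma> i \<up> Suc 0)) \<rho> (lift \<phi>) = lift (sub \<sigma> \<rho> \<phi>)"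
  by (simp add: lift_def sub_sub shift_def)

lemma sub_liftS: "sub \<sigma> (case_nat 0 (\<lambda>i. Suc (\<rho> i))) (liftS \<phi>) = liftS (sub \<sigma> \<rho> \<phi>)"
  by (simp add: liftS_def sub_sub)

lemma sub_inst: "sub \<sigma> \<rho> (inst t \<phi>) = inst (tsub \<sigma> t) (sub (case_nat (V 0) (\<lambda>i. \<sigma> i \<up> Suc 0)) \<rho> \<phi>)"
proof -
  have "(\<lambda>i. tsub \<sigma> (case_nat t V i)) =
    (\<lambda>i. tsub (case_nat (tsub \<sigma> t) V) (case_nat (V 0) (\<lambda>i. \<sigma> i \<up> Suc 0) i))"
    by (auto simp: tsub_shift split: nat.split)
  then show ?thesis by (simp add: inst_def sub_sub)
qed

lemma sub_instS: "sub \<sigma> \<rho> (instS X \<phi>) = instS (\<rho> X) (sub \<sigma> (case_nat 0 (\<lambda>i. Suc (\<rho> i))) \<phi>)"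
proof -
  have "(\<lambda>i. \<rho> (case_nat X id i)) = (\<lambda>i. case_nat (\<rho> X) id (case_nat 0 (\<lambda>i. Suc (\<rho> i)) i))"
    by (auto split: nat.split)
  then show ?thesis by (simp add: instS_def sub_sub)
qed

text \<open>Dependence on the variables below \<open>n\<close> is expressed by the action of
  substitutions, so no set of free variables is computed. One \<open>n\<close> serves both
  sorts.\<close>

definition fresh_from :: "nat \<Rightarrow> fm \<Rightarrow> bool" where
  "fresh_from n \<phi> \<longleftrightarrow> (\<forall>\<sigma> \<sigma>' \<rho> \<rho>'. (\<forall>i<n. \<sigma> i = \<sigma>' i \<and> \<rho> i = \<rho>' i) \<longrightarrow> sub \<sigma> \<rho> \<phi> = sub \<sigma>' \<rho>' \<phi>)"

lemma fresh_fromD: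
  "fresh_from n \<phi> \<Longrightarrow> (\<And>i. i < n \<Longrightarrow> \<sigma> i = \<sigma>' i) \<Longrightarrow> (\<And>i. i < n \<Longrightarrow> \<rho> i = \<rho>' i) \<Longrightarrow> sub \<sigma> \<rho> \<phi> = sub \<sigma>' \<rho>' \<phi>"
  unfolding fresh_from_def by blast

lemma fresh_from_mono: "fresh_from m \<phi> \<Longrightarrow> m \<le> n \<Longrightarrow> fresh_from n \<phi>"
  unfolding fresh_from_def by (meson order_less_le_trans)

lemma tsub_fresh_exists: "\<exists>n. \<forall>\<sigma> \<sigma>'. (\<forall>i<n. \<sigma> i = \<sigma>' i) \<longrightarrow> tsub \<sigma> t = tsub \<sigma>' t"
proof (induction t)
  case (V i)
  show ?case by (rule exI[of _ "Suc i"]) simp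
next
  case (Add t u)
  then obtain m n where *: "\<And>\<sigma> \<sigma>'. (\<forall>i<m. \<sigma> i = \<sigma>' i) \<Longrightarrow> tsub \<sigma> t = tsub \<sigma>' t"
    "\<And>\<sigma> \<sigma>'. (\<forall>i<n. \<sigma> i = \<sigma>' i) \<Longrightarrow> tsub \<sigma> u = tsub \<sigma>' u" by blast
  show ?case
    by (rule exI[of _ "max m n"]) (use *(1) *(2) in \<open>simp add: less_max_iff_disj\<close>)
next
  case (Mul t u)
  then obtain m n where *: "\<And>\<sigma> \<sigma>'. (\<forall>i<m. \<sigma> i = \<sigma>' i) \<Longrightarrow> tsub \<sigma> t = tsub \<sigma>' t"
    "\<And>\<sigma> \<sigma>'. (\<forall>i<n. \<sigma> i = \<sigma>' i) \<Longrightarrow> tsub \<sigma> u = tsub \<sigma>' u" by blast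
  show ?case
    by (rule exI[of _ "max m n"]) (use *(1) *(2) in \<open>simp add: less_max_iff_disj\<close>)
next
  case (Exp t u)
  then obtain m n where *: "\<And>\<sigma> \<sigma>'. (\<forall>i<m. \<sigma> i = \<sigma>' i) \<Longrightarrow> tsub \<sigma> t = tsub \<sigma>' t"
    "\<And>\<sigma> \<sigma>'. (\<forall>i<n. \<sigma> i = \<sigma>' i) \<Longrightarrow> tsub \<sigma> u = tsub \<sigma>' u" by blast
  show ?case
    by (rule exI[of _ "max m n"]) (use *(1) *(2) in \<open>simp add: less_max_iff_disj\<close>)
qed auto

lemma fresh_from_exists: "\<exists>n. fresh_from n \<phi>"
proof (induction \<phi>)
  case Fal
  show ?case by (simp add: fresh_from_def)
next
  case (Eq t u)
  obtain m n where *: "\<And>\<sigma> \<sigma>'. (\<forall>i<m. \<sigma> i = \<sigma>' i) \<Longrightarrow> tsub \<sigma> t = tsub \<sigma>' t"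
    "\<And>\<sigma> \<sigma>'. (\<forall>i<n. \<sigma> i = \<sigma>' i) \<Longrightarrow> tsub \<sigma> u = tsub \<sigma>' u" using tsub_fresh_exists by metis
  show ?case unfolding fresh_from_def
    by (rule exI[of _ "max m n"]) (use *(1) *(2) in \<open>simp add: less_max_iff_disj\<close>)
next
  case (Less t u)
  obtain m n where *: "\<And>\<sigma> \<sigma>'. (\<forall>i<m. \<sigma> i = \<sigma>' i) \<Longrightarrow> tsub \<sigma> t = tsub \<sigma>' t"
    "\<And>\<sigma> \<sigma>'. (\<forall>i<n. \<sigma> i = \<sigma>' i) \<Longrightarrow> tsub \<sigma> u = tsub \<sigma>' u" using tsub_fresh_exists by metis
  show ?case unfolding fresh_from_def
    by (rule exI[of _ "max m n"]) (use *(1) *(2) in \<open>simp add: less_max_iff_disj\<close>)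
next
  case (Mem t X)
  obtain m where *: "\<And>\<sigma> \<sigma>'. (\<forall>i<m. \<sigma> i = \<sigma>' i) \<Longrightarrow> tsub \<sigma> t = tsub \<sigma>' t"
    using tsub_fresh_exists by metis
  show ?case unfolding fresh_from_def
    by (rule exI[of _ "max m (Suc X)"]) (use *(1) in \<open>simp add: less_max_iff_disj\<close>)
next
  case (Imp \<phi> \<psi>)
  then obtain m n where "fresh_from m \<phi>" "fresh_from n \<psi>" by blast
  then have *: "fresh_from (max m n) \<phi>" "fresh_from (max m n) \<psi>" by (auto intro: fresh_from_mono)
  have "fresh_from (max m n) (\<phi> \<^bold>\<longrightarrow> \<psi>)"
    unfolding fresh_from_def sub.simps using fresh_fromD[OF *(1)] fresh_fromD[OF *(2)] by metis
  then show ?case by blast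
next
  case (All \<phi>)
  then obtain n where n: "fresh_from n \<phi>" by blast
  have "fresh_from n (All \<phi>)"
    unfolding fresh_from_def by (auto intro!: fresh_fromD[OF n] split: nat.split)
  then show ?case by blast
next
  case (AllS \<phi>)
  then obtain n where n: "fresh_from n \<phi>" by blast
  have "fresh_from n (AllS \<phi>)"
    unfolding fresh_from_def by (auto intro!: fresh_fromD[OF n] split: nat.split)
  then show ?case by blast
qed

lemma fresh_from_exists_list: "\<exists>n. \<forall>\<phi>\<in>set \<Gamma>. fresh_from n \<phi>"
proof (induction \<Gamma>)
  case (Cons \<phi> \<Gamma>)
  then obtain m n where "\<forall>\<phi>\<in>set \<Gamma>. fresh_from n \<phi>" "fresh_from m \<phi>" using fresh_from_exists by blast
  then show ?case by (intro exI[of _ "max m n"]) (auto intro: fresh_from_mono)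
qed simp

section \<open>Completeness\<close>

lemma weaken: "derives T \<Gamma> \<phi> \<Longrightarrow> set \<Gamma> \<subseteq> set \<Gamma>' \<Longrightarrow> derives T \<Gamma>' \<phi>"
proof (induction arbitrary: \<Gamma>' rule: derives.induct)
  case (ImpI \<phi> \<Gamma> \<psi>)
  show ?case by (rule derives.ImpI, rule ImpI.IH) (use ImpI.prems in auto)
next
  case (ImpE \<Gamma> \<phi> \<psi>)
  then show ?case by (blast intro: derives.ImpE)
next
  case (Raa \<phi> \<Gamma>)
  show ?case by (rule derives.Raa, rule Raa.IH) (use Raa.prems in auto)
next
  case (AllI \<Gamma> \<phi>)
  show ?case by (rule derives.AllI, rule AllI.IH) (use AllI.prems in auto)
next
  case (AllSI \<Gamma> \<phi>)
  show ?case by (rule derives.AllSI, rule AllSI.IH) (use AllSI.prems in auto)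
qed (auto intro: derives.Ax derives.Hyp derives.AllE derives.AllSE derives.EqRefl derives.EqSubst)

text \<open>An axiom stands for its universal closure, yet the rule for axioms gives it only
  verbatim. In the empty context each variable can be generalized and then instantiated, one at a
  time, first the number variables and then the set variables. The conditions on the tails say that
  the surviving variables are renumbered from 0.\<close>

lemma theorem_instance_steps:
  assumes "derives T [] \<phi>" "\<And>i. \<sigma> (n + i) = V i" "\<And>i. \<rho> (m + i) = i"
  shows "derives T [] (sub \<sigma> \<rho> \<phi>)"
proof -
  have 1: "derives T [] (sub \<sigma> id \<phi>)" if "derives T [] \<phi>" "\<And>i. \<sigma> (n + i) = V i" for \<phi> \<sigma>
    using that
  proof (induction n arbitrary: \<phi> \<sigma>)
    case 0
    then have "\<sigma> = V" by auto
    with 0 show ?case by simp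
  next
    case (Suc n)
    \<comment> \<open>The remaining \<open>n\<close> rounds send \<open>V (i + n)\<close> to
      \<open>V i\<close>, so the term is shifted by \<open>n\<close> in advance.\<close>
    have "derives T [] (inst (\<sigma> 0 \<up> n) \<phi>)"
      using Suc.prems(1) by (intro derives.AllE derives.AllI) simp
    then have "derives T [] (sub (\<lambda>i. \<sigma> (Suc i)) id (inst (\<sigma> 0 \<up> n) \<phi>))"
      by (rule Suc.IH) (use Suc.prems(2) in simp)
    moreover have "(\<lambda>i. tsub (\<lambda>i. \<sigma> (Suc i)) (case_nat (\<sigma> 0 \<up> n) V i)) = \<sigma>"
    proof
      fix i
      have "(\<lambda>i. \<sigma> (Suc (i + n))) = V" using Suc.prems(2) by (auto simp: add.commute)
      then show "tsub (\<lambda>i. \<sigma> (Suc i)) (case_nat (\<sigma> 0 \<up> n) V i) = \<sigma> i"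
        by (cases i) (simp_all add: tsub_shift)
    qed
    ultimately show ?case by (simp add: inst_def sub_sub id_def)
  qed
  have 2: "derives T [] (sub V \<rho> \<phi>)" if "derives T [] \<phi>" "\<And>i. \<rho> (m + i) = i" for \<phi> \<rho>
    using that
  proof (induction m arbitrary: \<phi> \<rho>)
    case 0
    then have "\<rho> = id" by auto
    with 0 show ?case by simp
  next
    case (Suc m)
    have "derives T [] (instS (\<rho> 0 + m) \<phi>)"
      using Suc.prems(1) by (intro derives.AllSE derives.AllSI) simp
    then have "derives T [] (sub V (\<lambda>i. \<rho> (Suc i)) (instS (\<rho> 0 + m) \<phi>))"
      by (rule Suc.IH) (use Suc.prems(2) in simp)
    moreover have "(\<lambda>i. \<rho> (Suc (case_nat (\<rho> 0 + m) id i))) = \<rho>"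
    proof
      fix i
      show "\<rho> (Suc (case_nat (\<rho> 0 + m) id i)) = \<rho> i"
        using Suc.prems(2)[of "\<rho> 0"] by (cases i) (simp_all add: add.commute)
    qed
    ultimately show ?case by (simp add: instS_def sub_sub)
  qed
  have "derives T [] (sub V \<rho> (sub \<sigma> id \<phi>))"
    using 2[OF 1[OF assms(1,2)] assms(3)] .
  then show ?thesis by (simp add: sub_sub)
qed

lemma theorem_instance:
  assumes "derives T [] \<phi>"
  shows "derives T \<Gamma> (sub \<sigma> \<rho> \<phi>)"
proof -
  obtain n where n: "fresh_from n \<phi>" using fresh_from_exists by blast
  \<comment> \<open>Only the values below \<open>n\<close> matter to \<open>\<phi>\<close>, so the
    tails may be replaced by ones of the required form.\<close>
  have "derives T [] (sub (\<lambda>i. if i < n then \<sigma> i else V (i - n)) (\<lambda>i. if i < n then \<rho> i else i - n) \<phi>)"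
    by (rule theorem_instance_steps[OF assms, of _ n _ n]) auto
  also have "sub (\<lambda>i. if i < n then \<sigma> i else V (i - n)) (\<lambda>i. if i < n then \<rho> i else i - n) \<phi> = sub \<sigma> \<rho> \<phi>"
    by (rule fresh_fromD[OF n]) auto
  finally show ?thesis by (rule weaken) simp
qed

text \<open>The one case that does not follow from its own rule is an axiom, since \<open>T\<close>
  need not be closed under substitution; there \<open>theorem_instance\<close> helps. The lemma is
  used to rename eigenvariables.\<close>

lemma derives_sub: "derives T \<Gamma> \<phi> \<Longrightarrow> derives T (map (sub \<sigma> \<rho>) \<Gamma>) (sub \<sigma> \<rho> \<phi>)"
proof (induction arbitrary: \<sigma> \<rho> rule: derives.induct)
  case (Ax \<phi> \<Gamma>)
  then show ?case by (intro theorem_instance derives.Ax)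
next
  case (Hyp \<phi> \<Gamma>)
  then show ?case by (intro derives.Hyp) auto
next
  case (ImpI \<phi> \<Gamma> \<psi>)
  from ImpI.IH[of \<sigma> \<rho>] show ?case by (auto intro: derives.ImpI)
next
  case (ImpE \<Gamma> \<phi> \<psi>)
  from ImpE.IH(1)[of \<sigma> \<rho>] ImpE.IH(2)[of \<sigma> \<rho>] show ?case by (auto intro: derives.ImpE)
next
  case (Raa \<phi> \<Gamma>)
  from Raa.IH[of \<sigma> \<rho>] show ?case by (auto intro: derives.Raa)
next
  case (AllI \<Gamma> \<phi>)
  have "map lift (map (sub \<sigma> \<rho>) \<Gamma>) = map (sub (case_nat (V 0) (\<lambda>i. \<sigma> i \<up> Suc 0)) \<rho>) (map lift \<Gamma>)"
    by (simp add: sub_lift)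
  with AllI.IH show ?case by (auto intro: derives.AllI simp del: map_map)
next
  case (AllE \<Gamma> \<phi> t)
  from AllE.IH[of \<sigma> \<rho>] show ?case unfolding sub_inst by (auto intro: derives.AllE)
next
  case (AllSI \<Gamma> \<phi>)
  have "map liftS (map (sub \<sigma> \<rho>) \<Gamma>) = map (sub \<sigma> (case_nat 0 (\<lambda>i. Suc (\<rho> i)))) (map liftS \<Gamma>)"
    by (simp add: sub_liftS)
  with AllSI.IH show ?case by (auto intro: derives.AllSI simp del: map_map)
next
  case (AllSE \<Gamma> \<phi> X)
  from AllSE.IH[of \<sigma> \<rho>] show ?case unfolding sub_instS by (auto intro: derives.AllSE)
next
  case (EqRefl \<Gamma> t)
  show ?case by (simp add: derives.EqRefl)
next
  case (EqSubst \<Gamma> t u \<phi>)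
  from EqSubst.IH(1)[of \<sigma> \<rho>] EqSubst.IH(2)[of \<sigma> \<rho>] show ?case
    unfolding sub_inst by (auto intro: derives.EqSubst)
qed

text \<open>The substitution sends \<open>V n\<close> to \<open>V 0\<close> and moves all other
  variables up by one. On hypotheses that depend only on variables below \<open>n\<close> it acts as
  \<open>lift\<close>, and it turns \<open>inst (V n) \<phi>\<close> back into
  \<open>\<phi>\<close>, which is the premise of \<open>AllI\<close>.\<close>

lemma generalize_fresh:
  assumes "derives T \<Gamma> (inst (V n) \<phi>)" and fresh: "\<forall>\<gamma>\<in>set (\<phi> # \<Gamma>). fresh_from n \<gamma>"
  shows "derives T \<Gamma> (All \<phi>)"
proof -
  let ?\<sigma> = "\<lambda>i. if i = n then V 0 else V (Suc i)"
  have "map (sub ?\<sigma> id) \<Gamma> = map lift \<Gamma>"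
    using fresh by (auto simp: lift_def intro!: fresh_fromD)
  moreover have "sub ?\<sigma> id (inst (V n) \<phi>) = \<phi>"
  proof -
    have "sub ?\<sigma> id (inst (V n) \<phi>) = sub (\<lambda>i. tsub ?\<sigma> (case_nat (V n) V i)) id \<phi>"
      by (simp add: inst_def sub_sub id_def)
    also have "\<dots> = sub V id \<phi>"
      using fresh by (intro fresh_fromD[of n]) (auto split: nat.split)
    finally show ?thesis by simp
  qed
  ultimately show ?thesis using derives_sub[OF assms(1), of ?\<sigma> id] by (simp add: derives.AllI cong: map_cong)
qed

lemma generalizeS_fresh:
  assumes "derives T \<Gamma> (instS n \<phi>)" and fresh: "\<forall>\<gamma>\<in>set (\<phi> # \<Gamma>). fresh_from n \<gamma>"
  shows "derives T \<Gamma> (AllS \<phi>)"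
proof -
  let ?\<rho> = "\<lambda>i. if i = n then 0 else Suc i"
  have "map (sub V ?\<rho>) \<Gamma> = map liftS \<Gamma>"
    using fresh by (auto simp: liftS_def intro!: fresh_fromD)
  moreover have "sub V ?\<rho> (instS n \<phi>) = \<phi>"
  proof -
    have "sub V ?\<rho> (instS n \<phi>) = sub V (\<lambda>i. ?\<rho> (case_nat n id i)) \<phi>"
      by (simp add: instS_def sub_sub)
    also have "\<dots> = sub V id \<phi>"
      using fresh by (intro fresh_fromD[of n]) (auto split: nat.split)
    finally show ?thesis by simp
  qed
  ultimately show ?thesis using derives_sub[OF assms(1), of V ?\<rho>] by (simp add: derives.AllSI cong: map_cong)
qed

section \<open>Two-sorted structures and satisfaction\<close>

record ('a, 's) struct =
  zero_of :: 'a
  one_of :: 'a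
  plus_of :: "'a \<Rightarrow> 'a \<Rightarrow> 'a"
  times_of :: "'a \<Rightarrow> 'a \<Rightarrow> 'a"
  exp_of :: "'a \<Rightarrow> 'a \<Rightarrow> 'a"
  less_of :: "'a \<Rightarrow> 'a \<Rightarrow> bool"
  mem_of :: "'a \<Rightarrow> 's \<Rightarrow> bool"

primrec val :: "('a, 's) struct \<Rightarrow> (nat \<Rightarrow> 'a) \<Rightarrow> tm \<Rightarrow> 'a" where
  "val \<M> e (V i) = e i"
| "val \<M> e \<^bold>0 = zero_of \<M>"
| "val \<M> e \<^bold>1 = one_of \<M>"
| "val \<M> e (t \<^bold>+ u) = plus_of \<M> (val \<M> e t) (val \<M> e u)"
| "val \<M> e (t \<^bold>* u) = times_of \<M> (val \<M> e t) (val \<M> e u)"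
| "val \<M> e (t \<^bold>^ u) = exp_of \<M> (val \<M> e t) (val \<M> e u)"

primrec sat :: "('a, 's) struct \<Rightarrow> (nat \<Rightarrow> 'a) \<Rightarrow> (nat \<Rightarrow> 's) \<Rightarrow> fm \<Rightarrow> bool" where
  "sat \<M> e s Fal \<longleftrightarrow> False"
| "sat \<M> e s (t \<^bold>= u) \<longleftrightarrow> val \<M> e t = val \<M> e u"
| "sat \<M> e s (t \<^bold>< u) \<longleftrightarrow> less_of \<M> (val \<M> e t) (val \<M> e u)"
| "sat \<M> e s (t \<^bold>\<in> X) \<longleftrightarrow> mem_of \<M> (val \<M> e t) (s X)"
| "sat \<M> e s (\<phi> \<^bold>\<longrightarrow> \<psi>) \<longleftrightarrow> (sat \<M> e s \<phi> \<longrightarrow> sat \<M> e s \<psi>)"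
| "sat \<M> e s (All \<phi>) \<longleftrightarrow> (\<forall>x. sat \<M> (case_nat x e) s \<phi>)"
| "sat \<M> e s (AllS \<phi>) \<longleftrightarrow> (\<forall>X. sat \<M> e (case_nat X s) \<phi>)"

lemma val_tsub: "val \<M> e (tsub \<sigma> t) = val \<M> (\<lambda>i. val \<M> e (\<sigma> i)) t"
  by (induction t) auto

lemma val_shift [simp]: "val \<M> e (t \<up> n) = val \<M> (\<lambda>i. e (i + n)) t"
  by (simp add: shift_def val_tsub)

lemma sat_sub: "sat \<M> e s (sub \<sigma> \<rho> \<phi>) \<longleftrightarrow> sat \<M> (\<lambda>i. val \<M> e (\<sigma> i)) (\<lambda>i. s (\<rho> i)) \<phi>"
proof (induction \<phi> arbitrary: e s \<sigma> \<rho>)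
  case (All \<phi>)
  have "(\<lambda>i. val \<M> (case_nat x e) (case_nat (V 0) (\<lambda>i. \<sigma> i \<up> Suc 0) i)) = case_nat x (\<lambda>i. val \<M> e (\<sigma> i))" for x
    by (auto split: nat.split)
  with All show ?case by simp
next
  case (AllS \<phi>)
  have "(\<lambda>i. case_nat X s (case_nat 0 (\<lambda>i. Suc (\<rho> i)) i)) = case_nat X (\<lambda>i. s (\<rho> i))" for X
    by (auto split: nat.split)
  with AllS show ?case by simp
qed (auto simp: val_tsub)

lemma sat_inst: "sat \<M> e s (inst t \<phi>) \<longleftrightarrow> sat \<M> (case_nat (val \<M> e t) e) s \<phi>"
proof -
  have "(\<lambda>i. val \<M> e (case_nat t V i)) = case_nat (val \<M> e t) e" by (auto split: nat.split)
  then show ?thesis by (simp add: inst_def sat_sub)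
qed

section \<open>Henkin sets and the term model\<close>

instance tm :: countable by countable_datatype
instance fm :: countable by countable_datatype

text \<open>The Henkin property is built in: a rejected universal formula has to come with a term or
  a set variable at which it fails.\<close>

definition decided :: "fm \<Rightarrow> fm set \<Rightarrow> bool" where
  "decided \<phi> S \<longleftrightarrow> \<phi> \<in> S \<or> (\<^bold>\<not> \<phi>) \<in> S \<and>
    (\<forall>\<psi>. \<phi> = All \<psi> \<longrightarrow> (\<exists>t. (\<^bold>\<not> inst t \<psi>) \<in> S)) \<and> (\<forall>\<psi>. \<phi> = AllS \<psi> \<longrightarrow> (\<exists>X. (\<^bold>\<not> instS X \<psi>) \<in> S))"

lemma decided_mono: "decided \<phi> S \<Longrightarrow> S \<subseteq> S' \<Longrightarrow> decided \<phi> S'"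
  unfolding decided_def by blast

text \<open>Contexts are finite lists, so there is always a variable fresh for them. It serves as
  the counterexample to a rejected universal formula, and the language needs no new
  constants.\<close>

lemma decide:
  assumes "\<not> derives Ax \<Gamma> Fal"
  shows "\<exists>\<Gamma>'. set \<Gamma> \<subseteq> set \<Gamma>' \<and> \<not> derives Ax \<Gamma>' Fal \<and> decided \<phi> (set \<Gamma>')"
proof (cases "derives Ax (\<phi> # \<Gamma>) Fal")
  case False
  then show ?thesis by (intro exI[of _ "\<phi> # \<Gamma>"]) (auto simp: decided_def)
next
  case True
  have neg: "\<not> derives Ax ((\<^bold>\<not> \<phi>) # \<Gamma>) Fal"
    using assms derives.ImpE[OF derives.ImpI[OF True] derives.Raa] by blast
  have freshAll: "\<exists>n. \<forall>\<gamma>\<in>set (\<psi> # (\<^bold>\<not> \<phi>) # \<Gamma>). fresh_from n \<gamma>" for \<psi>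
    using fresh_from_exists_list by blast
  show ?thesis
  proof (cases "\<exists>\<psi>. \<phi> = All \<psi>")
    case True
    then obtain \<psi> where \<psi>: "\<phi> = All \<psi>" by blast
    obtain m where m: "\<forall>\<gamma>\<in>set (\<psi> # (\<^bold>\<not> \<phi>) # \<Gamma>). fresh_from m \<gamma>" using freshAll by blast
    have "\<not> derives Ax ((\<^bold>\<not> inst (V m) \<psi>) # (\<^bold>\<not> \<phi>) # \<Gamma>) Fal"
    proof
      assume "derives Ax ((\<^bold>\<not> inst (V m) \<psi>) # (\<^bold>\<not> \<phi>) # \<Gamma>) Fal"
      then have "derives Ax ((\<^bold>\<not> \<phi>) # \<Gamma>) \<phi>"
        unfolding \<psi> by (intro generalize_fresh[OF derives.Raa]) (use m \<psi> in auto)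
      then have "derives Ax ((\<^bold>\<not> \<phi>) # \<Gamma>) Fal"
        by (intro derives.ImpE[OF derives.Hyp[of "\<^bold>\<not> \<phi>"]]) auto
      with neg show False by blast
    qed
    then show ?thesis
      by (intro exI[of _ "(\<^bold>\<not> inst (V m) \<psi>) # (\<^bold>\<not> \<phi>) # \<Gamma>"]) (auto simp: decided_def \<psi>)
  next
    case notAll: False
    show ?thesis
    proof (cases "\<exists>\<psi>. \<phi> = AllS \<psi>")
      case True
      then obtain \<psi> where \<psi>: "\<phi> = AllS \<psi>" by blast
      obtain m where m: "\<forall>\<gamma>\<in>set (\<psi> # (\<^bold>\<not> \<phi>) # \<Gamma>). fresh_from m \<gamma>" using freshAll by blast
      have "\<not> derives Ax ((\<^bold>\<not> instS m \<psi>) # (\<^bold>\<not> \<phi>) # \<Gamma>) Fal"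
      proof
        assume "derives Ax ((\<^bold>\<not> instS m \<psi>) # (\<^bold>\<not> \<phi>) # \<Gamma>) Fal"
        then have "derives Ax ((\<^bold>\<not> \<phi>) # \<Gamma>) \<phi>"
          unfolding \<psi> by (intro generalizeS_fresh[OF derives.Raa]) (use m \<psi> in auto)
        then have "derives Ax ((\<^bold>\<not> \<phi>) # \<Gamma>) Fal"
          by (intro derives.ImpE[OF derives.Hyp[of "\<^bold>\<not> \<phi>"]]) auto
        with neg show False by blast
      qed
      then show ?thesis
        by (intro exI[of _ "(\<^bold>\<not> instS m \<psi>) # (\<^bold>\<not> \<phi>) # \<Gamma>"]) (auto simp: decided_def \<psi>)
    next
      case False
      with notAll neg show ?thesis
        by (intro exI[of _ "(\<^bold>\<not> \<phi>) # \<Gamma>"]) (auto simp: decided_def)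
    qed
  qed
qed

locale henkin =
  fixes Ax :: "fm set" and S :: "fm set"
  assumes consistent: "set \<Gamma> \<subseteq> S \<Longrightarrow> \<not> derives Ax \<Gamma> Fal"
    and decided: "decided \<phi> S"

text \<open>Stage \<open>n\<close> decides the formula with number \<open>n\<close>. Every stage is
  a finite list, and a finite part of the union already lies in one stage, which gives
  consistency.\<close>

lemma henkin_extension:
  assumes "\<not> derives Ax \<Gamma> Fal"
  shows "\<exists>S. set \<Gamma> \<subseteq> S \<and> henkin Ax S"
proof -
  have "\<exists>G. \<forall>n. (\<not> derives Ax (G n) Fal \<and> set \<Gamma> \<subseteq> set (G n)) \<and>
    (set (G n) \<subseteq> set (G (Suc n)) \<and> decided (from_nat n) (set (G (Suc n))))"
  proof (rule dependent_nat_choice)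
    show "\<exists>\<Delta>. \<not> derives Ax \<Delta> Fal \<and> set \<Gamma> \<subseteq> set \<Delta>" using assms by blast
    show "\<exists>\<Delta>'. (\<not> derives Ax \<Delta>' Fal \<and> set \<Gamma> \<subseteq> set \<Delta>') \<and> set \<Delta> \<subseteq> set \<Delta>' \<and> decided (from_nat n) (set \<Delta>')"
      if "\<not> derives Ax \<Delta> Fal \<and> set \<Gamma> \<subseteq> set \<Delta>" for \<Delta> n
      using decide[of Ax \<Delta> "from_nat n"] that by blast
  qed
  then obtain G where G: "\<And>n. \<not> derives Ax (G n) Fal" "\<And>n. set \<Gamma> \<subseteq> set (G n)"
    "\<And>n. set (G n) \<subseteq> set (G (Suc n))" "\<And>n. decided (from_nat n) (set (G (Suc n)))" by blast
  have mono: "set (G m) \<subseteq> set (G n)" if "m \<le> n" for m n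
    using that G(3) by (rule lift_Suc_mono_le[of "\<lambda>n. set (G n)", rotated])
  have "henkin Ax (\<Union>n. set (G n))"
  proof
    fix \<Delta> assume \<Delta>: "set \<Delta> \<subseteq> (\<Union>n. set (G n))"
    have "\<exists>n. set \<Delta> \<subseteq> set (G n)" using \<Delta>
    proof (induction \<Delta>)
      case (Cons \<delta> \<Delta>)
      then obtain m n where "set \<Delta> \<subseteq> set (G m)" "\<delta> \<in> set (G n)" by auto
      then show ?case using mono[of m "max m n"] mono[of n "max m n"]
        by (intro exI[of _ "max m n"]) auto
    qed simp
    with G(1) show "\<not> derives Ax \<Delta> Fal" by (blast intro: weaken)
  next
    fix \<phi> :: fm
    have "decided \<phi> (set (G (Suc (to_nat \<phi>))))" using G(4)[of "to_nat \<phi>"] by simp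
    then show "decided \<phi> (\<Union>n. set (G n))"
      by (rule decided_mono) blast
  qed
  moreover have "set \<Gamma> \<subseteq> (\<Union>n. set (G n))" using G(2)[of 0] by blast
  ultimately show ?thesis by blast
qed

context henkin
begin

lemma closed: "derives Ax \<Gamma> \<phi> \<Longrightarrow> set \<Gamma> \<subseteq> S \<Longrightarrow> \<phi> \<in> S"
proof (rule ccontr)
  assume d: "derives Ax \<Gamma> \<phi>" "set \<Gamma> \<subseteq> S" "\<phi> \<notin> S"
  then have "(\<^bold>\<not> \<phi>) \<in> S" using decided[of \<phi>] by (auto simp: decided_def)
  moreover have "derives Ax ((\<^bold>\<not> \<phi>) # \<Gamma>) Fal"
    by (rule derives.ImpE[OF derives.Hyp[of "\<^bold>\<not> \<phi>"]]) (use d in \<open>auto intro: weaken\<close>)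
  ultimately show False using consistent[of "(\<^bold>\<not> \<phi>) # \<Gamma>"] d by auto
qed

lemma modus_ponens: "(\<phi> \<^bold>\<longrightarrow> \<psi>) \<in> S \<Longrightarrow> \<phi> \<in> S \<Longrightarrow> \<psi> \<in> S"
  by (rule closed[of "[\<phi> \<^bold>\<longrightarrow> \<psi>, \<phi>]"]) (auto intro: derives.ImpE[OF derives.Hyp derives.Hyp])

lemma Fal_notin: "Fal \<notin> S"
  using consistent[of "[Fal]"] derives.Hyp[of Fal "[Fal]" Ax] by auto

lemma Imp_iff: "(\<phi> \<^bold>\<longrightarrow> \<psi>) \<in> S \<longleftrightarrow> (\<phi> \<in> S \<longrightarrow> \<psi> \<in> S)"
proof
  assume "\<phi> \<in> S \<longrightarrow> \<psi> \<in> S"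
  moreover have "(\<phi> \<^bold>\<longrightarrow> \<psi>) \<in> S" if "\<psi> \<in> S"
    using that by (intro closed[of "[\<psi>]"] derives.ImpI derives.Hyp) auto
  moreover have "(\<phi> \<^bold>\<longrightarrow> \<psi>) \<in> S" if "(\<^bold>\<not> \<phi>) \<in> S"
  proof (rule closed[of "[\<^bold>\<not> \<phi>]"])
    show "derives Ax [\<^bold>\<not> \<phi>] (\<phi> \<^bold>\<longrightarrow> \<psi>)"
      by (rule derives.ImpI, rule derives.Raa, rule derives.ImpE[of _ _ \<phi>]) (auto intro: derives.Hyp)
  qed (use that in auto)
  ultimately show "(\<phi> \<^bold>\<longrightarrow> \<psi>) \<in> S" using decided[of \<phi>] by (auto simp: decided_def)
qed (use modus_ponens in blast)

lemma All_iff: "All \<phi> \<in> S \<longleftrightarrow> (\<forall>t. inst t \<phi> \<in> S)"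
proof
  show "\<forall>t. inst t \<phi> \<in> S" if "All \<phi> \<in> S"
    using that by (auto intro!: closed[of "[All \<phi>]", OF derives.AllE[OF derives.Hyp]])
  show "All \<phi> \<in> S" if "\<forall>t. inst t \<phi> \<in> S"
    using that decided[of "All \<phi>"] Imp_iff Fal_notin by (auto simp: decided_def)
qed

lemma AllS_iff: "AllS \<phi> \<in> S \<longleftrightarrow> (\<forall>X. instS X \<phi> \<in> S)"
proof
  show "\<forall>X. instS X \<phi> \<in> S" if "AllS \<phi> \<in> S"
    using that by (auto intro!: closed[of "[AllS \<phi>]", OF derives.AllSE[OF derives.Hyp]])
  show "AllS \<phi> \<in> S" if "\<forall>X. instS X \<phi> \<in> S"
    using that decided[of "AllS \<phi>"] Imp_iff Fal_notin by (auto simp: decided_def)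
qed

definition cls :: "tm \<Rightarrow> tm set" where "cls t = {u. (t \<^bold>= u) \<in> S}"

lemma eq_refl: "(t \<^bold>= t) \<in> S"
  by (rule closed[of "[]"]) (auto intro: derives.EqRefl)

lemma eq_subst: "(t \<^bold>= u) \<in> S \<Longrightarrow> inst t \<phi> \<in> S \<Longrightarrow> inst u \<phi> \<in> S"
  by (rule closed[of "[t \<^bold>= u, inst t \<phi>]"]) (auto intro: derives.EqSubst[OF derives.Hyp[of "t \<^bold>= u"] derives.Hyp])

lemma tsub_case_shift [simp]: "tsub (case_nat t V) (u \<up> Suc 0) = u"
  by (simp add: tsub_shift)

lemma eq_sym: "(t \<^bold>= u) \<in> S \<Longrightarrow> (u \<^bold>= t) \<in> S"
  using eq_subst[of t u "V 0 \<^bold>= t \<up> Suc 0"] eq_refl by (simp add: inst_def)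

lemma eq_trans: "(t \<^bold>= u) \<in> S \<Longrightarrow> (u \<^bold>= v) \<in> S \<Longrightarrow> (t \<^bold>= v) \<in> S"
  using eq_subst[of u v "t \<up> Suc 0 \<^bold>= V 0"] by (simp add: inst_def)

lemma cls_eq_iff: "cls t = cls u \<longleftrightarrow> (t \<^bold>= u) \<in> S"
  unfolding cls_def using eq_refl eq_sym eq_trans by blast

lemma eq_cong:
  assumes "(t \<^bold>= t') \<in> S" "(u \<^bold>= u') \<in> S"
  shows "(t \<^bold>+ u \<^bold>= t' \<^bold>+ u') \<in> S" "(t \<^bold>* u \<^bold>= t' \<^bold>* u') \<in> S" "(t \<^bold>^ u \<^bold>= t' \<^bold>^ u') \<in> S"
    "(t \<^bold>< u) \<in> S \<longleftrightarrow> (t' \<^bold>< u') \<in> S" "(t \<^bold>\<in> X) \<in> S \<longleftrightarrow> (t' \<^bold>\<in> X) \<in> S"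
proof -
  \<comment> \<open>Replacement acts on one hole, so the arguments are exchanged one after the
    other. The three operations are treated alike because each commutes with
    \<open>tsub\<close>.\<close>
  have "(f t u \<^bold>= f t' u') \<in> S" if f: "\<And>\<sigma> a b. tsub \<sigma> (f a b) = f (tsub \<sigma> a) (tsub \<sigma> b)" for f
  proof (rule eq_trans)
    show "(f t u \<^bold>= f t' u) \<in> S"
      using eq_subst[OF assms(1), of "f (t \<up> Suc 0) (u \<up> Suc 0) \<^bold>= f (V 0) (u \<up> Suc 0)"] eq_refl
      by (simp add: inst_def f)
    show "(f t' u \<^bold>= f t' u') \<in> S"
      using eq_subst[OF assms(2), of "f (t' \<up> Suc 0) (u \<up> Suc 0) \<^bold>= f (t' \<up> Suc 0) (V 0)"] eq_refl
      by (simp add: inst_def f)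
  qed
  from this[of Add] this[of Mul] this[of Exp]
  show "(t \<^bold>+ u \<^bold>= t' \<^bold>+ u') \<in> S" "(t \<^bold>* u \<^bold>= t' \<^bold>* u') \<in> S" "(t \<^bold>^ u \<^bold>= t' \<^bold>^ u') \<in> S" by simp_all
  have less: "(a' \<^bold>< b') \<in> S" if "(a \<^bold>= a') \<in> S" "(b \<^bold>= b') \<in> S" "(a \<^bold>< b) \<in> S" for a b a' b'
    using eq_subst[OF that(1), of "V 0 \<^bold>< b \<up> Suc 0"] eq_subst[OF that(2), of "a' \<up> Suc 0 \<^bold>< V 0"] that(3)
    by (simp add: inst_def)
  show "(t \<^bold>< u) \<in> S \<longleftrightarrow> (t' \<^bold>< u') \<in> S" using less assms eq_sym by blast
  have mem: "(a' \<^bold>\<in> X) \<in> S" if "(a \<^bold>= a') \<in> S" "(a \<^bold>\<in> X) \<in> S" for a a'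
    using eq_subst[OF that(1), of "V 0 \<^bold>\<in> X"] that(2) by (simp add: inst_def)
  show "(t \<^bold>\<in> X) \<in> S \<longleftrightarrow> (t' \<^bold>\<in> X) \<in> S" using mem assms eq_sym by blast
qed

end

text \<open>The numbers of the term model are enumerated by \<open>nat\<close>, which requires infinitely many of them.\<close>

locale henkin_infinite = henkin +
  assumes infinite_cls: "infinite (range cls)"
begin

definition code :: "tm \<Rightarrow> nat" where "code t = to_nat_on (range cls) (cls t)"
definition term_of :: "nat \<Rightarrow> tm" where "term_of = inv code"

lemma code_eq_iff [simp]: "code t = code u \<longleftrightarrow> (t \<^bold>= u) \<in> S"
proof -
  have "countable (range cls)" by (intro countable_image countableI_type)
  then have "to_nat_on (range cls) (cls t) = to_nat_on (range cls) (cls u) \<longleftrightarrow> cls t = cls u"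
    by (intro to_nat_on_inj) auto
  then show ?thesis unfolding code_def cls_eq_iff .
qed

lemma code_surj: "surj code"
proof -
  have "range code = to_nat_on (range cls) ` range cls" by (auto simp: code_def)
  also have "\<dots> = UNIV" using infinite_cls by (intro image_to_nat_on) auto
  finally show ?thesis .
qed

lemma code_term_of [simp]: "code (term_of n) = n"
  unfolding term_of_def by (rule surj_f_inv_f[OF code_surj])

lemma term_of_code: "(t \<^bold>= term_of (code t)) \<in> S"
  using code_term_of[of "code t"] unfolding code_eq_iff using eq_sym by blast

definition \<M> :: "(nat, nat) struct" where
  "\<M> = \<lparr>zero_of = code \<^bold>0, one_of = code \<^bold>1, plus_of = (\<lambda>m n. code (term_of m \<^bold>+ term_of n)),
    times_of = (\<lambda>m n. code (term_of m \<^bold>* term_of n)), exp_of = (\<lambda>m n. code (term_of m \<^bold>^ term_of n)),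
    less_of = (\<lambda>m n. (term_of m \<^bold>< term_of n) \<in> S), mem_of = (\<lambda>m X. (term_of m \<^bold>\<in> X) \<in> S)\<rparr>"

lemma val_\<M>: "val \<M> (\<lambda>i. code (\<sigma> i)) t = code (tsub \<sigma> t)"
  by (induction t) (auto simp: \<M>_def intro!: eq_cong eq_sym[OF term_of_code])

text \<open>The truth lemma. Elements are codes of terms, so an assignment is a substitution
  \<open>\<sigma>\<close> followed by \<open>code\<close>; set variables denote themselves.
  Arbitrary \<open>\<sigma>\<close> and \<open>\<rho>\<close> are needed to pass under
  quantifiers.\<close>

lemma sat_\<M>: "sat \<M> (\<lambda>i. code (\<sigma> i)) \<rho> \<phi> \<longleftrightarrow> sub \<sigma> \<rho> \<phi> \<in> S"
proof (induction \<phi> arbitrary: \<sigma> \<rho>)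
  case (Less t u)
  then show ?case
    using eq_cong(4)[OF term_of_code term_of_code, of "tsub \<sigma> t" "tsub \<sigma> u"] val_\<M>
    by (simp add: \<M>_def)
next
  case (Mem t X)
  then show ?case using eq_cong(5)[OF term_of_code eq_refl, of "tsub \<sigma> t"] val_\<M>
    by (simp add: \<M>_def)
next
  case (All \<psi>)
  have "sat \<M> (case_nat (code t) (\<lambda>i. code (\<sigma> i))) \<rho> \<psi> \<longleftrightarrow>
    inst t (sub (case_nat (V 0) (\<lambda>i. \<sigma> i \<up> 1)) \<rho> \<psi>) \<in> S" for t
  proof -
    have "case_nat (code t) (\<lambda>i. code (\<sigma> i)) = (\<lambda>i. code (case_nat t \<sigma> i))" by (auto split: nat.split)
    moreover have "(\<lambda>i. tsub (case_nat t V) (case_nat (V 0) (\<lambda>i. \<sigma> i \<up> 1) i)) = case_nat t \<sigma>"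
      by (auto split: nat.split)
    moreover have "sat \<M> (\<lambda>i. code (case_nat t \<sigma> i)) \<rho> \<psi> \<longleftrightarrow> sub (case_nat t \<sigma>) \<rho> \<psi> \<in> S"
      by (rule All.IH)
    ultimately show ?thesis by (simp only: inst_def sub_sub id_apply)
  qed
  moreover have "(\<forall>x. Q x) \<longleftrightarrow> (\<forall>t. Q (code t))" for Q
    using code_term_of by metis
  ultimately show ?case by (simp only: sat.simps sub.simps All_iff)
next
  case (AllS \<psi>)
  have "sat \<M> (\<lambda>i. code (\<sigma> i)) (case_nat X \<rho>) \<psi> \<longleftrightarrow>
    instS X (sub \<sigma> (case_nat 0 (\<lambda>i. Suc (\<rho> i))) \<psi>) \<in> S" for X
  proof -
    have "(\<lambda>i. case_nat X id (case_nat 0 (\<lambda>i. Suc (\<rho> i)) i)) = case_nat X \<rho>"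
      by (auto split: nat.split)
    moreover have "sat \<M> (\<lambda>i. code (\<sigma> i)) (case_nat X \<rho>) \<psi> \<longleftrightarrow> sub \<sigma> (case_nat X \<rho>) \<psi> \<in> S"
      by (rule AllS.IH)
    ultimately show ?thesis by (simp only: instS_def sub_sub tsub_V)
  qed
  then show ?case by (simp only: sat.simps sub.simps AllS_iff)
qed (use val_\<M> Imp_iff Fal_notin in auto)

lemma model: "derives Ax [] \<phi> \<Longrightarrow> sat \<M> e s \<phi>"
  using sat_\<M>[of "\<lambda>i. term_of (e i)" s \<phi>] theorem_instance[of Ax \<phi> "[]"] closed[of "[]"] by simp

end

text \<open>The carrier is to be \<open>nat\<close> itself, so the term model must be infinite. The
  two successor axioms ensure this, as they make the numerals pairwise inequivalent in
  \<open>S\<close>.\<close>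

theorem completeness:
  assumes "\<not> derives Ax [] \<phi>" and "basic_axioms \<subseteq> Ax"
  shows "\<exists>\<M> :: (nat, nat) struct. (\<forall>\<psi>\<in>Ax. \<forall>e s. sat \<M> e s \<psi>) \<and> (\<exists>e s. \<not> sat \<M> e s \<phi>)"
proof -
  have "\<not> derives Ax [\<^bold>\<not> \<phi>] Fal" using assms(1) derives.Raa by blast
  then obtain S where S: "set [\<^bold>\<not> \<phi>] \<subseteq> S" "henkin Ax S" using henkin_extension by blast
  interpret henkin Ax S by fact
  define num where "num = rec_nat \<^bold>0 (\<lambda>_ t. t \<^bold>+ \<^bold>1)"
  have num [simp]: "num 0 = \<^bold>0" "num (Suc n) = num n \<^bold>+ \<^bold>1" for n by (simp_all add: num_def)
  have axiom: "sub \<sigma> id \<psi> \<in> S" if "\<psi> \<in> basic_axioms" for \<sigma> \<psi>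
    using that assms(2) by (intro closed[of "[]"] theorem_instance derives.Ax) auto
  have not_zero: "(t \<^bold>+ \<^bold>1 \<^bold>= \<^bold>0) \<notin> S" for t
    using axiom[of "\<^bold>\<not> (V 0 \<^bold>+ \<^bold>1 \<^bold>= \<^bold>0)" "\<lambda>_. t"] Imp_iff Fal_notin by (auto simp: basic_axioms_def)
  have succ_inj: "(t \<^bold>= u) \<in> S" if "(t \<^bold>+ \<^bold>1 \<^bold>= u \<^bold>+ \<^bold>1) \<in> S" for t u
    using axiom[of "V 0 \<^bold>+ \<^bold>1 \<^bold>= V 1 \<^bold>+ \<^bold>1 \<^bold>\<longrightarrow> V 0 \<^bold>= V 1" "case_nat t (\<lambda>_. u)"] that Imp_iff
    by (auto simp: basic_axioms_def)
  have "m = n" if "(num m \<^bold>= num n) \<in> S" for m n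
    using that
  proof (induction m arbitrary: n)
    case 0
    then show ?case using not_zero eq_sym by (cases n) (simp, metis num)
  next
    case (Suc m)
    then show ?case using not_zero succ_inj by (cases n) (metis num, metis num)
  qed
  then have "inj (\<lambda>n. cls (num n))" by (auto simp: inj_def cls_eq_iff)
  then have "infinite (range (\<lambda>n. cls (num n)))" by (rule range_inj_infinite)
  then have "infinite (range cls)" by (rule contrapos_nn) (erule finite_subset[rotated], auto)
  then interpret henkin_infinite Ax S by unfold_locales
  have "\<not> sat \<M> (\<lambda>i. code (V i)) (\<lambda>i. i) \<phi>"
    using sat_\<M>[of V "\<lambda>i. i" \<phi>] S(1) Imp_iff Fal_notin by auto
  then show ?thesis using model derives.Ax by blast
qed

section \<open>Definability in a model\<close>

lemma delta0_sub: "delta0 \<phi> \<Longrightarrow> delta0 (sub \<sigma> \<rho> \<phi>)"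
proof (induction arbitrary: \<sigma> \<rho> rule: delta0.induct)
  case (6 \<phi> t)
  have "sub \<sigma> \<rho> (BAll t \<phi>) = BAll (tsub \<sigma> t) (sub (case_nat (V 0) (\<lambda>i. \<sigma> i \<up> 1)) \<rho> \<phi>)"
    by (simp add: BAll_def tsub_shift shift_tsub)
  then show ?case using 6 by (simp add: delta0.intros del: One_nat_def)
next
  case (7 \<phi> t)
  have "sub \<sigma> \<rho> (BEx t \<phi>) = BEx (tsub \<sigma> t) (sub (case_nat (V 0) (\<lambda>i. \<sigma> i \<up> 1)) \<rho> \<phi>)"
    by (simp add: BEx_def tsub_shift shift_tsub)
  then show ?case using 7 by (simp add: delta0.intros del: One_nat_def)
qed (auto intro: delta0.intros)

locale rca_model =
  fixes \<M> :: "('a :: countable, 's :: countable) struct"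
  assumes axiom: "\<phi> \<in> RCA0star \<Longrightarrow> sat \<M> e s \<phi>"
begin

abbreviation zero (\<open>\<zero>\<close>) where "\<zero> \<equiv> zero_of \<M>"
abbreviation one (\<open>\<one>\<close>) where "\<one> \<equiv> one_of \<M>"
abbreviation plus (infixl \<open>\<oplus>\<close> 65) where "(\<oplus>) \<equiv> plus_of \<M>"
abbreviation times (infixl \<open>\<otimes>\<close> 70) where "(\<otimes>) \<equiv> times_of \<M>"
abbreviation less (infix \<open>\<prec>\<close> 50) where "(\<prec>) \<equiv> less_of \<M>"
abbreviation mem (infix \<open>\<triangleleft>\<close> 50) where "(\<triangleleft>) \<equiv> mem_of \<M>"

definition le (infix \<open>\<preceq>\<close> 50) where "x \<preceq> y \<longleftrightarrow> x \<prec> y \<or> x = y"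

definition two where "two = \<one> \<oplus> \<one>"
definition pow2 where "pow2 x = exp_of \<M> two x"
definition pr where "pr x y = (x \<oplus> y) \<otimes> (x \<oplus> y) \<oplus> x"

text \<open>A \<open>\<Delta>\<^sup>0\<^sub>0\<close> formula with parameters: since the model is countable, its odd-numbered variables can be
  reserved for an enumeration of all elements, and its set variables for one of all sets.\<close>

definition with_params :: "(nat \<Rightarrow> 'a) \<Rightarrow> nat \<Rightarrow> 'a" where
  "with_params e i = (if even i then e (i div 2) else from_nat (i div 2))"

definition definable_tm :: "((nat \<Rightarrow> 'a) \<Rightarrow> 'a) \<Rightarrow> bool" where
  "definable_tm f \<longleftrightarrow> (\<exists>t. \<forall>e. f e = val \<M> (with_params e) t)"

text \<open>Working with HOL predicates of an environment avoids writing de Bruijn formulas: the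
  rules in \<open>def_intros\<close> build the formula by following the syntax of the predicate.
  Only bounded quantifiers have such rules, so quantifiers below are given bounds wherever induction
  or comprehension is to apply.\<close>

definition definable :: "((nat \<Rightarrow> 'a) \<Rightarrow> bool) \<Rightarrow> bool" where
  "definable Q \<longleftrightarrow> (\<exists>\<phi>. delta0 \<phi> \<and> (\<forall>e. Q e \<longleftrightarrow> sat \<M> (with_params e) from_nat \<phi>))"

named_theorems def_intros

lemma definable_var [def_intros]: "definable_tm (\<lambda>e. e i)"
  unfolding definable_tm_def by (rule exI[of _ "V (2 * i)"]) (simp add: with_params_def)

lemma definable_const [def_intros]: "definable_tm (\<lambda>e. c)"
  unfolding definable_tm_def by (rule exI[of _ "V (2 * to_nat c + 1)"]) (simp add: with_params_def)

lemma definable_plus [def_intros]: "definable_tm f \<Longrightarrow> definable_tm g \<Longrightarrow> definable_tm (\<lambda>e. f e \<oplus> g e)"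
  unfolding definable_tm_def by (metis val.simps(4))

lemma definable_times [def_intros]: "definable_tm f \<Longrightarrow> definable_tm g \<Longrightarrow> definable_tm (\<lambda>e. f e \<otimes> g e)"
  unfolding definable_tm_def by (metis val.simps(5))

lemma definable_pow2 [def_intros]: "definable_tm f \<Longrightarrow> definable_tm (\<lambda>e. pow2 (f e))"
  unfolding definable_tm_def pow2_def two_def by (metis val.simps(3,4,6))

lemma definable_pr [def_intros]: "definable_tm f \<Longrightarrow> definable_tm g \<Longrightarrow> definable_tm (\<lambda>e. pr (f e) (g e))"
  unfolding pr_def by (intro def_intros)

lemma definable_False: "definable (\<lambda>e. False)"
  unfolding definable_def by (rule exI[of _ Fal]) (simp add: delta0.intros)

lemma definable_eq [def_intros]: "definable_tm f \<Longrightarrow> definable_tm g \<Longrightarrow> definable (\<lambda>e. f e = g e)"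
  unfolding definable_def definable_tm_def by (metis sat.simps(2) delta0.intros(2))

lemma definable_less [def_intros]: "definable_tm f \<Longrightarrow> definable_tm g \<Longrightarrow> definable (\<lambda>e. f e \<prec> g e)"
  unfolding definable_def definable_tm_def by (metis sat.simps(3) delta0.intros(3))

lemma definable_mem [def_intros]: "definable_tm f \<Longrightarrow> definable (\<lambda>e. f e \<triangleleft> X)"
  unfolding definable_def definable_tm_def
  by (metis sat.simps(4) delta0.intros(4) from_nat_to_nat)

lemma definable_imp [def_intros]: "definable Q \<Longrightarrow> definable Q' \<Longrightarrow> definable (\<lambda>e. Q e \<longrightarrow> Q' e)"
  unfolding definable_def by (metis sat.simps(5) delta0.intros(5))

lemma definable_not [def_intros]: "definable Q \<Longrightarrow> definable (\<lambda>e. \<not> Q e)"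
  using definable_imp[OF _ definable_False] by simp

lemma definable_or [def_intros]: "definable Q \<Longrightarrow> definable Q' \<Longrightarrow> definable (\<lambda>e. Q e \<or> Q' e)"
  using definable_imp[OF definable_not] by (simp add: disj_imp)

lemma definable_and [def_intros]: "definable Q \<Longrightarrow> definable Q' \<Longrightarrow> definable (\<lambda>e. Q e \<and> Q' e)"
  using definable_not[OF definable_imp[OF _ definable_not]] by simp

lemma definable_iff [def_intros]: "definable Q \<Longrightarrow> definable Q' \<Longrightarrow> definable (\<lambda>e. Q e \<longleftrightarrow> Q' e)"
  unfolding iff_conv_conj_imp by (intro def_intros)

lemma definable_le [def_intros]: "definable_tm f \<Longrightarrow> definable_tm g \<Longrightarrow> definable (\<lambda>e. f e \<preceq> g e)"
  unfolding le_def by (intro def_intros)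

text \<open>A quantifier inserts one variable in front of all others, whereas
  \<open>with_params\<close> expects the new one among the even indices and the parameters left in
  place. The renaming reconciles the two numberings.\<close>

lemma sat_bind_params:
  "sat \<M> (case_nat x (with_params e)) s (sub (\<lambda>i. V (if i = 0 then 0 else if even i then i - 1 else Suc i)) id \<phi>)
    \<longleftrightarrow> sat \<M> (with_params (case_nat x e)) s \<phi>"
proof -
  have "(\<lambda>i. val \<M> (case_nat x (with_params e)) (V (if i = 0 then 0 else if even i then i - 1 else Suc i)))
    = with_params (case_nat x e)"
    by (auto simp: with_params_def fun_eq_iff elim!: evenE split: nat.split)
  then show ?thesis by (simp add: sat_sub)
qed

text \<open>In the premise the bound variable is entry 0 and the old environment is the tail, so
  resolution can strip quantifiers one by one.\<close>

lemma definable_ball [def_intros]: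
  assumes "definable_tm f" "definable (\<lambda>e. Q (\<lambda>i. e (Suc i)) (e 0))"
  shows "definable (\<lambda>e. \<forall>x. x \<prec> f e \<longrightarrow> Q e x)"
proof -
  obtain t where t: "\<And>e. f e = val \<M> (with_params e) t" using assms(1) definable_tm_def by auto
  obtain \<phi> where \<phi>: "delta0 \<phi>" "\<And>e. Q (\<lambda>i. e (Suc i)) (e 0) \<longleftrightarrow> sat \<M> (with_params e) from_nat \<phi>"
    using assms(2) definable_def by auto
  let ?\<psi> = "sub (\<lambda>i. V (if i = 0 then 0 else if even i then i - 1 else Suc i)) id \<phi>"
  have "sat \<M> (with_params e) from_nat (BAll t ?\<psi>) \<longleftrightarrow> (\<forall>x. x \<prec> f e \<longrightarrow> Q e x)" for e
    using \<phi>(2)[of "case_nat _ e"] by (simp add: BAll_def sat_bind_params t)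
  moreover have "delta0 (BAll t ?\<psi>)" by (intro delta0.intros delta0_sub \<phi>)
  ultimately show ?thesis unfolding definable_def by blast
qed

lemma definable_bex [def_intros]:
  assumes "definable_tm f" "definable (\<lambda>e. Q (\<lambda>i. e (Suc i)) (e 0))"
  shows "definable (\<lambda>e. \<exists>x. x \<prec> f e \<and> Q e x)"
  using definable_not[OF definable_ball[OF assms(1), of "\<lambda>e x. \<not> Q e x"]] definable_not[OF assms(2)] by simp

lemma induction [case_names definable zero suc]:
  assumes "definable (\<lambda>e. Q (e 0))" "Q \<zero>" "\<And>x. Q x \<Longrightarrow> Q (x \<oplus> \<one>)"
  shows "Q x"
proof -
  obtain \<phi> where \<phi>: "delta0 \<phi>" "\<And>e. Q (e 0) \<longleftrightarrow> sat \<M> (with_params e) from_nat \<phi>"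
    using assms(1) definable_def by auto
  let ?\<psi> = "sub (\<lambda>i. V (if i = 0 then 0 else if even i then i - 1 else Suc i)) id \<phi>"
  let ?e = "with_params (\<lambda>_. \<zero>)"
  have \<psi>: "sat \<M> (case_nat x ?e) from_nat ?\<psi> \<longleftrightarrow> Q x" for x
    using \<phi>(2)[of "case_nat x _"] by (simp add: sat_bind_params)
  have step: "sat \<M> (case_nat x ?e) from_nat (sub (case_nat (V 0 \<^bold>+ \<^bold>1) (\<lambda>i. V (Suc i))) id \<chi>)
    \<longleftrightarrow> sat \<M> (case_nat (x \<oplus> \<one>) ?e) from_nat \<chi>" for x \<chi>
  proof -
    have "(\<lambda>i. val \<M> (case_nat x ?e) (case_nat (V 0 \<^bold>+ \<^bold>1) (\<lambda>i. V (Suc i)) i)) = case_nat (x \<oplus> \<one>) ?e"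
      by (auto split: nat.split)
    then show ?thesis by (simp add: sat_sub)
  qed
  have "delta0 ?\<psi>" by (intro delta0_sub \<phi>)
  then have "sat \<M> ?e from_nat (inst \<^bold>0 ?\<psi> \<^bold>\<and>
    All (?\<psi> \<^bold>\<longrightarrow> sub (case_nat (V 0 \<^bold>+ \<^bold>1) (\<lambda>i. V (Suc i))) id ?\<psi>) \<^bold>\<longrightarrow> All ?\<psi>)"
    by (intro axiom) (auto simp: RCA0star_def delta0_induction_def)
  then have "((Q \<zero> \<longrightarrow> (\<forall>x. Q x \<longrightarrow> Q (x \<oplus> \<one>)) \<longrightarrow> False) \<longrightarrow> False) \<longrightarrow> (\<forall>x. Q x)"
    unfolding sat.simps sat_inst val.simps step \<psi> .
  moreover have "\<forall>x. Q x \<longrightarrow> Q (x \<oplus> \<one>)" using assms(3) by blast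
  moreover have "((A \<longrightarrow> B \<longrightarrow> False) \<longrightarrow> False) \<longrightarrow> C \<Longrightarrow> A \<Longrightarrow> B \<Longrightarrow> C" for A B C by blast
  ultimately have "\<forall>x. Q x" using assms(2) by meson
  then show ?thesis ..
qed

lemma comprehension:
  assumes "definable (\<lambda>e. A (e 1) (e 0))" "definable (\<lambda>e. B (e 1) (e 0))"
    and iff: "\<And>x. (\<exists>y. A x y) \<longleftrightarrow> (\<forall>y. B x y)"
  shows "\<exists>X. \<forall>x. x \<triangleleft> X \<longleftrightarrow> (\<exists>y. A x y)"
proof -
  \<comment> \<open>In the comprehension scheme \<open>V 0\<close> is the witness and
    \<open>V 1\<close> the number, but \<open>with_params\<close> puts these two at the indices 0
    and 2.\<close>
  let ?\<sigma> = "\<lambda>i. V (if i = 0 then 0 else if i = 2 then 1 else if even i then i - 2 else i + 2)"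
  let ?e = "with_params (\<lambda>_. \<zero>)"
  have \<sigma>: "(\<lambda>i. val \<M> (case_nat y (case_nat x ?e)) (?\<sigma> i)) = with_params (case_nat y (case_nat x (\<lambda>_. \<zero>)))" for x y
    by (auto simp: with_params_def fun_eq_iff double_not_eq_Suc_double elim!: evenE oddE split: nat.split)
  obtain \<phi> where \<phi>: "delta0 \<phi>" "\<And>e. A (e 1) (e 0) \<longleftrightarrow> sat \<M> (with_params e) from_nat \<phi>"
    using assms(1) definable_def by auto
  obtain \<psi> where \<psi>: "delta0 \<psi>" "\<And>e. B (e 1) (e 0) \<longleftrightarrow> sat \<M> (with_params e) from_nat \<psi>"
    using assms(2) definable_def by auto
  let ?\<theta> = "sub ?\<sigma> id \<phi>"
  let ?\<eta> = "sub ?\<sigma> id \<psi>"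
  have A: "sat \<M> (case_nat y (case_nat x ?e)) from_nat ?\<theta> \<longleftrightarrow> A x y" for x y
    unfolding sat_sub \<sigma> using \<phi>(2)[of "case_nat y (case_nat x _)"] by simp
  have B: "sat \<M> (case_nat y (case_nat x ?e)) from_nat ?\<eta> \<longleftrightarrow> B x y" for x y
    unfolding sat_sub \<sigma> using \<psi>(2)[of "case_nat y (case_nat x _)"] by simp
  have "sat \<M> ?e from_nat (All (Ex ?\<theta> \<^bold>\<longleftrightarrow> All ?\<eta>) \<^bold>\<longrightarrow> ExS (All (V 0 \<^bold>\<in> 0 \<^bold>\<longleftrightarrow> liftS (Ex ?\<theta>))))"
    by (intro axiom) (unfold RCA0star_def delta1_comprehension_def, blast intro: delta0_sub \<phi> \<psi>)
  moreover have "sat \<M> e (case_nat X s) (liftS \<chi>) \<longleftrightarrow> sat \<M> e s \<chi>" for e X s \<chi>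
    by (simp add: liftS_def sat_sub)
  ultimately have "\<exists>X. \<forall>x. (x \<triangleleft> X \<longrightarrow> (\<forall>y. B x y)) \<and> ((\<exists>y. \<not> B x y) \<or> x \<triangleleft> X)"
    using iff A B by simp
  then show ?thesis unfolding iff by (elim ex_forward) blast
qed

lemma comprehension0:
  assumes "definable (\<lambda>e. A (e 1))"
  shows "\<exists>X. \<forall>x. x \<triangleleft> X \<longleftrightarrow> A x"
  using comprehension[of "\<lambda>x y. A x" "\<lambda>x y. A x"] assms by simp

lemma basic:
  "x \<oplus> \<one> \<noteq> \<zero>" "x \<oplus> \<one> = y \<oplus> \<one> \<Longrightarrow> x = y" "x \<oplus> \<zero> = x" "x \<oplus> (y \<oplus> \<one>) = (x \<oplus> y) \<oplus> \<one>"
  "x \<otimes> \<zero> = \<zero>" "x \<otimes> (y \<oplus> \<one>) = x \<otimes> y \<oplus> x" "\<not> x \<prec> \<zero>" "x \<prec> y \<oplus> \<one> \<longleftrightarrow> x \<prec> y \<or> x = y"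
  "exp_of \<M> x \<zero> = \<one>" "exp_of \<M> x (y \<oplus> \<one>) = exp_of \<M> x y \<otimes> x"
proof -
  have "\<forall>\<phi>\<in>basic_axioms. sat \<M> (case_nat x (\<lambda>_. y)) undefined \<phi>"
    using axiom by (simp add: RCA0star_def)
  note * = this[unfolded basic_axioms_def Set.ball_simps sat.simps val.simps One_nat_def nat.case]
  show "x \<oplus> \<one> \<noteq> \<zero>" "x \<oplus> \<one> = y \<oplus> \<one> \<Longrightarrow> x = y" "x \<oplus> \<zero> = x" "x \<oplus> (y \<oplus> \<one>) = (x \<oplus> y) \<oplus> \<one>"
    "x \<otimes> \<zero> = \<zero>" "x \<otimes> (y \<oplus> \<one>) = x \<otimes> y \<oplus> x" "\<not> x \<prec> \<zero>" "x \<prec> y \<oplus> \<one> \<longleftrightarrow> x \<prec> y \<or> x = y"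
    "exp_of \<M> x \<zero> = \<one>" "exp_of \<M> x (y \<oplus> \<one>) = exp_of \<M> x y \<otimes> x"
    using * by blast+
qed

section \<open>Ordered arithmetic\<close>

lemma zero_plus: "\<zero> \<oplus> x = x"
  by (induction x rule: induction) (auto intro!: def_intros simp: basic(3-6))

lemma suc_plus: "(x \<oplus> \<one>) \<oplus> y = (x \<oplus> y) \<oplus> \<one>"
  by (induction y rule: induction) (auto intro!: def_intros simp: basic(3-6))

lemma plus_commute: "x \<oplus> y = y \<oplus> x"
  by (induction y rule: induction) (auto intro!: def_intros simp: basic(3-6) zero_plus suc_plus)

lemma plus_assoc: "(x \<oplus> y) \<oplus> z = x \<oplus> (y \<oplus> z)"
  by (induction z rule: induction) (auto intro!: def_intros simp: basic(3-6))

lemma zero_times: "\<zero> \<otimes> x = \<zero>"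
  by (induction x rule: induction) (auto intro!: def_intros simp: basic(3-6))

lemma suc_times: "(x \<oplus> \<one>) \<otimes> y = x \<otimes> y \<oplus> y"
proof (induction y rule: induction)
  case (suc y)
  then show ?case by (simp add: basic(3-6)) (metis plus_assoc plus_commute)
qed (auto intro!: def_intros simp: basic(3-6))

lemma times_commute: "x \<otimes> y = y \<otimes> x"
  by (induction y rule: induction) (auto intro!: def_intros simp: basic(3-6) zero_times suc_times)

lemma plus_times: "(x \<oplus> y) \<otimes> z = x \<otimes> z \<oplus> y \<otimes> z"
proof (induction z rule: induction)
  case (suc z)
  then show ?case by (simp add: basic(3-6)) (metis plus_assoc plus_commute)
qed (auto intro!: def_intros simp: basic(3-6))

lemma times_assoc: "(x \<otimes> y) \<otimes> z = x \<otimes> (y \<otimes> z)"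
proof (induction z rule: induction)
  case (suc z)
  then show ?case by (simp add: basic(3-6)) (metis plus_times times_commute)
qed (auto intro!: def_intros simp: basic(3-6))

lemma one_times: "\<one> \<otimes> x = x"
  using suc_times[of \<zero> x] by (simp add: zero_plus zero_times)

sublocale sr: comm_semiring_0 where plus = "(\<oplus>)" and zero = \<zero> and times = "(\<otimes>)"
proof unfold_locales
  show "x \<oplus> y \<oplus> z = x \<oplus> (y \<oplus> z)" for x y z by (rule plus_assoc)
  show "x \<oplus> y = y \<oplus> x" for x y by (rule plus_commute)
  show "x \<otimes> y \<otimes> z = x \<otimes> (y \<otimes> z)" for x y z by (rule times_assoc)
  show "x \<otimes> y = y \<otimes> x" for x y by (rule times_commute)
qed (simp_all add: zero_plus plus_times zero_times basic(5))

sublocale sr: comm_monoid_mult where times = "(\<otimes>)" and one = \<one>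
  by unfold_locales (rule one_times)

lemma cancel_right [simp]: "x \<oplus> z = y \<oplus> z \<longleftrightarrow> x = y"
proof
  show "x \<oplus> z = y \<oplus> z \<Longrightarrow> x = y"
    by (induction z rule: induction) (auto intro!: def_intros simp: plus_assoc[symmetric] dest: basic(2))
qed simp

lemma cancel_left [simp]: "z \<oplus> x = z \<oplus> y \<longleftrightarrow> x = y"
  by (simp add: plus_commute[of z])

lemma plus_eq_self [simp]: "x \<oplus> y = x \<longleftrightarrow> y = \<zero>" "x = x \<oplus> y \<longleftrightarrow> y = \<zero>"
    "y \<oplus> x = x \<longleftrightarrow> y = \<zero>" "x = y \<oplus> x \<longleftrightarrow> y = \<zero>"
  using cancel_left[of x y \<zero>] cancel_right[of y x \<zero>] by auto

lemma suc_neq_zero [simp]: "x \<oplus> \<one> \<noteq> \<zero>" "\<one> \<oplus> x \<noteq> \<zero>"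
  using basic(1) by (auto simp: plus_commute)

section \<open>The order and its compatibility with addition and multiplication\<close>

lemma less_suc: "x \<prec> y \<oplus> \<one> \<longleftrightarrow> x \<prec> y \<or> x = y" by (rule basic)

lemma zero_less_suc: "\<zero> \<prec> x \<oplus> \<one>"
proof (induction x rule: induction)
  case zero
  show ?case unfolding less_suc by simp
next
  case (suc x)
  then show ?case unfolding less_suc[of _ "x \<oplus> \<one>"] ..
qed (intro def_intros)

lemma suc_mono: "x \<prec> y \<Longrightarrow> x \<oplus> \<one> \<prec> y \<oplus> \<one>"
proof (induction y rule: induction)
  case (suc y)
  then show ?case unfolding less_suc by (auto simp: less_suc)
qed (auto intro!: def_intros simp: basic)

lemma suc_cases: obtains "x = \<zero>" | y where "x = y \<oplus> \<one>"
proof -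
  have "x = \<zero> \<or> (\<exists>y. y \<prec> x \<and> x = y \<oplus> \<one>)"
    by (induction x rule: induction) (auto intro!: def_intros simp: less_suc)
  then show ?thesis using that by blast
qed

lemma less_iff: "x \<prec> y \<longleftrightarrow> (\<exists>d. y = x \<oplus> d \<oplus> \<one>)"
proof
  have "x \<prec> x \<oplus> d \<oplus> \<one>" for d
  proof (induction d rule: induction)
    case (suc d)
    then show ?case by (simp add: plus_assoc[symmetric] less_suc)
  qed (auto intro!: def_intros simp: less_suc)
  then show "\<exists>d. y = x \<oplus> d \<oplus> \<one> \<Longrightarrow> x \<prec> y" by blast
  \<comment> \<open>The difference is sought below \<open>y\<close> to make the statement a bounded
    formula, for which induction is available.\<close>
  have "x \<prec> y \<longrightarrow> (\<exists>d. d \<prec> y \<and> y = x \<oplus> d \<oplus> \<one>)"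
  proof (induction y rule: induction)
    case (suc y)
    show ?case
    proof
      assume "x \<prec> y \<oplus> \<one>"
      then consider "x \<prec> y" | "x = y" by (auto simp: less_suc)
      then show "\<exists>d. d \<prec> y \<oplus> \<one> \<and> y \<oplus> \<one> = x \<oplus> d \<oplus> \<one>"
      proof cases
        case 1
        with suc obtain d where "d \<prec> y" "y = x \<oplus> d \<oplus> \<one>" by blast
        then show ?thesis by (intro exI[of _ "d \<oplus> \<one>"]) (simp add: suc_mono del: plus_assoc, simp add: plus_assoc)
      next
        case 2
        then show ?thesis by (intro exI[of _ \<zero>]) (auto intro: zero_less_suc)
      qed
    qed
  qed (auto intro!: def_intros simp: basic)
  then show "x \<prec> y \<Longrightarrow> \<exists>d. y = x \<oplus> d \<oplus> \<one>" by blast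
qed

lemma le_iff: "x \<preceq> y \<longleftrightarrow> (\<exists>d. y = x \<oplus> d)"
  unfolding le_def less_iff
  by (metis plus_assoc sr.add_0_right suc_cases)

lemma less_linear: "x \<prec> y \<or> x = y \<or> y \<prec> x"
proof (induction x rule: induction)
  case zero
  show ?case by (cases y rule: suc_cases) (auto simp: zero_less_suc)
next
  case (suc x)
  then consider "x \<prec> y" | "x = y" | "y \<prec> x" by blast
  then show ?case
  proof cases
    case 1
    then obtain d where d: "y = x \<oplus> d \<oplus> \<one>" by (auto simp: less_iff)
    show ?thesis
    proof (cases d rule: suc_cases)
      case (2 c)
      then have "y = x \<oplus> \<one> \<oplus> c \<oplus> \<one>" using d by (simp add: ac_simps)
      then show ?thesis unfolding less_iff by blast
    qed (use d in simp)
  qed (auto simp: less_suc)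
qed (auto intro!: def_intros)

sublocale ord: linorder "(\<preceq>)" "(\<prec>)"
proof unfold_locales
  have irrefl: "\<not> x \<prec> x" for x by (auto simp: less_iff plus_assoc)
  have trans: "x \<prec> z" if "x \<prec> y" "y \<prec> z" for x y z
  proof -
    from that obtain d d' where "y = x \<oplus> d \<oplus> \<one>" "z = y \<oplus> d' \<oplus> \<one>" by (auto simp: less_iff)
    then have "z = x \<oplus> (d \<oplus> \<one> \<oplus> d') \<oplus> \<one>" by (simp add: plus_assoc)
    then show ?thesis unfolding less_iff by blast
  qed
  fix x y z
  show "x \<prec> y \<longleftrightarrow> x \<preceq> y \<and> \<not> y \<preceq> x" using irrefl trans by (auto simp: le_def)
  show "x \<preceq> x" by (simp add: le_def)
  show "x \<preceq> y \<Longrightarrow> y \<preceq> z \<Longrightarrow> x \<preceq> z" using trans by (auto simp: le_def)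
  show "x \<preceq> y \<Longrightarrow> y \<preceq> x \<Longrightarrow> x = y" using irrefl trans by (auto simp: le_def)
  show "x \<preceq> y \<or> y \<preceq> x" using less_linear by (auto simp: le_def)
qed

lemma zero_le [simp]: "\<zero> \<preceq> x"
  by (auto simp: le_iff)

lemma not_less_zero [simp]: "\<not> x \<prec> \<zero>"
  by (rule basic)

lemma le_zero [simp]: "x \<preceq> \<zero> \<longleftrightarrow> x = \<zero>"
  by (simp add: le_def)

lemma less_suc_le: "x \<prec> y \<oplus> \<one> \<longleftrightarrow> x \<preceq> y"
  by (simp add: le_def less_suc)

lemma suc_le_less: "x \<oplus> \<one> \<preceq> y \<longleftrightarrow> x \<prec> y"
  unfolding le_iff less_iff by (metis sr.add.assoc sr.add.commute)

lemma le_cancel [simp]: "x \<oplus> z \<preceq> y \<oplus> z \<longleftrightarrow> x \<preceq> y" "z \<oplus> x \<preceq> z \<oplus> y \<longleftrightarrow> x \<preceq> y"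
proof -
  show "z \<oplus> x \<preceq> z \<oplus> y \<longleftrightarrow> x \<preceq> y" for x y z unfolding le_iff by (simp add: plus_assoc)
  then show "x \<oplus> z \<preceq> y \<oplus> z \<longleftrightarrow> x \<preceq> y" by (simp add: plus_commute[of _ z])
qed

lemma less_cancel [simp]: "x \<oplus> z \<prec> y \<oplus> z \<longleftrightarrow> x \<prec> y" "z \<oplus> x \<prec> z \<oplus> y \<longleftrightarrow> x \<prec> y"
  by (simp_all add: ord.less_le)

lemma le_plus [simp]: "x \<preceq> x \<oplus> y" "x \<preceq> y \<oplus> x"
  by (auto simp: le_iff plus_commute)

lemma less_plus_one [simp]: "x \<prec> x \<oplus> \<one>"
  by (simp add: less_suc)

lemma plus_mono: "x \<preceq> x' \<Longrightarrow> y \<preceq> y' \<Longrightarrow> x \<oplus> y \<preceq> x' \<oplus> y'"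
  by (meson le_cancel ord.order_trans)

lemma times_mono: "x \<preceq> x' \<Longrightarrow> y \<preceq> y' \<Longrightarrow> x \<otimes> y \<preceq> x' \<otimes> y'"
  unfolding le_iff by (auto simp: algebra_simps) (metis plus_assoc)

section \<open>Renaming of variables; least and greatest elements\<close>

lemma definable_ball_le [def_intros]:
  assumes "definable_tm f" "definable (\<lambda>e. Q (\<lambda>i. e (Suc i)) (e 0))"
  shows "definable (\<lambda>e. \<forall>x. x \<preceq> f e \<longrightarrow> Q e x)"
  using definable_ball[of "\<lambda>e. f e \<oplus> \<one>" Q] assms by (simp add: less_suc_le def_intros)

lemma definable_bex_le [def_intros]:
  assumes "definable_tm f" "definable (\<lambda>e. Q (\<lambda>i. e (Suc i)) (e 0))"
  shows "definable (\<lambda>e. \<exists>x. x \<preceq> f e \<and> Q e x)"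
  using definable_bex[of "\<lambda>e. f e \<oplus> \<one>" Q] assms by (simp add: less_suc_le def_intros)

text \<open>Variables have even indices and parameters odd ones, so a renaming of the former leaves
  the latter alone. This is what carries a definable predicate into the scope of further
  quantifiers.\<close>

lemma definable_rename: "definable Q \<Longrightarrow> definable (\<lambda>e. Q (\<lambda>i. e (\<sigma> i)))"
proof -
  assume "definable Q"
  then obtain \<phi> where \<phi>: "delta0 \<phi>" "\<And>e. Q e \<longleftrightarrow> sat \<M> (with_params e) from_nat \<phi>"
    unfolding definable_def by blast
  have "(\<lambda>i. val \<M> (with_params e) (V (if even i then 2 * \<sigma> (i div 2) else i))) = with_params (\<lambda>i. e (\<sigma> i))" for e
    by (auto simp: with_params_def)
  then have "Q (\<lambda>i. e (\<sigma> i)) \<longleftrightarrow>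
    sat \<M> (with_params e) from_nat (sub (\<lambda>i. V (if even i then 2 * \<sigma> (i div 2) else i)) id \<phi>)" for e
    using \<phi>(2) by (simp add: sat_sub)
  with \<phi>(1) show ?thesis unfolding definable_def using delta0_sub by blast
qed

lemma definable_tm_rename: "definable_tm f \<Longrightarrow> definable_tm (\<lambda>e. f (\<lambda>i. e (\<sigma> i)))"
proof -
  assume "definable_tm f"
  then obtain t where t: "\<And>e. f e = val \<M> (with_params e) t"
    unfolding definable_tm_def by blast
  have "(\<lambda>i. val \<M> (with_params e) (V (if even i then 2 * \<sigma> (i div 2) else i))) = with_params (\<lambda>i. e (\<sigma> i))" for e
    by (auto simp: with_params_def)
  then have "f (\<lambda>i. e (\<sigma> i)) =
    val \<M> (with_params e) (tsub (\<lambda>i. V (if even i then 2 * \<sigma> (i div 2) else i)) t)" for e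
    using t by (simp add: val_tsub)
  then show ?thesis unfolding definable_tm_def by blast
qed

lemma definable_unary: "definable (\<lambda>e. Q (e 0)) \<Longrightarrow> definable (\<lambda>e. Q (e n))"
  using definable_rename[of "\<lambda>e. Q (e 0)" "\<lambda>_. n"] by simp

lemma bounded_comprehension: "definable (\<lambda>e. Q (e 0)) \<Longrightarrow> \<exists>X. \<forall>x. x \<triangleleft> X \<longleftrightarrow> Q x"
  by (rule comprehension0) (rule definable_unary)

lemma least:
  assumes "definable (\<lambda>e. Q (e 0))" "Q x"
  shows "\<exists>m. m \<preceq> x \<and> Q m \<and> (\<forall>y. y \<prec> m \<longrightarrow> \<not> Q y)"
proof -
  note [def_intros] = definable_unary[OF assms(1)]
  have "(\<exists>m. m \<preceq> x \<and> Q m \<and> (\<forall>y. y \<prec> m \<longrightarrow> \<not> Q y)) \<or> (\<forall>m. m \<preceq> x \<longrightarrow> \<not> Q m)"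
  proof (induction x rule: induction)
    case definable
    show ?case by (intro def_intros)
  next
    case (suc x)
    show ?case
    proof (cases "\<exists>m. m \<preceq> x \<and> Q m \<and> (\<forall>y. y \<prec> m \<longrightarrow> \<not> Q y)")
      case True
      then show ?thesis by (meson le_plus(1) ord.order_trans)
    next
      case False
      with suc have *: "\<not> Q m" if "m \<prec> x \<oplus> \<one>" for m using that by (simp add: less_suc_le)
      show ?thesis
      proof (cases "Q (x \<oplus> \<one>)")
        case True
        with * show ?thesis by blast
      next
        case False
        with * show ?thesis by (auto simp: le_def)
      qed
    qed
  qed simp
  with assms(2) show ?thesis by blast
qed

text \<open>Induction on the bound \<open>b\<close>; the alternative that nothing up to
  \<open>b\<close> satisfies \<open>Q\<close> is bounded as well, so the whole disjunction may be
  induced on.\<close>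

lemma greatest:
  assumes "definable (\<lambda>e. Q (e 0))" "Q x" "x \<preceq> b"
  shows "\<exists>m. m \<preceq> b \<and> Q m \<and> (\<forall>y. y \<preceq> b \<longrightarrow> m \<prec> y \<longrightarrow> \<not> Q y)"
proof -
  note [def_intros] = definable_unary[OF assms(1)]
  have "(\<exists>m. m \<preceq> b \<and> Q m \<and> (\<forall>y. y \<preceq> b \<longrightarrow> m \<prec> y \<longrightarrow> \<not> Q y)) \<or> (\<forall>m. m \<preceq> b \<longrightarrow> \<not> Q m)"
  proof (induction b rule: induction)
    case definable
    show ?case by (intro def_intros)
  next
    case (suc b)
    have le: "y \<preceq> b \<oplus> \<one> \<longleftrightarrow> y \<preceq> b \<or> y = b \<oplus> \<one>" for y by (simp add: le_def less_suc)
    show ?case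
    proof (cases "Q (b \<oplus> \<one>)")
      case True
      then show ?thesis by (intro disjI1 exI[of _ "b \<oplus> \<one>"]) (auto simp: ord.not_less[symmetric])
    next
      case False
      with suc show ?thesis by (auto simp: le)
    qed
  qed (auto simp: le_def)
  with assms(2,3) show ?thesis by blast
qed

lemma le_plus_middle [simp]: "x \<preceq> y \<oplus> (x \<oplus> z)" "x \<preceq> y \<oplus> (z \<oplus> x)"
  by (metis le_plus sr.add.left_commute plus_commute)+

section \<open>Binary codes of finite sets\<close>

lemma two_times: "two \<otimes> x = x \<oplus> x"
  by (simp add: two_def sr.distrib_right)

lemma pow2_zero [simp]: "pow2 \<zero> = \<one>"
  by (simp add: pow2_def basic)

lemma pow2_suc: "pow2 (x \<oplus> \<one>) = two \<otimes> pow2 x"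
  by (simp add: pow2_def basic(10) sr.mult.commute)

lemma pow2_plus: "pow2 (x \<oplus> y) = pow2 x \<otimes> pow2 y"
proof (induction y rule: induction)
  case definable
  show ?case by (intro def_intros)
next
  case (suc y)
  have "pow2 (x \<oplus> (y \<oplus> \<one>)) = two \<otimes> pow2 (x \<oplus> y)" by (simp only: basic(4) pow2_suc)
  with suc show ?case by (simp add: pow2_suc sr.mult.left_commute)
qed simp

lemma pow2_gt: "x \<prec> pow2 x"
proof (induction x rule: induction)
  case definable
  show ?case by (intro def_intros)
next
  case zero
  show ?case using zero_less_suc[of \<zero>] by simp
next
  case (suc x)
  then have "x \<oplus> \<one> \<preceq> pow2 x" by (simp add: suc_le_less)
  also have "pow2 x \<prec> pow2 x \<oplus> pow2 x" using suc
    by (metis le_cancel(1) less_cancel(2) ord.le_less_trans sr.add_0_right zero_le)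
  finally show ?case by (simp add: pow2_suc two_times)
qed

lemma pow2_pos: "\<zero> \<prec> pow2 x"
  using pow2_gt[of x] zero_le ord.le_less_trans by blast

lemma pow2_mono: "x \<preceq> y \<Longrightarrow> pow2 x \<preceq> pow2 y"
proof -
  assume "x \<preceq> y"
  then obtain d where "y = x \<oplus> d" by (auto simp: le_iff)
  moreover have "\<one> \<preceq> pow2 d" using pow2_pos[of d] suc_le_less[of \<zero>] by simp
  ultimately show ?thesis using times_mono[of "pow2 x" "pow2 x" \<one> "pow2 d"] by (simp add: pow2_plus)
qed

section \<open>Growth and injectivity of the pairing\<close>

lemma pr_ge: "x \<preceq> pr x y" "y \<preceq> pr x y" "x \<oplus> y \<preceq> pr x y"
proof -
  have "z \<preceq> z \<otimes> z" for z
    by (cases z rule: suc_cases) (simp_all add: algebra_simps)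
  from this[of "x \<oplus> y"] have "x \<oplus> y \<preceq> pr x y"
    unfolding pr_def by (meson le_plus(1) ord.order_trans)
  then show "x \<preceq> pr x y" "y \<preceq> pr x y" "x \<oplus> y \<preceq> pr x y"
    by (meson le_plus ord.order_trans)+
qed

lemma pr_mono: "x \<preceq> x' \<Longrightarrow> y \<preceq> y' \<Longrightarrow> pr x y \<preceq> pr x' y'"
  unfolding pr_def by (intro plus_mono times_mono)

text \<open>With \<open>z = x + y\<close> the code of \<open>(x, y)\<close> lies between the square
  of \<open>z\<close> and that of \<open>z + 1\<close>, so pairs with different sums have different
  codes. For equal sums the first component can be cancelled out.\<close>

lemma pr_less:
  assumes "x \<oplus> y \<prec> x' \<oplus> y'"
  shows "pr x y \<prec> pr x' y'"
proof -
  let ?z = "x \<oplus> y"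
  have "pr x y \<preceq> ?z \<otimes> ?z \<oplus> ?z" unfolding pr_def by simp
  also have "\<dots> \<prec> (?z \<oplus> \<one>) \<otimes> (?z \<oplus> \<one>)"
    unfolding less_iff by (rule exI[of _ ?z]) (simp add: algebra_simps)
  also have "\<dots> \<preceq> (x' \<oplus> y') \<otimes> (x' \<oplus> y')" using assms by (intro times_mono) (simp_all add: suc_le_less)
  also have "\<dots> \<preceq> pr x' y'" unfolding pr_def by simp
  finally show ?thesis .
qed

lemma pr_eq_iff [simp]: "pr x y = pr x' y' \<longleftrightarrow> x = x' \<and> y = y'"
proof
  assume eq: "pr x y = pr x' y'"
  then have "x \<oplus> y = x' \<oplus> y'" using pr_less ord.less_irrefl less_linear by metis
  with eq have "x = x'" unfolding pr_def by simp
  with \<open>x \<oplus> y = x' \<oplus> y'\<close> show "x = x' \<and> y = y'" by simp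
qed simp

definition elem where
  "elem t c \<longleftrightarrow> (\<exists>q. q \<prec> c \<oplus> \<one> \<and> (\<exists>r. r \<prec> pow2 t \<and> c = (two \<otimes> q \<oplus> \<one>) \<otimes> pow2 t \<oplus> r))"

lemma definable_elem [def_intros]:
  assumes "definable_tm f" "definable_tm g"
  shows "definable (\<lambda>e. elem (f e) (g e))"
  unfolding elem_def by (intro def_intros definable_tm_rename[OF assms(1)] definable_tm_rename[OF assms(2)])

text \<open>The bound on the quotient \<open>q\<close> is automatic, because \<open>q\<close> is at
  most \<open>2q + 1\<close>, hence at most \<open>c\<close>.\<close>

lemma elem_iff: "elem t c \<longleftrightarrow> (\<exists>q r. r \<prec> pow2 t \<and> c = (two \<otimes> q \<oplus> \<one>) \<otimes> pow2 t \<oplus> r)"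
proof
  assume "\<exists>q r. r \<prec> pow2 t \<and> c = (two \<otimes> q \<oplus> \<one>) \<otimes> pow2 t \<oplus> r"
  then obtain q r where *: "r \<prec> pow2 t" "c = (two \<otimes> q \<oplus> \<one>) \<otimes> pow2 t \<oplus> r" by blast
  have "q \<preceq> two \<otimes> q \<oplus> \<one>" unfolding two_times plus_assoc by simp
  also have "\<dots> \<preceq> (two \<otimes> q \<oplus> \<one>) \<otimes> pow2 t"
    using times_mono[of "two \<otimes> q \<oplus> \<one>" _ \<one> "pow2 t"] pow2_pos[of t] suc_le_less[of \<zero>] by simp
  also have "\<dots> \<preceq> c" using * by simp
  finally show "elem t c" unfolding elem_def using * by (auto simp: less_suc_le)
qed (auto simp: elem_def)

lemma elem_le: "elem t c \<Longrightarrow> pow2 t \<preceq> c"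
  by (auto simp: elem_iff algebra_simps)

lemma elem_less: "elem t c \<Longrightarrow> t \<prec> c"
  using elem_le pow2_gt ord.less_le_trans by blast

lemma elem_top: "c \<prec> pow2 n \<Longrightarrow> elem n (c \<oplus> pow2 n)"
  unfolding elem_iff by (intro exI[of _ \<zero>] exI[of _ c]) (simp add: plus_commute)

text \<open>For \<open>t < n\<close> the number \<open>pow2 n\<close> is an even multiple of
  \<open>pow2 t\<close>. Adding it changes the quotient \<open>q\<close> by \<open>pow2 d\<close>
  and keeps the binary digit at \<open>t\<close>.\<close>

lemma elem_plus_top:
  assumes "t \<prec> n"
  shows "elem t (c \<oplus> pow2 n) \<longleftrightarrow> elem t c"
proof -
  from assms obtain d where d: "n = t \<oplus> d \<oplus> \<one>" by (auto simp: less_iff)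
  have n: "pow2 n = two \<otimes> pow2 d \<otimes> pow2 t" unfolding d pow2_suc unfolding pow2_plus by (simp add: ac_simps)
  show ?thesis
  proof
    assume "elem t c"
    then obtain q r where qr: "r \<prec> pow2 t" "c = (two \<otimes> q \<oplus> \<one>) \<otimes> pow2 t \<oplus> r" by (auto simp: elem_iff)
    then have "c \<oplus> pow2 n = (two \<otimes> (q \<oplus> pow2 d) \<oplus> \<one>) \<otimes> pow2 t \<oplus> r" by (simp add: n algebra_simps)
    with qr show "elem t (c \<oplus> pow2 n)" unfolding elem_iff by blast
  next
    assume "elem t (c \<oplus> pow2 n)"
    then obtain q r where qr: "r \<prec> pow2 t" "c \<oplus> pow2 n = (two \<otimes> q \<oplus> \<one>) \<otimes> pow2 t \<oplus> r"
      by (auto simp: elem_iff)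
    \<comment> \<open>Otherwise the right-hand side would be smaller than \<open>pow2 n\<close>,
      which is contained in the left-hand side.\<close>
    have "pow2 d \<preceq> q"
    proof (rule ccontr)
      assume "\<not> pow2 d \<preceq> q"
      then obtain k where k: "pow2 d = q \<oplus> k \<oplus> \<one>" by (auto simp: ord.not_le less_iff)
      have "(two \<otimes> q \<oplus> \<one>) \<otimes> pow2 t \<oplus> r \<prec> (two \<otimes> q \<oplus> \<one>) \<otimes> pow2 t \<oplus> pow2 t" using qr by simp
      also have "\<dots> \<preceq> (two \<otimes> q \<oplus> \<one>) \<otimes> pow2 t \<oplus> pow2 t \<oplus> two \<otimes> k \<otimes> pow2 t" by simp
      also have "\<dots> = pow2 n" unfolding n k two_def by (simp add: algebra_simps)
      also have "\<dots> \<preceq> c \<oplus> pow2 n" by simp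
      finally show False using qr by simp
    qed
    then obtain k where k: "q = pow2 d \<oplus> k" by (auto simp: le_iff)
    have "c \<oplus> pow2 n = ((two \<otimes> k \<oplus> \<one>) \<otimes> pow2 t \<oplus> r) \<oplus> pow2 n"
      unfolding qr(2) unfolding n k by (simp add: algebra_simps)
    then have "c = (two \<otimes> k \<oplus> \<one>) \<otimes> pow2 t \<oplus> r" by simp
    with qr(1) show "elem t c" unfolding elem_iff by blast
  qed
qed

text \<open>The code is built by adding \<open>pow2 n\<close> whenever \<open>Q n\<close> holds.
  Exponentiation enters here: the bound \<open>pow2 n\<close> on the code turns its existence into a
  bounded statement, to which induction applies.\<close>

lemma finite_code:
  assumes "definable (\<lambda>e. Q (e 0))"
  shows "\<exists>c. \<forall>t. elem t c \<longleftrightarrow> t \<prec> n \<and> Q t"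
proof -
  note [def_intros] = definable_unary[OF assms]
  have "\<exists>c. c \<prec> pow2 n \<and> (\<forall>t. t \<prec> n \<longrightarrow> elem t c \<longleftrightarrow> Q t)"
  proof (induction n rule: induction)
    case definable
    show ?case by (intro def_intros)
  next
    case zero
    show ?case using zero_less_suc[of \<zero>] by auto
  next
    case (suc n)
    then obtain c where c: "c \<prec> pow2 n" "\<And>t. t \<prec> n \<Longrightarrow> elem t c \<longleftrightarrow> Q t" by blast
    show ?case
    proof (cases "Q n")
      case True
      have "c \<oplus> pow2 n \<prec> pow2 (n \<oplus> \<one>)" using c by (simp add: pow2_suc two_times)
      with c True show ?thesis by (intro exI[of _ "c \<oplus> pow2 n"]) (auto simp: less_suc elem_plus_top elem_top)
    next
      case False
      have "c \<prec> pow2 (n \<oplus> \<one>)"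
        using c pow2_mono[of n "n \<oplus> \<one>"] ord.less_le_trans by simp
      moreover have "\<not> elem n c" using elem_le[of n c] c(1) by auto
      ultimately show ?thesis using c False by (intro exI[of _ c]) (auto simp: less_suc)
    qed
  qed
  then obtain c where c: "c \<prec> pow2 n" "\<And>t. t \<prec> n \<Longrightarrow> elem t c \<longleftrightarrow> Q t" by blast
  have "t \<prec> n" if "elem t c" for t
    using elem_le[OF that] c(1) pow2_mono[of n t] by (meson ord.leD ord.le_less_trans ord.not_le_imp_less ord.order_trans)
  with c(2) show ?thesis by blast
qed

section \<open>Coded sequences\<close>

definition entry where "entry s i a \<longleftrightarrow> elem (pr i a) s"

definition seq where
  "seq s l \<longleftrightarrow> (\<forall>v. v \<prec> s \<longrightarrow> elem v s \<longrightarrow> (\<exists>i. i \<prec> l \<and> (\<exists>a. a \<prec> s \<and> v = pr i a))) \<and>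
    (\<forall>i. i \<prec> l \<longrightarrow> (\<exists>a. a \<prec> s \<and> entry s i a \<and> (\<forall>b. b \<prec> s \<longrightarrow> entry s i b \<longrightarrow> b = a)))"

lemma definable_entry [def_intros]:
  "definable_tm f \<Longrightarrow> definable_tm g \<Longrightarrow> definable_tm h \<Longrightarrow> definable (\<lambda>e. entry (f e) (g e) (h e))"
  unfolding entry_def by (intro def_intros)

lemma definable_seq [def_intros]:
  assumes "definable_tm f" "definable_tm g"
  shows "definable (\<lambda>e. seq (f e) (g e))"
  unfolding seq_def
  by (intro def_intros assms definable_tm_rename[OF assms(1)] definable_tm_rename[OF assms(2)])

lemma entry_less: "entry s i a \<Longrightarrow> a \<prec> s" "entry s i a \<Longrightarrow> i \<prec> s"
  unfolding entry_def using elem_less pr_ge(1,2) ord.le_less_trans by blast+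

lemma seq_iff:
  "seq s l \<longleftrightarrow> (\<forall>v. elem v s \<longrightarrow> (\<exists>i a. i \<prec> l \<and> v = pr i a)) \<and> (\<forall>i. i \<prec> l \<longrightarrow> (\<exists>!a. entry s i a))"
proof -
  have "(\<forall>v. v \<prec> s \<longrightarrow> elem v s \<longrightarrow> (\<exists>i. i \<prec> l \<and> (\<exists>a. a \<prec> s \<and> v = pr i a))) \<longleftrightarrow>
    (\<forall>v. elem v s \<longrightarrow> (\<exists>i a. i \<prec> l \<and> v = pr i a))"
    using elem_less entry_less(1) unfolding entry_def by blast
  moreover have "(\<exists>a. a \<prec> s \<and> entry s i a \<and> (\<forall>b. b \<prec> s \<longrightarrow> entry s i b \<longrightarrow> b = a)) \<longleftrightarrow> (\<exists>!a. entry s i a)" for i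
    using entry_less(1) by blast
  ultimately show ?thesis unfolding seq_def by simp
qed

lemma seq_entry: "seq s l \<Longrightarrow> i \<prec> l \<Longrightarrow> \<exists>a. entry s i a"
  and seq_unique: "seq s l \<Longrightarrow> entry s i a \<Longrightarrow> entry s i b \<Longrightarrow> a = b"
  and seq_bound: "seq s l \<Longrightarrow> entry s i a \<Longrightarrow> i \<prec> l"
proof -
  show "seq s l \<Longrightarrow> i \<prec> l \<Longrightarrow> \<exists>a. entry s i a" unfolding seq_iff by blast
  show bound: "seq s l \<Longrightarrow> entry s i a \<Longrightarrow> i \<prec> l" for i a unfolding seq_iff entry_def by fastforce
  show "seq s l \<Longrightarrow> entry s i a \<Longrightarrow> entry s i b \<Longrightarrow> a = b" using bound unfolding seq_iff by blast
qed

text \<open>The common bound \<open>A\<close> on the entries confines the pairs of position and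
  entry below \<open>pr l A + 1\<close>, so \<open>finite_code\<close> supplies the
  sequence.\<close>

lemma seq_exists:
  assumes Q: "definable (\<lambda>e. Q (e (Suc 0)) (e 0))"
    and unique: "\<And>i. i \<prec> l \<Longrightarrow> \<exists>!a. Q i a" and bound: "\<And>i a. i \<prec> l \<Longrightarrow> Q i a \<Longrightarrow> a \<prec> A"
  shows "\<exists>s. seq s l \<and> (\<forall>i a. entry s i a \<longleftrightarrow> i \<prec> l \<and> Q i a)"
proof -
  have "definable (\<lambda>e. \<exists>i. i \<prec> l \<and> (\<exists>a. a \<prec> A \<and> e 0 = pr i a \<and> Q i a))"
    by (intro def_intros Q)
  then obtain s where s: "\<And>v. elem v s \<longleftrightarrow> v \<prec> pr l A \<oplus> \<one> \<and> (\<exists>i. i \<prec> l \<and> (\<exists>a. a \<prec> A \<and> v = pr i a \<and> Q i a))"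
    using finite_code[of "\<lambda>v. \<exists>i. i \<prec> l \<and> (\<exists>a. a \<prec> A \<and> v = pr i a \<and> Q i a)" "pr l A \<oplus> \<one>"] by blast
  have "pr i a \<prec> pr l A \<oplus> \<one>" if "i \<prec> l" "a \<prec> A" for i a
    using that by (simp add: less_suc_le pr_mono)
  then have entry: "entry s i a \<longleftrightarrow> i \<prec> l \<and> Q i a" for i a
    unfolding entry_def s using bound by auto
  moreover have "seq s l" unfolding seq_iff entry using unique s by blast
  ultimately show ?thesis by blast
qed

section \<open>Functions of the model\<close>

definition internal :: "('a \<Rightarrow> 'a) \<Rightarrow> bool" where
  "internal f \<longleftrightarrow> (\<exists>X. \<forall>x y. pr x y \<triangleleft> X \<longleftrightarrow> y = f x)"

text \<open>A value of \<open>f\<close> is not a term of the language, so only the equation is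
  definable. Hence the recurring form of later formulas, in which a variable with an explicit bound
  is set equal to the value.\<close>

lemma definable_internal:
  assumes "internal f" "definable_tm s" "definable_tm t"
  shows "definable (\<lambda>e. t e = f (s e))"
proof -
  obtain X where X: "\<And>x y. pr x y \<triangleleft> X \<longleftrightarrow> y = f x" using assms(1) internal_def by auto
  have "definable (\<lambda>e. pr (s e) (t e) \<triangleleft> X)" by (intro def_intros assms)
  then show ?thesis unfolding X .
qed

text \<open>A function whose graph is \<open>\<Sigma>\<^sup>0\<^sub>1\<close> has a \<open>\<Delta>\<^sup>0\<^sub>1\<close> graph.\<close>

lemma internalI:
  assumes A: "definable (\<lambda>e. A (e 2) (e 1) (e 0))"
    and total: "\<And>x. \<exists>w. A x (f x) w" and sound: "\<And>x y w. A x y w \<Longrightarrow> y = f x"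
  shows "internal f"
proof -
  have [def_intros]: "definable (\<lambda>e. A (e i) (e j) (e k))" for i j k
    using definable_rename[OF A, of "\<lambda>n. if n = 2 then i else if n = 1 then j else k"] by simp
  have "\<exists>X. \<forall>p. p \<triangleleft> X \<longleftrightarrow> (\<exists>w. \<exists>x. x \<preceq> p \<and> (\<exists>y. y \<preceq> p \<and> p = pr x y \<and> A x y w))"
  \<comment> \<open>The universal form: every witnessed value of \<open>x\<close> equals
    \<open>y\<close>. The value and its witness are packed into the single variable
    \<open>v\<close>, since comprehension allows one quantifier.\<close>
  proof (rule comprehension[where B = "\<lambda>p v. \<exists>x. x \<preceq> p \<and> (\<exists>y. y \<preceq> p \<and> p = pr x y \<and>
      (\<forall>y'. y' \<preceq> v \<longrightarrow> (\<forall>w. w \<preceq> v \<longrightarrow> v = pr y' w \<longrightarrow> A x y' w \<longrightarrow> y' = y)))"])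
    fix p
    show "(\<exists>w. \<exists>x. x \<preceq> p \<and> (\<exists>y. y \<preceq> p \<and> p = pr x y \<and> A x y w)) \<longleftrightarrow>
      (\<forall>v. \<exists>x. x \<preceq> p \<and> (\<exists>y. y \<preceq> p \<and> p = pr x y \<and>
        (\<forall>y'. y' \<preceq> v \<longrightarrow> (\<forall>w. w \<preceq> v \<longrightarrow> v = pr y' w \<longrightarrow> A x y' w \<longrightarrow> y' = y))))"
      (is "?L \<longleftrightarrow> ?R")
    proof
      assume ?L
      then show ?R using sound by metis
    next
      assume R: ?R
      then obtain x y where xy: "p = pr x y" by blast
      obtain w where w: "A x (f x) w" using total by blast
      from R[rule_format, of "pr (f x) w"] have "f x = y" using xy w pr_ge by auto
      with w xy show ?L using pr_ge by blast
    qed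
  qed (intro def_intros)+
  then obtain X where X: "\<And>p. p \<triangleleft> X \<longleftrightarrow> (\<exists>w. \<exists>x. x \<preceq> p \<and> (\<exists>y. y \<preceq> p \<and> p = pr x y \<and> A x y w))" by blast
  have "pr x y \<triangleleft> X \<longleftrightarrow> y = f x" for x y
    unfolding X using total sound pr_ge by auto
  then show ?thesis unfolding internal_def by blast
qed

lemma internal_exists:
  assumes A: "definable (\<lambda>e. A (e 2) (e 1) (e 0))"
    and total: "\<And>x. \<exists>y w. A x y w" and unique: "\<And>x y w y' w'. A x y w \<Longrightarrow> A x y' w' \<Longrightarrow> y = y'"
  shows "\<exists>f. internal f \<and> (\<forall>x. \<exists>w. A x (f x) w)"
proof -
  from total obtain f where f: "\<forall>x. \<exists>w. A x (f x) w" by metis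
  then have "internal f" using internalI[OF A] unique by meson
  with f show ?thesis by blast
qed

definition internal2 :: "('a \<Rightarrow> 'a \<Rightarrow> 'a) \<Rightarrow> bool" where
  "internal2 h \<longleftrightarrow> (\<exists>H. internal H \<and> (\<forall>x y. h x y = H (pr x y)))"

lemma definable_internal2:
  assumes "internal2 h" "definable_tm s" "definable_tm r" "definable_tm t"
  shows "definable (\<lambda>e. t e = h (s e) (r e))"
proof -
  obtain H where H: "internal H" "\<And>x y. h x y = H (pr x y)" using assms(1) internal2_def by auto
  show ?thesis unfolding H(2) by (intro definable_internal H def_intros assms)
qed

section \<open>The fast-growing hierarchy\<close>

primrec graph :: "nat \<Rightarrow> 'a \<Rightarrow> 'a \<Rightarrow> bool" where
  "graph 0 x y \<longleftrightarrow> y = x \<oplus> \<one>"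
| "graph (Suc n) x y \<longleftrightarrow> (\<exists>w. seq w (x \<oplus> \<one> \<oplus> \<one>) \<and> entry w \<zero> x \<and> entry w (x \<oplus> \<one>) y \<and>
    (\<forall>i. i \<prec> x \<oplus> \<one> \<longrightarrow> (\<forall>a. a \<prec> w \<longrightarrow> (\<forall>b. b \<prec> w \<longrightarrow> entry w i a \<and> entry w (i \<oplus> \<one>) b \<longrightarrow> graph n a b))))"

definition total :: "nat \<Rightarrow> bool" where "total n \<longleftrightarrow> (\<forall>x. \<exists>y. graph n x y)"

definition F :: "nat \<Rightarrow> 'a \<Rightarrow> 'a" where "F n x = (THE y. graph n x y)"

text \<open>The sequence that witnesses a value of the next function at \<open>x\<close> has at
  least two entries, and the second one is the value of the present function at
  \<open>x\<close>.\<close>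

lemma total_Suc: "total (Suc n) \<Longrightarrow> total n"
  unfolding total_def
proof
  fix x assume "\<forall>x. \<exists>y. graph (Suc n) x y"
  then obtain y where "graph (Suc n) x y" by blast
  then obtain w where w: "seq w (x \<oplus> \<one> \<oplus> \<one>)" "entry w \<zero> x"
    and step: "\<And>i a b. i \<prec> x \<oplus> \<one> \<Longrightarrow> a \<prec> w \<Longrightarrow> b \<prec> w \<Longrightarrow> entry w i a \<Longrightarrow> entry w (i \<oplus> \<one>) b \<Longrightarrow> graph n a b"
    by auto
  have "\<one> \<prec> x \<oplus> \<one> \<oplus> \<one>" using suc_mono[OF zero_less_suc[of x]] by simp
  then obtain b where b: "entry w \<one> b" using w seq_entry by blast
  have "graph n x b"
    by (rule step[of \<zero>]) (use w b entry_less zero_less_suc in auto)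
  then show "\<exists>y. graph n x y" by blast
qed

text \<open>\<open>iterates f f' h\<close>: \<open>h j x = f\<^sup>j(x)\<close> for \<open>j \<le> x + 1\<close>, the only iterates that are known to exist
  if \<open>f'(x) = f\<^sup>x\<^sup>+\<^sup>1(x)\<close> is total; other values of \<open>h\<close> are junk.\<close>

definition iterates :: "('a \<Rightarrow> 'a) \<Rightarrow> ('a \<Rightarrow> 'a) \<Rightarrow> ('a \<Rightarrow> 'a \<Rightarrow> 'a) \<Rightarrow> bool" where
  "iterates f f' h \<longleftrightarrow> internal2 h \<and> (\<forall>x. h \<zero> x = x) \<and> (\<forall>x. h (x \<oplus> \<one>) x = f' x) \<and>
    (\<forall>x x' j. x \<preceq> x' \<longrightarrow> j \<preceq> x \<oplus> \<one> \<longrightarrow> h j x \<preceq> h j x') \<and>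
    (\<forall>x i j. i \<preceq> j \<longrightarrow> j \<preceq> x \<oplus> \<one> \<longrightarrow> h i x \<preceq> h j x) \<and>
    (\<forall>x j. j \<preceq> x \<longrightarrow> h j (f x) = h (j \<oplus> \<one>) x)"

definition inflationary_mono :: "('a \<Rightarrow> 'a) \<Rightarrow> bool" where
  "inflationary_mono f \<longleftrightarrow> (\<forall>x. x \<prec> f x) \<and> (\<forall>x y. x \<preceq> y \<longrightarrow> f x \<preceq> f y)"

text \<open>The iterates of \<open>f\<close> are read off from sequences that witness values of
  \<open>graph (Suc n)\<close>. The inductions speak about entries of fixed codes, which are bounded
  by those codes, and not about \<open>h\<close> itself, whose values have no bound given by a
  term.\<close>

lemma iteration:
  assumes tot: "total (Suc n)" and F: "internal f" "inflationary_mono f" and graph: "\<And>x y. graph n x y \<longleftrightarrow> y = f x"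
  shows "\<exists>f' h. (\<forall>x y. graph (Suc n) x y \<longleftrightarrow> y = f' x) \<and> iterates f f' h \<and> internal f' \<and> inflationary_mono f'"
proof -
  have infl: "x \<prec> f x" and mono: "x \<preceq> y \<Longrightarrow> f x \<preceq> f y" for x y
    using F(2) by (auto simp: inflationary_mono_def)
  note [def_intros] = definable_internal[OF F(1)]
  define wit where "wit w x \<longleftrightarrow> seq w (x \<oplus> \<one> \<oplus> \<one>) \<and> entry w \<zero> x \<and>
    (\<forall>i. i \<prec> x \<oplus> \<one> \<longrightarrow> (\<forall>a. a \<prec> w \<longrightarrow> (\<forall>b. b \<prec> w \<longrightarrow> entry w i a \<and> entry w (i \<oplus> \<one>) b \<longrightarrow> b = f a)))" for w x
  have wit_definable: "definable (\<lambda>e. wit (e i) (e j))" for i j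
    unfolding wit_def
    by ((rule definable_internal[OF F(1)] | rule def_intros)+)
  have graph_wit: "graph (Suc n) x y \<longleftrightarrow> (\<exists>w. wit w x \<and> entry w (x \<oplus> \<one>) y)" for x y
    by (auto simp: wit_def graph)
  have wit_exists: "\<exists>w. wit w x" for x using tot graph_wit unfolding total_def by blast
  have wit_seq: "seq w (x \<oplus> \<one> \<oplus> \<one>)" and wit_zero: "entry w \<zero> a \<longleftrightarrow> a = x" if "wit w x" for w x a
    using that seq_unique unfolding wit_def by blast+
  have wit_dom: "(\<exists>a. entry w j a) \<longleftrightarrow> j \<preceq> x \<oplus> \<one>" if "wit w x" for w x j
    using seq_entry[OF wit_seq[OF that]] seq_bound[OF wit_seq[OF that]] less_suc_le by blast
  have wit_suc: "\<exists>a. entry w j a \<and> b = f a" if wit: "wit w x" "entry w (j \<oplus> \<one>) b" for w x j b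
  proof -
    have j: "j \<prec> x \<oplus> \<one>" using wit_dom[OF wit(1), of "j \<oplus> \<one>"] wit(2) by (auto simp: less_suc_le)
    then obtain a where "entry w j a" using wit_dom[OF wit(1), of j] by (auto simp: ord.less_le)
    with j wit show ?thesis unfolding wit_def using entry_less by blast
  qed
  have wit_mono: "a \<preceq> b" if "wit w x" "wit w' x'" "x \<preceq> x'" "entry w j a" "entry w' j b" for w x w' x' j a b
  proof -
    have "\<forall>a. a \<prec> w \<longrightarrow> (\<forall>b. b \<prec> w' \<longrightarrow> entry w j a \<longrightarrow> entry w' j b \<longrightarrow> a \<preceq> b)"
    proof (induction j rule: induction)
      case definable
      show ?case by (intro def_intros)
    next
      case zero
      then show ?case using wit_zero[OF that(1)] wit_zero[OF that(2)] that(3) by auto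
    next
      case (suc j)
      then show ?case using wit_suc[OF that(1), of j] wit_suc[OF that(2), of j] mono entry_less(1) by metis
    qed
    then show ?thesis using that entry_less by blast
  qed
  have wit_eq: "a = b" if "wit w x" "wit w' x" "entry w j a" "entry w' j b" for w w' x j a b
    using wit_mono[OF that(1,2) _ that(3,4)] wit_mono[OF that(2,1) _ that(4,3)] by (simp add: ord.order.antisym)
  \<comment> \<open>\<open>H\<close> takes a coded pair \<open>(j, x)\<close> to the entry at
    position \<open>j\<close> of the sequence for \<open>x\<close>. Numbers that code no such pair,
    or one with \<open>j\<close> above \<open>x + 1\<close>, get the value 0.\<close>
  have "\<exists>H. internal H \<and> (\<forall>p. \<exists>w. (\<exists>j. j \<preceq> p \<and> (\<exists>x. x \<preceq> p \<and> p = pr j x \<and> j \<preceq> x \<oplus> \<one> \<and> wit w x \<and> entry w j (H p))) \<or>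
    \<not> (\<exists>j. j \<preceq> p \<and> (\<exists>x. x \<preceq> p \<and> p = pr j x \<and> j \<preceq> x \<oplus> \<one>)) \<and> H p = \<zero>)"
  proof (rule internal_exists)
    fix p
    show "\<exists>y w. (\<exists>j. j \<preceq> p \<and> (\<exists>x. x \<preceq> p \<and> p = pr j x \<and> j \<preceq> x \<oplus> \<one> \<and> wit w x \<and> entry w j y)) \<or>
      \<not> (\<exists>j. j \<preceq> p \<and> (\<exists>x. x \<preceq> p \<and> p = pr j x \<and> j \<preceq> x \<oplus> \<one>)) \<and> y = \<zero>"
      using wit_exists wit_dom by blast
  qed (intro def_intros wit_definable, use wit_eq in auto)
  then obtain H where H: "internal H" and H': "\<And>p. \<exists>w. (\<exists>j. j \<preceq> p \<and> (\<exists>x. x \<preceq> p \<and> p = pr j x \<and> j \<preceq> x \<oplus> \<one> \<and> wit w x \<and> entry w j (H p))) \<or>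
    \<not> (\<exists>j. j \<preceq> p \<and> (\<exists>x. x \<preceq> p \<and> p = pr j x \<and> j \<preceq> x \<oplus> \<one>)) \<and> H p = \<zero>" by blast
  define h where "h j x = H (pr j x)" for j x
  have h: "a = h j x" if "wit w x" "entry w j a" for w x j a
  proof -
    have "j \<preceq> x \<oplus> \<one>" using wit_dom that by blast
    then have "\<exists>w. wit w x \<and> entry w j (h j x)" using H'[of "pr j x"] pr_ge by (auto simp: h_def)
    then show ?thesis using wit_eq that by blast
  qed
  have h': "entry w j (h j x)" if "wit w x" "j \<preceq> x \<oplus> \<one>" for w x j
    using wit_dom h that by blast
  let ?f' = "\<lambda>x. h (x \<oplus> \<one>) x"
  have "internal2 h" using H by (auto simp: internal2_def h_def)
  have graph': "graph (Suc n) x y \<longleftrightarrow> y = ?f' x" for x y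
    unfolding graph_wit using h h' wit_exists by (metis ord.order_refl)
  have h_mono: "h j x \<preceq> h j x'" if "x \<preceq> x'" "j \<preceq> x \<oplus> \<one>" for x x' j
  proof -
    have "j \<preceq> x' \<oplus> \<one>" using that le_cancel(1) ord.order_trans by blast
    then show ?thesis using wit_exists wit_mono h' that by metis
  qed
  have h_suc: "h (j \<oplus> \<one>) x = f (h j x)" if "j \<preceq> x" for j x
  proof -
    obtain w where w: "wit w x" using wit_exists by blast
    have "entry w (j \<oplus> \<one>) (h (j \<oplus> \<one>) x)" by (rule h'[OF w]) (use that in simp)
    then show ?thesis using wit_suc[OF w] h[OF w] by metis
  qed
  have h_zero: "h \<zero> x = x" for x
    using wit_exists[of x] h wit_zero by (metis)
  have h_incr: "h i x \<preceq> h j x" if "i \<preceq> j" "j \<preceq> x \<oplus> \<one>" for i j x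
  proof -
    obtain w where w: "wit w x" using wit_exists by blast
    have "i \<preceq> j \<longrightarrow> (\<forall>b. b \<prec> w \<longrightarrow> entry w j b \<longrightarrow> h i x \<preceq> b)"
    proof (induction j rule: induction)
      case definable
      show ?case by (intro def_intros)
    next
      case zero
      show ?case using h[OF w] by auto
    next
      case (suc j)
      show ?case
      proof (intro impI allI)
        fix b assume b: "i \<preceq> j \<oplus> \<one>" "entry w (j \<oplus> \<one>) b"
        show "h i x \<preceq> b"
        proof (cases "i = j \<oplus> \<one>")
          case True
          then show ?thesis using h[OF w b(2)] by simp
        next
          case False
          then have "i \<preceq> j" using b by (simp add: le_def less_suc)
          moreover obtain a where "entry w j a" "b = f a" using wit_suc[OF w b(2)] by blast
          ultimately show ?thesis using suc infl[of a] entry_less(1)[of w j a]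
            by (meson ord.less_imp_le ord.order_trans)
        qed
      qed
    qed
    then show ?thesis using h'[OF w that(2)] that(1) entry_less by blast
  qed
  have h_shift: "h j (f x) = h (j \<oplus> \<one>) x" if "j \<preceq> x" for j x
  proof -
    \<comment> \<open>The sequence for \<open>f x\<close> agrees with the one for \<open>x\<close>
      after its first entry is dropped. The latter ends at position \<open>x + 1\<close>, whence the
      condition that \<open>j\<close> be at most \<open>x\<close>.\<close>
    obtain w w' where w: "wit w x" "wit w' (f x)" using wit_exists by meson
    have "j \<preceq> x \<longrightarrow> (\<forall>a. a \<prec> w \<longrightarrow> (\<forall>b. b \<prec> w' \<longrightarrow> entry w (j \<oplus> \<one>) a \<longrightarrow> entry w' j b \<longrightarrow> b = a))"
    proof (induction j rule: induction)
      case definable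
      show ?case by (intro def_intros)
    next
      case zero
      show ?case using wit_suc[OF w(1), of \<zero>] wit_zero[OF w(1)] wit_zero[OF w(2)] by auto
    next
      case (suc j)
      then show ?case using wit_suc[OF w(1), of "j \<oplus> \<one>"] wit_suc[OF w(2), of j] entry_less(1) ord.order_trans[of j "j \<oplus> \<one>" x] le_plus(1) by metis
    qed
    moreover have "entry w (j \<oplus> \<one>) (h (j \<oplus> \<one>) x)" by (rule h'[OF w(1)]) (use that in simp)
    moreover have "entry w' j (h j (f x))"
    proof (rule h'[OF w(2)])
      have "j \<preceq> f x" using that infl[of x] by (meson ord.less_imp_le ord.order_trans)
      then show "j \<preceq> f x \<oplus> \<one>" using le_plus(1) ord.order_trans by blast
    qed
    ultimately show ?thesis using that entry_less(1) by blast
  qed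
  have "internal ?f'"
  proof (rule internalI[where A = "\<lambda>x y w. y = h (x \<oplus> \<one>) x"])
    show "definable (\<lambda>e. e 1 = h (e 2 \<oplus> \<one>) (e 2))"
      by (intro definable_internal2[OF \<open>internal2 h\<close>] def_intros)
  qed auto
  moreover have "inflationary_mono ?f'"
  proof -
    have "x \<prec> ?f' x" for x
    proof -
      have "x \<preceq> h x x" using h_incr[of \<zero> x x] h_zero by simp
      also have "\<dots> \<prec> h (x \<oplus> \<one>) x" using h_suc[of x x] infl by simp
      finally show ?thesis .
    qed
    moreover have "?f' x \<preceq> ?f' y" if "x \<preceq> y" for x y
    proof -
      have "?f' x \<preceq> h (x \<oplus> \<one>) y" using h_mono[OF that] by simp
      also have "\<dots> \<preceq> ?f' y" using that by (intro h_incr) auto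
      finally show ?thesis .
    qed
    ultimately show ?thesis by (simp add: inflationary_mono_def)
  qed
  moreover have "iterates f ?f' h"
    unfolding iterates_def using \<open>internal2 h\<close> h_zero h_mono h_incr h_shift by blast
  ultimately show ?thesis by (intro exI[of _ ?f'] exI[of _ h] conjI allI graph')
qed

lemma F_properties:
  assumes "total n"
  shows "internal (F n)" "inflationary_mono (F n)" "graph n x y \<longleftrightarrow> y = F n x"
proof -
  have "internal (F n) \<and> inflationary_mono (F n) \<and> (\<forall>x y. graph n x y \<longleftrightarrow> y = F n x)"
    using assms
  proof (induction n)
    case 0
    have F0: "F 0 = (\<lambda>x. x \<oplus> \<one>)" by (auto simp: F_def)
    have "internal (\<lambda>x. x \<oplus> \<one>)"
      by (rule internalI[where A = "\<lambda>x y w. y = x \<oplus> \<one>"]) (intro def_intros, auto)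
    then show ?case by (simp add: F0 inflationary_mono_def)
  next
    case (Suc n)
    then have "internal (F n)" "inflationary_mono (F n)" "\<And>x y. graph n x y \<longleftrightarrow> y = F n x"
      using total_Suc by blast+
    from iteration[OF Suc.prems this] obtain f' where f':
      "\<And>x y. graph (Suc n) x y \<longleftrightarrow> y = f' x" "internal f'" "inflationary_mono f'" by blast
    have "F (Suc n) = f'" unfolding F_def f'(1) by simp
    with f' show ?case by blast
  qed
  then show "internal (F n)" "inflationary_mono (F n)" "graph n x y \<longleftrightarrow> y = F n x" by blast+
qed

lemma F_zero [simp]: "F 0 x = x \<oplus> \<one>"
  by (simp add: F_def)

lemma iterates_F:
  assumes "total (Suc n)"
  shows "\<exists>h. iterates (F n) (F (Suc n)) h"
proof -
  obtain f' h where f': "\<And>x y. graph (Suc n) x y \<longleftrightarrow> y = f' x" and "iterates (F n) f' h"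
    using iteration[OF assms F_properties[OF total_Suc[OF assms]]] by blast
  moreover have "F (Suc n) = f'" unfolding F_def f' by simp
  ultimately show ?thesis by blast
qed

section \<open>Ranks\<close>

text \<open>One level of the decomposition: \<open>\<rho> x\<close> counts how often \<open>f\<close> can be iterated on \<open>x\<close> without exceeding
  the potential \<open>\<mu> x\<close>, and \<open>\<mu>' x\<close> is the largest number that stays below \<open>\<mu> x\<close> under that many iterations.\<close>

lemma rank_step:
  assumes it: "iterates f f' h" and f: "inflationary_mono f" and \<mu>: "internal \<mu>" and bound: "\<And>x. \<mu> x \<prec> f' x"
  obtains \<rho> \<mu>' where "internal \<rho>" "\<And>x. \<rho> x \<preceq> x" "internal \<mu>'" "\<And>x. \<mu>' x \<prec> f x"
    "\<And>x. \<rho> x = \<zero> \<Longrightarrow> \<mu>' x = \<mu> x" "\<And>x. \<mu> x \<prec> x \<Longrightarrow> \<rho> x = \<zero>" "\<And>x. x \<preceq> \<mu> x \<Longrightarrow> x \<preceq> \<mu>' x"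
    "\<And>x y. x \<prec> y \<Longrightarrow> \<mu> y \<preceq> \<mu> x \<Longrightarrow> \<rho> y \<prec> \<rho> x \<or> \<rho> y = \<rho> x \<and> \<mu>' y \<preceq> \<mu>' x"
proof -
  have h2: "internal2 h" and h_zero: "\<And>x. h \<zero> x = x" and h_last: "\<And>x. h (x \<oplus> \<one>) x = f' x"
    and h_mono: "\<And>x x' j. x \<preceq> x' \<Longrightarrow> j \<preceq> x \<oplus> \<one> \<Longrightarrow> h j x \<preceq> h j x'"
    and h_incr: "\<And>x i j. i \<preceq> j \<Longrightarrow> j \<preceq> x \<oplus> \<one> \<Longrightarrow> h i x \<preceq> h j x"
    and h_shift: "\<And>x j. j \<preceq> x \<Longrightarrow> h j (f x) = h (j \<oplus> \<one>) x"
    using it unfolding iterates_def by auto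
  have infl: "x \<prec> f x" for x using f by (auto simp: inflationary_mono_def)
  have le_bex: "(\<exists>u. u \<preceq> w \<and> u = v) \<longleftrightarrow> v \<preceq> w" for v w by blast
  note def_rules = definable_internal2[OF h2] definable_internal[OF \<mu>]
  have def_h: "definable (\<lambda>e. h (e i) (e j) \<preceq> e k)" for i j k
  proof -
    have "definable (\<lambda>e. \<exists>u. u \<preceq> e k \<and> u = h (e i) (e j))"
      by ((rule def_rules | rule def_intros)+)
    then show ?thesis by (simp only: le_bex)
  qed
  \<comment> \<open>The witness \<open>w\<close> is the value \<open>\<mu> x\<close>, which can thus
    be compared and used as a bound. Counts above \<open>x\<close> are not considered, since the
    count \<open>x + 1\<close> already reaches \<open>f' x\<close>, which exceeds
    \<open>\<mu> x\<close>.\<close>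
  let ?R = "\<lambda>x y w. w = \<mu> x \<and> (w \<prec> x \<and> y = \<zero> \<or>
    x \<preceq> w \<and> y \<preceq> x \<and> h y x \<preceq> w \<and> (\<forall>j. j \<preceq> x \<longrightarrow> y \<prec> j \<longrightarrow> \<not> h j x \<preceq> w))"
  have "\<exists>\<rho>. internal \<rho> \<and> (\<forall>x. \<exists>w. ?R x (\<rho> x) w)"
  proof (rule internal_exists)
    show "definable (\<lambda>e. ?R (e 2) (e 1) (e 0))"
      by ((rule def_rules def_h | rule def_intros)+)
    show "\<exists>y w. ?R x y w" for x
    proof (cases "\<mu> x \<prec> x")
      case False
      then have "x \<preceq> \<mu> x" by (simp add: ord.not_less)
      have "definable (\<lambda>e. \<exists>u. u \<preceq> \<mu> x \<and> u = h (e 0) x)"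
        by ((rule def_rules | rule def_intros)+)
      then have "definable (\<lambda>e. h (e 0) x \<preceq> \<mu> x)" by (simp only: le_bex)
      from greatest[OF this, of \<zero> x] \<open>x \<preceq> \<mu> x\<close> show ?thesis by (auto simp: h_zero)
    qed auto
    show "y = y'" if "?R x y w" "?R x y' w'" for x y w y' w'
      using that less_linear[of y y'] by (auto simp: ord.not_less[symmetric])
  qed
  then obtain \<rho> where \<rho>: "internal \<rho>" "\<And>x. ?R x (\<rho> x) (\<mu> x)" by blast
  \<comment> \<open>The maximum is taken among numbers from \<open>x\<close> on. These are at least
    \<open>\<rho> x\<close>, so \<open>h (\<rho> x)\<close> is a genuine iterate at each of
    them.\<close>
  let ?S = "\<lambda>x y w. w = \<mu> x \<and> (w \<prec> x \<and> y = w \<or>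
    x \<preceq> w \<and> x \<preceq> y \<and> y \<preceq> w \<and> (\<exists>j. j \<preceq> x \<and> j = \<rho> x \<and> h j y \<preceq> w \<and> (\<forall>z. z \<preceq> w \<longrightarrow> y \<prec> z \<longrightarrow> \<not> h j z \<preceq> w)))"
  have "\<exists>\<mu>'. internal \<mu>' \<and> (\<forall>x. \<exists>w. ?S x (\<mu>' x) w)"
  proof (rule internal_exists)
    show "definable (\<lambda>e. ?S (e 2) (e 1) (e 0))"
      by ((rule def_rules def_h definable_internal[OF \<rho>(1)] | rule def_intros)+)
    show "\<exists>y w. ?S x y w" for x
    proof (cases "\<mu> x \<prec> x")
      case False
      then have x: "x \<preceq> \<mu> x" by (simp add: ord.not_less)
      with \<rho>(2)[of x] have "h (\<rho> x) x \<preceq> \<mu> x" "\<rho> x \<preceq> x" by (auto simp: ord.not_less[symmetric])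
      have "definable (\<lambda>e. \<exists>u. u \<preceq> \<mu> x \<and> u = h (\<rho> x) (e 0))"
        by ((rule def_rules | rule def_intros)+)
      then have "definable (\<lambda>e. h (\<rho> x) (e 0) \<preceq> \<mu> x)" by (simp only: le_bex)
      from greatest[OF this, of x "\<mu> x"] x \<open>h (\<rho> x) x \<preceq> \<mu> x\<close> \<open>\<rho> x \<preceq> x\<close> obtain m where
        "m \<preceq> \<mu> x" "h (\<rho> x) m \<preceq> \<mu> x" "\<forall>y. y \<preceq> \<mu> x \<longrightarrow> m \<prec> y \<longrightarrow> \<not> h (\<rho> x) y \<preceq> \<mu> x" by blast
      moreover from this have "x \<preceq> m" using x \<open>h (\<rho> x) x \<preceq> \<mu> x\<close> ord.not_less by blast
      ultimately show ?thesis using x \<open>\<rho> x \<preceq> x\<close> by blast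
    qed auto
    show "y = y'" if "?S x y w" "?S x y' w'" for x y w y' w'
      using that less_linear[of y y'] by (auto simp: ord.not_less[symmetric])
  qed
  then obtain \<mu>' where \<mu>': "internal \<mu>'" "\<And>x. ?S x (\<mu>' x) (\<mu> x)" by blast
  have small: "\<rho> x = \<zero>" "\<mu>' x = \<mu> x" if "\<mu> x \<prec> x" for x
    using \<rho>(2)[of x] \<mu>'(2)[of x] that by (auto simp: ord.not_less[symmetric])
  have large: "h (\<rho> x) x \<preceq> \<mu> x" "\<And>j. j \<preceq> x \<Longrightarrow> h j x \<preceq> \<mu> x \<Longrightarrow> j \<preceq> \<rho> x"
    "x \<preceq> \<mu>' x" "\<mu>' x \<preceq> \<mu> x" "h (\<rho> x) (\<mu>' x) \<preceq> \<mu> x" "\<And>z. z \<preceq> \<mu> x \<Longrightarrow> h (\<rho> x) z \<preceq> \<mu> x \<Longrightarrow> z \<preceq> \<mu>' x"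
    if "x \<preceq> \<mu> x" for x
    using \<rho>(2)[of x] \<mu>'(2)[of x] that by (auto simp: ord.not_less[symmetric])
  have \<rho>_le: "\<rho> x \<preceq> x" for x
    using \<rho>(2)[of x] by auto
  have "\<mu>' x \<prec> f x" for x
  proof (cases "\<mu> x \<prec> x")
    case True
    then show ?thesis using small(2)[OF True] infl[of x] by (simp add: ord.less_trans)
  next
    case False
    then have x: "x \<preceq> \<mu> x" by (simp add: ord.not_less)
    show ?thesis
    proof (rule ccontr)
      \<comment> \<open>Then \<open>f x\<close> would tolerate \<open>\<rho> x\<close> iterations,
        so \<open>x\<close> would tolerate one more. That contradicts the choice of
        \<open>\<rho> x\<close> if it is below \<open>x\<close>, and the bound on
        \<open>\<mu>\<close> if it equals \<open>x\<close>.\<close>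
      assume "\<not> \<mu>' x \<prec> f x"
      then have "f x \<preceq> \<mu>' x" by (simp add: ord.not_less)
      moreover have "\<rho> x \<preceq> f x \<oplus> \<one>"
        using \<rho>_le[of x] infl[of x] by (meson le_plus(1) ord.less_imp_le ord.order_trans)
      ultimately have "h (\<rho> x) (f x) \<preceq> \<mu> x" using h_mono large(5)[OF x] ord.order_trans by blast
      then have *: "h (\<rho> x \<oplus> \<one>) x \<preceq> \<mu> x" using h_shift \<rho>_le by simp
      show False
      proof (cases "\<rho> x = x")
        case True
        then show False using * bound[of x] by (simp add: h_last ord.not_less[symmetric])
      next
        case False
        then have "\<rho> x \<oplus> \<one> \<preceq> x" using \<rho>_le[of x] by (simp add: suc_le_less ord.less_le)
        from large(2)[OF x this *] show False by (simp add: ord.not_less[symmetric])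
      qed
    qed
  qed
  moreover have "\<mu>' x = \<mu> x" if "\<rho> x = \<zero>" for x
  proof (cases "\<mu> x \<prec> x")
    case False
    then have x: "x \<preceq> \<mu> x" by (simp add: ord.not_less)
    from large(6)[OF x ord.order_refl] that have "\<mu> x \<preceq> \<mu>' x" by (simp add: h_zero)
    then show ?thesis using large(4)[OF x] by (simp add: ord.order.antisym)
  qed (use small in auto)
  moreover have "\<rho> y \<prec> \<rho> x \<or> \<rho> y = \<rho> x \<and> \<mu>' y \<preceq> \<mu>' x" if xy: "x \<prec> y" "\<mu> y \<preceq> \<mu> x" for x y
  proof (cases "\<mu> y \<prec> y")
    \<comment> \<open>Here \<open>\<rho> y\<close> is 0 and the potential of \<open>y\<close> is
      unchanged, so either the digit drops from a positive value or both potentials are the original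
      ones.\<close>
    case True
    show ?thesis
    proof (cases "\<rho> x = \<zero>")
      case True
      then show ?thesis using small[OF \<open>\<mu> y \<prec> y\<close>] \<open>\<And>x. \<rho> x = \<zero> \<Longrightarrow> \<mu>' x = \<mu> x\<close> xy by simp
    next
      case False
      then show ?thesis using small[OF \<open>\<mu> y \<prec> y\<close>] by (simp add: ord.less_le)
    qed
  next
    case False
    then have y: "y \<preceq> \<mu> y" by (simp add: ord.not_less)
    then have x: "x \<preceq> \<mu> x" using xy by (meson ord.less_imp_le ord.order_trans)
    have hy: "h (\<rho> y) y \<preceq> \<mu> x" using large(1)[OF y] xy ord.order_trans by blast
    \<comment> \<open>This ensures that \<open>h (\<rho> y) x\<close> is a genuine iterate. With
      more than \<open>x\<close> iterations from \<open>y\<close>, monotonicity would give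
      \<open>f' x\<close> at most \<open>\<mu> x\<close>. Afterwards \<open>\<rho> y\<close> is seen
      to be one of the counts over which \<open>\<rho> x\<close> is maximal.\<close>
    have "\<rho> y \<preceq> x"
    proof (rule ccontr)
      assume "\<not> \<rho> y \<preceq> x"
      then have "x \<oplus> \<one> \<preceq> \<rho> y" by (simp add: suc_le_less ord.not_le)
      moreover have "\<rho> y \<preceq> y \<oplus> \<one>" using \<rho>_le[of y] le_plus(1) ord.order_trans by blast
      ultimately have "h (x \<oplus> \<one>) y \<preceq> \<mu> x" using h_incr hy ord.order_trans by blast
      moreover have "f' x \<preceq> h (x \<oplus> \<one>) y" using h_mono[of x y "x \<oplus> \<one>"] xy by (simp add: h_last ord.less_imp_le)
      ultimately show False using bound[of x] by (meson ord.leD ord.order_trans)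
    qed
    moreover have "h (\<rho> y) x \<preceq> \<mu> x"
      using h_mono[of x y "\<rho> y"] xy \<open>\<rho> y \<preceq> x\<close> hy by (meson le_plus(1) ord.less_imp_le ord.order_trans)
    ultimately have le: "\<rho> y \<preceq> \<rho> x" using large(2)[OF x] by blast
    show ?thesis
    proof (cases "\<rho> y = \<rho> x")
      case True
      \<comment> \<open>With equal digits, \<open>\<mu>' y\<close> competes in the maximum that
        defines \<open>\<mu>' x\<close>.\<close>
      have "h (\<rho> x) (\<mu>' y) \<preceq> \<mu> x" using large(5)[OF y] xy True ord.order_trans by fastforce
      moreover have "\<mu>' y \<preceq> \<mu> x" using large(4)[OF y] xy ord.order_trans by blast
      ultimately show ?thesis using large(6)[OF x] True by blast
    qed (use le in \<open>simp add: ord.less_le\<close>)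
  qed
  ultimately show ?thesis by (intro that[of \<rho> \<mu>'] \<rho>(1) \<mu>'(1) \<rho>_le small(1) large(3))
qed

text \<open>\<open>\<rho>\<close> lists the digits of the potential \<open>\<mu>\<close>, and
  \<open>\<nu>\<close> is what is left of it after \<open>n\<close> levels. If
  \<open>\<mu> x\<close> is at least \<open>x\<close>, the two bounds on \<open>\<nu> x\<close>
  force it to be \<open>x\<close>.\<close>

definition level_ranks :: "nat \<Rightarrow> ('a \<Rightarrow> 'a) \<Rightarrow> (nat \<Rightarrow> 'a \<Rightarrow> 'a) \<Rightarrow> ('a \<Rightarrow> 'a) \<Rightarrow> bool" where
  "level_ranks n \<mu> \<rho> \<nu> \<longleftrightarrow> (\<forall>i<n. internal (\<rho> i) \<and> (\<forall>x. \<rho> i x \<preceq> x)) \<and> (\<forall>x. \<nu> x \<preceq> x) \<and>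
    (\<forall>x. (\<forall>i<n. \<rho> i x = \<zero>) \<longrightarrow> \<nu> x = \<mu> x) \<and> (\<forall>x. \<mu> x \<prec> x \<longrightarrow> (\<forall>i<n. \<rho> i x = \<zero>)) \<and> (\<forall>x. x \<preceq> \<mu> x \<longrightarrow> x \<preceq> \<nu> x) \<and>
    (\<forall>x y. x \<prec> y \<longrightarrow> \<mu> y \<preceq> \<mu> x \<longrightarrow> (\<exists>i<n. \<rho> i y \<prec> \<rho> i x) \<or> (\<forall>i<n. \<rho> i y = \<rho> i x) \<and> \<nu> y \<preceq> \<nu> x)"

text \<open>The digit of the fastest function is split off first. It leaves a potential below
  \<open>F n\<close>, to which the induction hypothesis applies. At level 0 a potential below
  \<open>x + 1\<close> is at most \<open>x\<close> and serves as the rest.\<close>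

lemma rank_levels:
  assumes "total n" "internal \<mu>" "\<And>x. \<mu> x \<prec> F n x"
  shows "\<exists>\<rho> \<nu>. level_ranks n \<mu> \<rho> \<nu>"
  using assms
proof (induction n arbitrary: \<mu>)
  case 0
  then show ?case unfolding level_ranks_def by (intro exI[of _ "\<lambda>_ _. \<zero>"] exI[of _ \<mu>]) (auto simp: less_suc_le)
next
  case (Suc n)
  obtain h where h: "iterates (F n) (F (Suc n)) h" using iterates_F[OF Suc.prems(1)] by blast
  have n: "total n" using Suc.prems(1) by (rule total_Suc)
  obtain r \<mu>' where r: "internal r" "\<And>x. r x \<preceq> x" and \<mu>': "internal \<mu>'" "\<And>x. \<mu>' x \<prec> F n x"
    and r_zero: "\<And>x. r x = \<zero> \<Longrightarrow> \<mu>' x = \<mu> x" and small: "\<And>x. \<mu> x \<prec> x \<Longrightarrow> r x = \<zero>"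
    and large: "\<And>x. x \<preceq> \<mu> x \<Longrightarrow> x \<preceq> \<mu>' x"
    and split: "\<And>x y. x \<prec> y \<Longrightarrow> \<mu> y \<preceq> \<mu> x \<Longrightarrow> r y \<prec> r x \<or> r y = r x \<and> \<mu>' y \<preceq> \<mu>' x"
  proof (rule rank_step[OF h F_properties(2)[OF n] Suc.prems(2,3)], goal_cases)
    case (1 r \<mu>')
    show ?case by (rule 1(1)[OF 1(2-)])
  qed
  obtain \<rho> \<nu> where "level_ranks n \<mu>' \<rho> \<nu>" using Suc.IH[OF n \<mu>'] by blast
  then have \<rho>: "\<And>i. i < n \<Longrightarrow> internal (\<rho> i) \<and> (\<forall>x. \<rho> i x \<preceq> x)" and \<nu>: "\<And>x. \<nu> x \<preceq> x"
    and \<rho>_zero: "\<And>x. (\<forall>i<n. \<rho> i x = \<zero>) \<Longrightarrow> \<nu> x = \<mu>' x" and small': "\<And>x. \<mu>' x \<prec> x \<Longrightarrow> (\<forall>i<n. \<rho> i x = \<zero>)"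
    and large': "\<And>x. x \<preceq> \<mu>' x \<Longrightarrow> x \<preceq> \<nu> x"
    and split': "\<And>x y. x \<prec> y \<Longrightarrow> \<mu>' y \<preceq> \<mu>' x \<Longrightarrow> (\<exists>i<n. \<rho> i y \<prec> \<rho> i x) \<or> (\<forall>i<n. \<rho> i y = \<rho> i x) \<and> \<nu> y \<preceq> \<nu> x"
    unfolding level_ranks_def by blast+
  have all: "(\<forall>i<Suc n. Q i) \<longleftrightarrow> Q 0 \<and> (\<forall>i<n. Q (Suc i))" for Q
    by (metis less_Suc_eq_0_disj)
  have ex: "(\<exists>i<Suc n. Q i) \<longleftrightarrow> Q 0 \<or> (\<exists>i<n. Q (Suc i))" for Q
    by (metis less_Suc_eq_0_disj)
  show ?case unfolding level_ranks_def
  proof (intro exI[of _ "case_nat r \<rho>"] exI[of _ \<nu>] conjI allI impI)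
    show "\<nu> x = \<mu> x" if "\<forall>i<Suc n. case_nat r \<rho> i x = \<zero>" for x
      using that \<rho>_zero[of x] r_zero[of x] unfolding all by simp
    show "case_nat r \<rho> i x = \<zero>" if "\<mu> x \<prec> x" "i < Suc n" for x i
      using small[OF that(1)] r_zero[of x] small'[of x] that by (cases i) auto
    show "(\<exists>i<Suc n. case_nat r \<rho> i y \<prec> case_nat r \<rho> i x) \<or>
      (\<forall>i<Suc n. case_nat r \<rho> i y = case_nat r \<rho> i x) \<and> \<nu> y \<preceq> \<nu> x" if "x \<prec> y" "\<mu> y \<preceq> \<mu> x" for x y
      using split[OF that] split'[OF that(1)] unfolding all ex by auto
  qed (use r \<rho> \<nu> large large' in \<open>auto split: nat.split\<close>)
qed

theorem ranks:
  assumes "total n" "internal \<mu>" "\<And>x. \<mu> x \<prec> F n x"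
  shows "\<exists>r. (\<forall>i<n + 2. internal (r i) \<and> (\<forall>x. r i x \<preceq> x)) \<and>
    (\<forall>x y. y \<prec> x \<or> x \<prec> y \<and> \<mu> y \<prec> \<mu> x \<longrightarrow> (\<exists>i<n + 2. r i y \<prec> r i x))"
proof -
  obtain \<rho> \<nu> where "level_ranks n \<mu> \<rho> \<nu>" using rank_levels[OF assms] by blast
  then have \<rho>: "\<And>i. i < n \<Longrightarrow> internal (\<rho> i) \<and> (\<forall>x. \<rho> i x \<preceq> x)" and \<nu>: "\<And>x. \<nu> x \<preceq> x"
    and zero: "\<And>x. (\<forall>i<n. \<rho> i x = \<zero>) \<Longrightarrow> \<nu> x = \<mu> x" and small: "\<And>x. \<mu> x \<prec> x \<Longrightarrow> (\<forall>i<n. \<rho> i x = \<zero>)"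
    and large: "\<And>x. x \<preceq> \<mu> x \<Longrightarrow> x \<preceq> \<nu> x"
    and split: "\<And>x y. x \<prec> y \<Longrightarrow> \<mu> y \<preceq> \<mu> x \<Longrightarrow> (\<exists>i<n. \<rho> i y \<prec> \<rho> i x) \<or> (\<forall>i<n. \<rho> i y = \<rho> i x) \<and> \<nu> y \<preceq> \<nu> x"
    unfolding level_ranks_def by blast+
  \<comment> \<open>The cap makes the rank at most its argument. It is inactive at the pairs for
    which this rank is needed: there \<open>\<mu> x\<close> is at most \<open>x\<close> and
    \<open>\<mu> y\<close> is below \<open>y\<close>.\<close>
  define m where "m x = (if \<mu> x \<preceq> x then \<mu> x else x)" for x
  have m: "internal m"
  proof (rule internalI[where A = "\<lambda>x y w. w = \<mu> x \<and> (w \<preceq> x \<and> y = w \<or> \<not> w \<preceq> x \<and> y = x)"])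
    show "definable (\<lambda>e. e 0 = \<mu> (e 2) \<and> (e 0 \<preceq> e 2 \<and> e 1 = e 0 \<or> \<not> e 0 \<preceq> e 2 \<and> e 1 = e 2))"
      by ((rule definable_internal[OF assms(2)] | rule def_intros)+)
  qed (auto simp: m_def)
  have id: "internal (\<lambda>x. x)"
    by (rule internalI[where A = "\<lambda>x y w. y = x"]) (intro def_intros, auto)
  define r where "r i = (if i < n then \<rho> i else if i = n then (\<lambda>x. x) else m)" for i
  have "\<exists>i<n + 2. r i y \<prec> r i x" if xy: "y \<prec> x \<or> x \<prec> y \<and> \<mu> y \<prec> \<mu> x" for x y
  proof (cases "y \<prec> x")
    case True
    then show ?thesis by (intro exI[of _ n]) (simp add: r_def)
  next
    case False
    then have xy: "x \<prec> y" "\<mu> y \<prec> \<mu> x" using xy by auto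
    show ?thesis
    proof (cases "\<exists>i<n. \<rho> i y \<prec> \<rho> i x")
      case True
      then obtain i where "i < n" "\<rho> i y \<prec> \<rho> i x" by blast
      then show ?thesis by (intro exI[of _ i]) (simp add: r_def)
    next
      case False
      then have eq: "\<forall>i<n. \<rho> i y = \<rho> i x" and le: "\<nu> y \<preceq> \<nu> x" using split[OF xy(1) ord.less_imp_le[OF xy(2)]] by auto
      \<comment> \<open>All digits agree, and the rest of \<open>y\<close> is at most that of
        \<open>x\<close>, hence at most \<open>x\<close> and below \<open>y\<close>. So
        \<open>\<mu> y\<close> is below \<open>y\<close>, the digits of \<open>y\<close> and with
        them those of \<open>x\<close> vanish, and the rest of \<open>x\<close> is
        \<open>\<mu> x\<close> itself.\<close>
      have "\<nu> y \<prec> y" using le \<nu>[of x] xy(1) by (meson ord.le_less_trans)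
      then have "\<mu> y \<prec> y" using large[of y] by (meson ord.not_less)
      then have "\<forall>i<n. \<rho> i x = \<zero>" using small eq by simp
      then have "\<mu> x \<preceq> x" using zero \<nu>[of x] by simp
      then have "m y \<prec> m x" using xy \<open>\<mu> y \<prec> y\<close> by (simp add: m_def ord.less_imp_le)
      then show ?thesis by (intro exI[of _ "Suc n"]) (simp add: r_def)
    qed
  qed
  moreover have "internal (r i) \<and> (\<forall>x. r i x \<preceq> x)" if "i < n + 2" for i
    using \<rho> m id by (auto simp: r_def m_def)
  ultimately show ?thesis by blast
qed

section \<open>Bounded relations\<close>

definition decr where
  "decr Q s l \<longleftrightarrow> seq s l \<and> (\<forall>i. i \<prec> l \<longrightarrow> (\<forall>a. a \<prec> s \<longrightarrow> (\<forall>b. b \<prec> s \<longrightarrow>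
    entry s i a \<and> entry s (i \<oplus> \<one>) b \<longrightarrow> pr b a \<triangleleft> Q)))"

lemma decr_iff: "decr Q s l \<longleftrightarrow> seq s l \<and> (\<forall>i a b. entry s i a \<longrightarrow> entry s (i \<oplus> \<one>) b \<longrightarrow> pr b a \<triangleleft> Q)"
  unfolding decr_def using entry_less(1) seq_bound by blast

definition bounded_by :: "nat \<Rightarrow> 's \<Rightarrow> bool" where
  "bounded_by k Q \<longleftrightarrow> (\<forall>s l x. decr Q s l \<and> entry s \<zero> x \<longrightarrow> (\<exists>y. graph k x y \<and> l \<preceq> y))"

lemma bounded_by_rank:
  assumes r: "internal r" "\<And>x. r x \<preceq> x" and Q: "\<And>x y. pr y x \<triangleleft> Q \<Longrightarrow> r y \<prec> r x"
  shows "bounded_by 0 Q"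
  unfolding bounded_by_def
proof (intro allI impI, elim conjE)
  fix s l x assume s: "decr Q s l" "entry s \<zero> x"
  then have seq: "seq s l" and step: "\<And>i a b. entry s i a \<Longrightarrow> entry s (i \<oplus> \<one>) b \<Longrightarrow> r b \<prec> r a"
    using Q by (auto simp: decr_iff)
  \<comment> \<open>Each step costs at least one unit of rank. As \<open>r a\<close> is at most
    \<open>a\<close>, its value can be named by a bounded variable, which makes the invariant
    inductive. It yields a length of at most \<open>r x + 1\<close>.\<close>
  have *: "\<forall>a. a \<prec> s \<longrightarrow> entry s i a \<longrightarrow> (\<exists>u. u \<preceq> a \<and> u = r a \<and> u \<oplus> i \<preceq> r x)" for i
  proof (induction i rule: induction)
    case definable
    show ?case by ((rule definable_internal[OF r(1)] | rule def_intros)+)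
  next
    case zero
    show ?case using seq_unique[OF seq s(2)] r(2) by auto
  next
    case (suc i)
    show ?case
    proof (intro allI impI)
      fix b assume b: "entry s (i \<oplus> \<one>) b"
      then have "i \<prec> l" using seq_bound[OF seq] less_plus_one ord.less_trans by blast
      then obtain a where a: "entry s i a" using seq_entry[OF seq] by blast
      then have "r a \<oplus> i \<preceq> r x" using suc entry_less(1) by blast
      moreover have "r b \<oplus> \<one> \<preceq> r a" using step[OF a b] by (simp add: suc_le_less)
      ultimately have "r b \<oplus> \<one> \<oplus> i \<preceq> r x" by (meson le_cancel(1) ord.order_trans)
      then show "\<exists>u. u \<preceq> b \<and> u = r b \<and> u \<oplus> (i \<oplus> \<one>) \<preceq> r x"
        using r(2) by (auto simp: ac_simps)
    qed
  qed
  have "l \<preceq> x \<oplus> \<one>"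
  proof (cases l rule: suc_cases)
    case (2 j)
    then obtain a where "entry s j a" using seq_entry[OF seq, of j] by auto
    then have "r a \<oplus> j \<preceq> r x" using * entry_less(1) by blast
    then have "j \<preceq> x" using r(2)[of x] le_plus(2) ord.order_trans by blast
    with 2 show ?thesis by simp
  qed simp
  then show "\<exists>y. graph 0 x y \<and> l \<preceq> y" by simp
qed

text \<open>Quotient and remainder serve to repeat a segment of a run periodically; their bounds
  make the statement inductive.\<close>

lemma division:
  assumes "\<zero> \<prec> d"
  shows "\<exists>q. q \<preceq> m \<and> (\<exists>r. r \<preceq> m \<and> r \<prec> d \<and> m = d \<otimes> q \<oplus> r)"
proof (induction m rule: induction)
  case definable
  show ?case by (intro def_intros)
next
  case (suc m)
  then obtain q r where qr: "q \<preceq> m" "r \<preceq> m" "r \<prec> d" "m = d \<otimes> q \<oplus> r" by blast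
  show ?case
  proof (cases "r \<oplus> \<one> = d")
    case True
    then have "m \<oplus> \<one> = d \<otimes> (q \<oplus> \<one>) \<oplus> \<zero>" using qr(4) by (simp add: basic(6) plus_assoc)
    moreover have "q \<oplus> \<one> \<preceq> m \<oplus> \<one>" using qr(1) by simp
    ultimately show ?thesis using assms zero_le by blast
  next
    case False
    then have "r \<oplus> \<one> \<prec> d" using qr(3) by (simp add: ord.less_le suc_le_less)
    moreover have "m \<oplus> \<one> = d \<otimes> q \<oplus> (r \<oplus> \<one>)" using qr(4) by (simp add: plus_assoc)
    moreover have "q \<preceq> m \<oplus> \<one>" using qr(1) le_plus(1) ord.order_trans by blast
    ultimately show ?thesis using qr(2) by (intro exI[of _ q] exI[of _ "r \<oplus> \<one>"] conjI) auto
  qed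
qed (use assms in auto)

lemma division_unique:
  assumes "d \<otimes> q \<oplus> r = d \<otimes> q' \<oplus> r'" "r \<prec> d" "r' \<prec> d"
  shows "q = q'" "r = r'"
proof -
  have *: False if eq: "d \<otimes> q \<oplus> r = d \<otimes> q' \<oplus> r'" and "r \<prec> d" "q \<prec> q'" for q r q' r'
  proof -
    obtain c where "q' = q \<oplus> c \<oplus> \<one>" using \<open>q \<prec> q'\<close> by (auto simp: less_iff)
    then have "d \<otimes> q \<oplus> r = d \<otimes> q \<oplus> (d \<oplus> (d \<otimes> c \<oplus> r'))" using eq by (simp add: algebra_simps)
    then have "d \<preceq> r" by simp
    with \<open>r \<prec> d\<close> show False by (simp add: ord.not_less[symmetric])
  qed
  show "q = q'" using *[of q r q' r'] *[of q' r' q r] assms less_linear by metis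
  with assms(1) show "r = r'" by simp
qed

end

section \<open>Runs of a deterministic bounded relation and their lengths\<close>

locale deterministic_bounded = rca_model \<M> for \<M> :: "('a :: countable, 's :: countable) struct" +
  fixes R P :: 's and k :: nat
  assumes total: "total k" and bounded: "bounded_by k R"
    and deterministic: "pr y x \<triangleleft> R \<Longrightarrow> pr z x \<triangleleft> R \<Longrightarrow> y = z"
    and P_iff: "pr y x \<triangleleft> P \<longleftrightarrow> (\<exists>s n. decr R s (n \<oplus> \<one> \<oplus> \<one>) \<and> entry s \<zero> x \<and> entry s (n \<oplus> \<one>) y)"
begin

lemma length_bound: "decr R s l \<Longrightarrow> entry s \<zero> x \<Longrightarrow> l \<preceq> F k x"
  using bounded unfolding bounded_by_def F_properties(3)[OF total] by blast

definition run where "run s d x y \<longleftrightarrow> decr R s (d \<oplus> \<one>) \<and> entry s \<zero> x \<and> entry s d y"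

lemma definable_run:
  assumes "definable_tm f" "definable_tm g" "definable_tm t" "definable_tm u"
  shows "definable (\<lambda>e. run (f e) (g e) (t e) (u e))"
  unfolding run_def decr_def
  by (intro def_intros assms definable_tm_rename[OF assms(1)] definable_tm_rename[OF assms(2)])

lemma run_append:
  assumes s: "run s d x y" and s': "run s' d' y z"
  shows "\<exists>w. run w (d \<oplus> d') x z"
proof -
  have seq: "seq s (d \<oplus> \<one>)" "entry s \<zero> x" "entry s d y" "seq s' (d' \<oplus> \<one>)" "entry s' \<zero> y" "entry s' d' z"
    and step: "\<And>i a b. entry s i a \<Longrightarrow> entry s (i \<oplus> \<one>) b \<Longrightarrow> pr b a \<triangleleft> R"
      "\<And>i a b. entry s' i a \<Longrightarrow> entry s' (i \<oplus> \<one>) b \<Longrightarrow> pr b a \<triangleleft> R"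
    using s s' by (auto simp: run_def decr_iff)
  note unique = seq_unique[OF seq(1)] seq_unique[OF seq(4)]
  \<comment> \<open>Both alternatives apply at position \<open>d\<close>, where the first run ends
    and the second starts, and both give \<open>y\<close> there.\<close>
  let ?Q = "\<lambda>i a. i \<preceq> d \<and> entry s i a \<or> (\<exists>j. j \<preceq> d' \<and> i = d \<oplus> j \<and> entry s' j a)"
  have "\<exists>w. seq w (d \<oplus> d' \<oplus> \<one>) \<and> (\<forall>i a. entry w i a \<longleftrightarrow> i \<prec> d \<oplus> d' \<oplus> \<one> \<and> ?Q i a)"
  proof (rule seq_exists)
    show "definable (\<lambda>e. ?Q (e (Suc 0)) (e 0))" by (intro def_intros)
    show "\<exists>!a. ?Q i a" if "i \<prec> d \<oplus> d' \<oplus> \<one>" for i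
    proof (rule ex_ex1I)
      show "\<exists>a. ?Q i a"
      proof (cases "i \<preceq> d")
        case True
        then show ?thesis using seq_entry[OF seq(1), of i] by (auto simp: less_suc_le)
      next
        case False
        then obtain j where j: "i = d \<oplus> j" using ord.linear[of i d] by (auto simp: le_iff)
        with that have "j \<preceq> d'" by (simp add: less_suc_le)
        then show ?thesis using seq_entry[OF seq(4), of j] j by (auto simp: less_suc_le)
      qed
      have join: "a = b" if "i \<preceq> d" "entry s i a" "i = d \<oplus> j" "entry s' j b" for a b j
      proof -
        have "j = \<zero>" using that(1,3) le_cancel(2)[of d j \<zero>] by simp
        then have "entry s d a" "entry s' \<zero> b" using that by auto
        then show ?thesis using unique(1)[OF _ seq(3)] unique(2)[OF _ seq(5)] by simp
      qed
      show "a = b" if "?Q i a" "?Q i b" for a b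
        using that join unique by fastforce
    qed
    show "a \<prec> s \<oplus> s'" if "?Q i a" for i a
      using that entry_less(1) le_plus ord.less_le_trans by blast
  qed
  then obtain w where w: "seq w (d \<oplus> d' \<oplus> \<one>)" "\<And>i a. entry w i a \<longleftrightarrow> i \<prec> d \<oplus> d' \<oplus> \<one> \<and> ?Q i a" by blast
  have "pr b a \<triangleleft> R" if ab: "entry w i a" "entry w (i \<oplus> \<one>) b" for i a b
  proof -
    from ab have "?Q i a" "?Q (i \<oplus> \<one>) b" unfolding w(2) by blast+
    then consider "entry s i a" "entry s (i \<oplus> \<one>) b"
      | j where "i \<preceq> d" "entry s i a" "i \<oplus> \<one> = d \<oplus> j" "entry s' j b"
      | j where "i = d \<oplus> j" "entry s' j a" "i \<oplus> \<one> \<preceq> d"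
      | j j' where "i = d \<oplus> j" "entry s' j a" "i \<oplus> \<one> = d \<oplus> j'" "entry s' j' b"
      by blast
    then show ?thesis
    proof cases
      case 2
      show ?thesis
      proof (cases j rule: suc_cases)
        case 1
        then have "i \<oplus> \<one> = d" "b = y" using 2 seq unique by auto
        then show ?thesis using 2 step seq by blast
      next
        case c: (2 c)
        then have i: "i = d \<oplus> c" using 2(3) by (simp add: plus_assoc[symmetric])
        then have "c = \<zero>" using 2(1) le_cancel(2)[of d c \<zero>] by simp
        then have "a = y" "entry s' (\<zero> \<oplus> \<one>) b" using i 2 c unique seq by auto
        then show ?thesis using step(2)[of \<zero>] seq by blast
      qed
    next
      case (3 j)
      then have "d \<oplus> j \<prec> d" by (simp add: suc_le_less)
      then show ?thesis by (simp add: ord.not_le[symmetric])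
    next
      case (4 j j')
      then have "j' = j \<oplus> \<one>" by (simp add: plus_assoc)
      then show ?thesis using 4 step(2) by blast
    qed (use step in blast)
  qed
  with w(1) have "decr R w (d \<oplus> d' \<oplus> \<one>)" by (simp add: decr_iff)
  moreover have "entry w \<zero> x" unfolding w(2) using seq by (simp add: zero_less_suc)
  moreover have "entry w (d \<oplus> d') z" unfolding w(2) using seq by auto
  ultimately show ?thesis unfolding run_def by blast
qed

text \<open>If a state recurs after \<open>d\<close> steps, the segment in between can be repeated:
  entry \<open>m\<close> of the new run is the entry of \<open>s\<close> at \<open>i\<close> plus
  the remainder of \<open>m\<close> modulo \<open>d\<close>. Its length \<open>F k a + 1\<close>
  violates the bound on runs from \<open>a\<close>.\<close>

lemma no_loop:
  assumes s: "decr R s l" "entry s i a" "entry s j a"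
  shows "\<not> i \<prec> j"
proof
  assume "i \<prec> j"
  then obtain c where c: "j = i \<oplus> c \<oplus> \<one>" by (auto simp: less_iff)
  define d where "d = c \<oplus> \<one>"
  have d: "\<zero> \<prec> d" "j = i \<oplus> d" by (simp_all add: d_def zero_less_suc c plus_assoc)
  have seq: "seq s l" and step: "\<And>i a b. entry s i a \<Longrightarrow> entry s (i \<oplus> \<one>) b \<Longrightarrow> pr b a \<triangleleft> R"
    using s by (auto simp: decr_iff)
  have dom: "\<exists>b. entry s (i \<oplus> r) b" if "r \<preceq> d" for r
  proof -
    have "i \<oplus> r \<preceq> j" using that by (simp add: d(2))
    also have "j \<prec> l" using seq_bound[OF seq s(3)] .
    finally show ?thesis by (rule seq_entry[OF seq])
  qed
  let ?Q = "\<lambda>m b. \<exists>q. q \<preceq> m \<and> (\<exists>r. r \<preceq> m \<and> r \<prec> d \<and> m = d \<otimes> q \<oplus> r \<and> entry s (i \<oplus> r) b)"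
  let ?l = "F k a \<oplus> \<one>"
  have "\<exists>w. seq w ?l \<and> (\<forall>m b. entry w m b \<longleftrightarrow> m \<prec> ?l \<and> ?Q m b)"
  proof (rule seq_exists)
    show "definable (\<lambda>e. ?Q (e (Suc 0)) (e 0))" by (intro def_intros)
    show "\<exists>!b. ?Q m b" for m
    proof (rule ex_ex1I)
      show "\<exists>b. ?Q m b" using division[OF d(1), of m] dom by (metis ord.less_imp_le)
      show "b = b'" if "?Q m b" "?Q m b'" for b b'
        using that division_unique seq_unique[OF seq] by metis
    qed
    show "b \<prec> s" if "?Q m b" for m b using that entry_less(1) by blast
  qed
  then obtain w where w: "seq w ?l" "\<And>m b. entry w m b \<longleftrightarrow> m \<prec> ?l \<and> ?Q m b" by blast
  have "pr b' b \<triangleleft> R" if bb: "entry w m b" "entry w (m \<oplus> \<one>) b'" for m b b'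
  proof -
    from bb obtain q r q' r' where qr: "r \<prec> d" "m = d \<otimes> q \<oplus> r" "entry s (i \<oplus> r) b"
      "r' \<prec> d" "m \<oplus> \<one> = d \<otimes> q' \<oplus> r'" "entry s (i \<oplus> r') b'" unfolding w(2) by blast
    have "entry s (i \<oplus> (r \<oplus> \<one>)) b'"
    proof (cases "r \<oplus> \<one> = d")
      case True
      then have "d \<otimes> (q \<oplus> \<one>) \<oplus> \<zero> = d \<otimes> q' \<oplus> r'" using qr(2,5) by (simp add: basic(6) plus_assoc)
      then have "r' = \<zero>" using division_unique(2)[of d "q \<oplus> \<one>" \<zero> q' r'] d(1) qr(4) by simp
      then have "b' = a" using qr(6) seq_unique[OF seq s(2)] by simp
      then show ?thesis using s(3) True d(2) by simp
    next
      case False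
      then have "r \<oplus> \<one> \<prec> d" using qr(1) by (simp add: ord.less_le suc_le_less)
      moreover have "d \<otimes> q \<oplus> (r \<oplus> \<one>) = d \<otimes> q' \<oplus> r'" using qr(2,5) by (simp add: plus_assoc)
      ultimately have "r \<oplus> \<one> = r'" using division_unique(2) qr(4) by blast
      then show ?thesis using qr(6) by simp
    qed
    then show ?thesis using step qr(3) by (simp add: plus_assoc[symmetric])
  qed
  with w(1) have "decr R w ?l" by (simp add: decr_iff)
  moreover have "entry w \<zero> a" unfolding w(2) using s(2) d(1) by (auto simp: zero_less_suc)
  ultimately have "?l \<preceq> F k a" by (rule length_bound)
  then show False by (simp add: suc_le_less)
qed

text \<open>Determinism enters here: two runs with the same start agree at every position that they
  share.\<close>

lemma run_agree:
  assumes s: "run s d x y" and s': "run s' d' x y'" and "entry s i a" "entry s' i b"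
  shows "a = b"
proof -
  have seq: "seq s (d \<oplus> \<one>)" "entry s \<zero> x" "seq s' (d' \<oplus> \<one>)" "entry s' \<zero> x"
    and step: "\<And>i a b. entry s i a \<Longrightarrow> entry s (i \<oplus> \<one>) b \<Longrightarrow> pr b a \<triangleleft> R"
      "\<And>i a b. entry s' i a \<Longrightarrow> entry s' (i \<oplus> \<one>) b \<Longrightarrow> pr b a \<triangleleft> R"
    using s s' by (auto simp: run_def decr_iff)
  have "\<forall>a. a \<prec> s \<longrightarrow> (\<forall>b. b \<prec> s' \<longrightarrow> entry s i a \<longrightarrow> entry s' i b \<longrightarrow> a = b)"
  proof (induction i rule: induction)
    case definable
    show ?case by (intro def_intros)
  next
    case zero
    show ?case using seq_unique[OF seq(1,2)] seq_unique[OF seq(3,4)] by blast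
  next
    case (suc i)
    show ?case
    proof (intro allI impI)
      fix a b assume ab: "entry s (i \<oplus> \<one>) a" "entry s' (i \<oplus> \<one>) b"
      then have "i \<prec> d \<oplus> \<one>" "i \<prec> d' \<oplus> \<one>"
        using seq_bound[OF seq(1)] seq_bound[OF seq(3)] less_plus_one ord.less_trans by blast+
      then obtain a' b' where ab': "entry s i a'" "entry s' i b'"
        using seq_entry[OF seq(1)] seq_entry[OF seq(3)] by blast
      then have "a' = b'" using suc entry_less(1) by blast
      then show "a = b" using deterministic step(1)[OF ab'(1) ab(1)] step(2)[OF ab'(2) ab(2)] by blast
    qed
  qed
  then show ?thesis using assms entry_less(1) by blast
qed

text \<open>A shorter run from \<open>x\<close> to \<open>y\<close> is an initial segment of a
  longer one, in which \<open>y\<close> would then occur twice.\<close>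

lemma run_length_unique: "run s d x y \<Longrightarrow> run s' d' x y \<Longrightarrow> d = d'"
proof -
  have *: "\<not> d \<prec> d'" if run: "run s d x y" "run s' d' x y" for s d s' d'
  proof
    assume "d \<prec> d'"
    then have "d \<prec> d' \<oplus> \<one>" using less_plus_one ord.less_trans by blast
    then obtain a where "entry s' d a" using run(2) seq_entry[of s' "d' \<oplus> \<one>" d] by (auto simp: run_def decr_iff)
    moreover from this have "y = a" using run_agree[OF run] run(1) by (auto simp: run_def)
    ultimately show False using no_loop[of s' "d' \<oplus> \<one>" d y d'] run(2) \<open>d \<prec> d'\<close> by (auto simp: run_def)
  qed
  show "run s d x y \<Longrightarrow> run s' d' x y \<Longrightarrow> d = d'" using * less_linear by blast
qed

lemma P_run: "pr y x \<triangleleft> P \<longleftrightarrow> (\<exists>s d. run s d x y \<and> \<zero> \<prec> d)"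
proof
  show "pr y x \<triangleleft> P \<Longrightarrow> \<exists>s d. run s d x y \<and> \<zero> \<prec> d"
    unfolding P_iff run_def using zero_less_suc by blast
  show "\<exists>s d. run s d x y \<and> \<zero> \<prec> d \<Longrightarrow> pr y x \<triangleleft> P"
    unfolding P_iff run_def by (metis not_less_zero suc_cases)
qed

definition dist :: "'a \<Rightarrow> 'a" where
  "dist p = (if p \<triangleleft> P then THE n. \<exists>s x y. p = pr y x \<and> run s n x y else \<zero>)"

lemma dist_eq: "run s d x y \<Longrightarrow> \<zero> \<prec> d \<Longrightarrow> dist (pr y x) = d"
  using P_run run_length_unique by (auto simp: dist_def)

lemma run_dist: "pr y x \<triangleleft> P \<Longrightarrow> \<exists>s. run s (dist (pr y x)) x y"
  using P_run dist_eq by metis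

lemma dist_pos: "pr y x \<triangleleft> P \<Longrightarrow> \<zero> \<prec> dist (pr y x)"
  using P_run dist_eq by metis

lemma irreflexive: "\<not> pr x x \<triangleleft> P"
  unfolding P_run run_def using no_loop by blast

lemma dist_bound: "pr y x \<triangleleft> P \<Longrightarrow> dist (pr y x) \<prec> F k x"
  using run_dist length_bound suc_le_less unfolding run_def by blast

text \<open>Additivity of the length is what later transfers a bound on the steps left at
  \<open>x\<close> to a smaller one at \<open>y\<close>.\<close>

lemma P_trans:
  assumes "pr y x \<triangleleft> P" "pr z y \<triangleleft> P"
  shows "pr z x \<triangleleft> P" "dist (pr z x) = dist (pr y x) \<oplus> dist (pr z y)"
proof -
  obtain s where s: "run s (dist (pr y x) \<oplus> dist (pr z y)) x z"
    using run_append run_dist assms by meson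
  have "\<zero> \<prec> dist (pr y x) \<oplus> dist (pr z y)"
    using dist_pos[OF assms(1)] le_plus(1) ord.less_le_trans by blast
  with s show "pr z x \<triangleleft> P" "dist (pr z x) = dist (pr y x) \<oplus> dist (pr z y)"
    using P_run dist_eq by blast+
qed

text \<open>Membership in \<open>P\<close> decides whether there is a run to search for, and
  uniqueness of the length makes the outcome of the search a function.\<close>

lemma internal_dist: assumes rel: "\<And>p. p \<triangleleft> P \<Longrightarrow> \<exists>x y. p = pr y x" shows "internal dist"
proof (rule internalI)
  let ?A = "\<lambda>p n w. p \<triangleleft> P \<and> (\<exists>x. x \<preceq> p \<and> (\<exists>y. y \<preceq> p \<and> p = pr y x \<and> run w n x y)) \<or> \<not> p \<triangleleft> P \<and> n = \<zero>"
  show "definable (\<lambda>e. ?A (e 2) (e 1) (e 0))" by (intro def_intros definable_run)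
  show "\<exists>w. ?A p (dist p) w" for p
  proof (cases "p \<triangleleft> P")
    case True
    with rel obtain x y where "p = pr y x" by blast
    with True show ?thesis using run_dist pr_ge(1,2) by blast
  qed (simp add: dist_def)
  show "n = dist p" if A: "?A p n w" for p n w
  proof (cases "p \<triangleleft> P")
    case True
    with A obtain x y where xy: "p = pr y x" "run w n x y" by blast
    with True obtain s where "run s (dist p) x y" using run_dist by blast
    with xy show ?thesis using run_length_unique by blast
  qed (use A in \<open>simp add: dist_def\<close>)
qed

text \<open>The number of steps that remain from \<open>x\<close> need not be computable. The potential is instead the best bound
  on it given by those \<open>x'\<close> at most \<open>x\<close> from which \<open>x\<close> is reachable: a run from \<open>x'\<close> makes fewer than \<open>F\<^sub>k(x')\<close> steps,
  and \<open>dist\<close> of them are used up.\<close>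

lemma potential:
  assumes rel: "\<And>p. p \<triangleleft> P \<Longrightarrow> \<exists>x y. p = pr y x"
  shows "\<exists>\<mu>. internal \<mu> \<and> (\<forall>x. \<mu> x \<prec> F k x) \<and> (\<forall>x y. x \<prec> y \<longrightarrow> pr y x \<triangleleft> P \<longrightarrow> \<mu> y \<prec> \<mu> x)"
proof -
  note Fk = F_properties[OF total]
  have F_mono: "x \<preceq> y \<Longrightarrow> F k x \<preceq> F k y" and F_infl: "x \<prec> F k x" for x y
    using Fk(2) by (auto simp: inflationary_mono_def)
  have "internal dist" by (rule internal_dist) (rule rel)
  note def_rules = definable_internal[OF Fk(1)] definable_internal[OF this]
  \<comment> \<open>\<open>C x v w\<close> says that \<open>v = F k x' - 1 - n\<close> for some
    \<open>x'\<close> at most \<open>x\<close>, with \<open>n\<close> the length of the run from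
    \<open>x'\<close> to \<open>x\<close>, and 0 if they coincide. Monotonicity makes
    \<open>w = F k x\<close> a bound for all values involved.\<close>
  define C where "C x v w \<longleftrightarrow> (\<exists>x'. x' \<preceq> x \<and> (\<exists>n. n \<preceq> w \<and> (\<exists>u. u \<preceq> w \<and> u = F k x' \<and> v \<oplus> n \<oplus> \<one> = u \<and>
    (x' = x \<and> n = \<zero> \<or> pr x x' \<triangleleft> P \<and> n = dist (pr x x')))))" for x v w
  have definable_C: "definable (\<lambda>e. C (e i) (e j) (e l))" for i j l
    unfolding C_def by ((rule def_rules | rule def_intros)+)
  have definable_C': "definable (\<lambda>e. C x (e 0) (F k x))" for x
    unfolding C_def by ((rule def_rules | rule def_intros)+)
  let ?A = "\<lambda>x v w. w = F k x \<and> C x v w \<and> (\<forall>v'. v' \<prec> v \<longrightarrow> \<not> C x v' w)"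
  have "\<exists>\<mu>. internal \<mu> \<and> (\<forall>x. \<exists>w. ?A x (\<mu> x) w)"
  proof (rule internal_exists)
    show "definable (\<lambda>e. ?A (e 2) (e 1) (e 0))" by ((rule def_rules definable_C | rule def_intros)+)
    show "\<exists>v w. ?A x v w" for x
    proof -
      obtain v where "F k x = v \<oplus> \<one>"
        using F_infl[of x] by (cases "F k x" rule: suc_cases) auto
      then have "C x v (F k x)" unfolding C_def by - (rule exI[of _ x], rule conjI, simp, rule exI[of _ \<zero>], simp)
      from least[of "\<lambda>v. C x v (F k x)", OF definable_C' this] show ?thesis by blast
    qed
    show "v = v'" if "?A x v w" "?A x v' w'" for x v w v' w' using that less_linear[of v v'] by blast
  qed
  then obtain \<mu> where \<mu>: "internal \<mu>" "\<And>x. ?A x (\<mu> x) (F k x)" by blast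
  have C: "C x (\<mu> x) (F k x)" and min: "C x v (F k x) \<Longrightarrow> \<mu> x \<preceq> v" for x v
    using \<mu>(2)[of x] ord.not_less by blast+
  have "\<mu> x \<prec> F k x" for x
  proof -
    from C[of x] obtain x' n where "F k x' \<preceq> F k x" "\<mu> x \<oplus> n \<oplus> \<one> = F k x'"
      unfolding C_def by blast
    then have "\<mu> x \<oplus> n \<prec> F k x" by (simp flip: suc_le_less)
    then show ?thesis using le_plus(1) ord.le_less_trans by blast
  qed
  moreover have "\<mu> y \<prec> \<mu> x" if xy: "x \<prec> y" "pr y x \<triangleleft> P" for x y
  proof -
    from C[of x] obtain x' n where x': "x' \<preceq> x" "\<mu> x \<oplus> n \<oplus> \<one> = F k x'"
      and n: "x' = x \<and> n = \<zero> \<or> pr x x' \<triangleleft> P \<and> n = dist (pr x x')" unfolding C_def by blast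
    let ?d = "dist (pr y x)"
    have y: "pr y x' \<triangleleft> P" "dist (pr y x') = n \<oplus> ?d" using n xy(2) P_trans[of x x' y] by auto
    \<comment> \<open>The start \<open>x'\<close> that is optimal for \<open>x\<close> also reaches
      \<open>y\<close>, and the whole run to \<open>y\<close> stays within the bound at
      \<open>x'\<close>; so the distance from \<open>x\<close> to \<open>y\<close> can be subtracted
      from \<open>\<mu> x\<close>. The result \<open>v\<close> competes in the minimum for
      \<open>y\<close>, as \<open>x'\<close> is at most \<open>x\<close> and \<open>x\<close> is
      below \<open>y\<close>.\<close>
    have "?d \<oplus> n \<prec> \<mu> x \<oplus> n \<oplus> \<one>"
      unfolding x'(2) using dist_bound[OF y(1)] unfolding y(2) plus_commute[of n] .
    then have "?d \<preceq> \<mu> x" by (simp only: less_suc_le le_cancel)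
    then obtain v where v: "\<mu> x = ?d \<oplus> v" by (auto simp: le_iff)
    have "x' \<preceq> y" using x'(1) xy(1) by (meson ord.less_imp_le ord.order_trans)
    then have "F k x' \<preceq> F k y" by (rule F_mono)
    moreover have "n \<oplus> ?d \<preceq> F k y"
      using dist_bound[OF y(1)] y(2) \<open>F k x' \<preceq> F k y\<close> by (metis ord.less_imp_le ord.order_trans)
    moreover have "v \<oplus> (n \<oplus> ?d) \<oplus> \<one> = F k x'" unfolding x'(2)[symmetric] v by (simp add: ac_simps)
    ultimately have "C y v (F k y)"
      unfolding C_def using y \<open>x' \<preceq> y\<close> by - (rule exI[of _ x'], rule conjI, simp, rule exI[of _ "n \<oplus> ?d"], simp)
    then have "\<mu> y \<preceq> v" by (rule min)
    also have "v \<prec> \<mu> x" using dist_pos[OF xy(2)] less_cancel(1)[of \<zero> v ?d] by (simp add: v)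
    finally show ?thesis .
  qed
  ultimately show ?thesis using \<mu>(1) by blast
qed

lemma decomposition:
  assumes rel: "\<And>p. p \<triangleleft> P \<Longrightarrow> \<exists>x y. p = pr y x"
  shows "\<exists>S :: nat \<Rightarrow> 's. (\<forall>i<k + 2. (\<forall>p. p \<triangleleft> S i \<longrightarrow> (\<exists>x y. p = pr y x)) \<and> bounded_by 0 (S i)) \<and>
    (\<forall>p. p \<triangleleft> P \<longrightarrow> (\<exists>i<k + 2. p \<triangleleft> S i))"
proof -
  obtain \<mu> where \<mu>: "internal \<mu>" "\<And>x. \<mu> x \<prec> F k x" "\<And>x y. x \<prec> y \<Longrightarrow> pr y x \<triangleleft> P \<Longrightarrow> \<mu> y \<prec> \<mu> x"
    using potential rel by blast
  obtain r where r: "\<And>i. i < k + 2 \<Longrightarrow> internal (r i)" "\<And>i x. i < k + 2 \<Longrightarrow> r i x \<preceq> x"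
    and split: "\<And>x y. y \<prec> x \<or> x \<prec> y \<and> \<mu> y \<prec> \<mu> x \<Longrightarrow> \<exists>i<k + 2. r i y \<prec> r i x"
    using ranks[OF total \<mu>(1,2)] by blast
  have "\<exists>X. \<forall>p. p \<triangleleft> X \<longleftrightarrow> p \<triangleleft> P \<and> (\<exists>x y. p = pr y x \<and> r i y \<prec> r i x)" if i: "i < k + 2" for i
  proof -
    let ?A = "\<lambda>p. p \<triangleleft> P \<and> (\<exists>x. x \<preceq> p \<and> (\<exists>y. y \<preceq> p \<and> p = pr y x \<and>
      (\<exists>u. u \<preceq> y \<and> u = r i y \<and> (\<exists>v. v \<preceq> x \<and> v = r i x \<and> u \<prec> v))))"
    have "definable (\<lambda>e. ?A (e 0))" by ((rule definable_internal[OF r(1)[OF i]] | rule def_intros)+)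
    then obtain X where "\<And>p. p \<triangleleft> X \<longleftrightarrow> ?A p" using bounded_comprehension[of ?A] by blast
    then have "\<forall>p. p \<triangleleft> X \<longleftrightarrow> p \<triangleleft> P \<and> (\<exists>x y. p = pr y x \<and> r i y \<prec> r i x)"
      using r(2)[OF i] pr_ge(1,2) by blast
    then show ?thesis by blast
  qed
  then obtain S where S: "\<And>i p. i < k + 2 \<Longrightarrow> p \<triangleleft> S i \<longleftrightarrow> p \<triangleleft> P \<and> (\<exists>x y. p = pr y x \<and> r i y \<prec> r i x)"
    by metis
  have "bounded_by 0 (S i)" if "i < k + 2" for i
    by (rule bounded_by_rank[OF r(1)[OF that] r(2)[OF that]]) (auto simp: S[OF that])
  moreover have "\<exists>i<k + 2. p \<triangleleft> S i" if p: "p \<triangleleft> P" for p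
  proof -
    obtain x y where xy: "p = pr y x" using rel p by blast
    \<comment> \<open>Equality is excluded because no run returns to its start.\<close>
    then have "y \<prec> x \<or> x \<prec> y \<and> \<mu> y \<prec> \<mu> x" using irreflexive \<mu>(3) p less_linear by blast
    then show ?thesis using split S p xy by blast
  qed
  ultimately show ?thesis using S by blast
qed

end

section \<open>Provability of the decomposition\<close>

lemma sat_Conj: "sat \<M> e s (Conj \<phi>s) \<longleftrightarrow> (\<forall>\<phi>\<in>set \<phi>s. sat \<M> e s \<phi>)"
  by (induction \<phi>s) (auto simp: Conj_def)

lemma sat_Disj: "sat \<M> e s (Disj \<phi>s) \<longleftrightarrow> (\<exists>\<phi>\<in>set \<phi>s. sat \<M> e s \<phi>)"
  by (induction \<phi>s) (auto simp: Disj_def)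

text \<open>The outermost of \<open>n + 1\<close> quantifiers has index \<open>n\<close> in the
  matrix, so the induction step extends \<open>S\<close> at \<open>n\<close>; the old set variables
  begin at the index after the new ones.\<close>

lemma sat_ExS_power:
  "sat \<M> e s ((ExS ^^ n) \<phi>) \<longleftrightarrow> (\<exists>S. sat \<M> e (\<lambda>i. if i < n then S i else s (i - n)) \<phi>)"
proof (induction n arbitrary: s)
  case (Suc n)
  have *: "(\<lambda>i. if i < n then S i else case_nat X s (i - n)) =
    (\<lambda>i. if i < Suc n then (if i < n then S i else X) else s (i - Suc n))" for S X
  proof
    fix i
    show "(if i < n then S i else case_nat X s (i - n)) =
      (if i < Suc n then (if i < n then S i else X) else s (i - Suc n))"
    proof (cases i n rule: linorder_cases)
      case greater
      then obtain j where "i = Suc (n + j)" using less_imp_Suc_add by blast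
      then show ?thesis by (simp add: Suc_diff_le)
    qed auto
  qed
  have "sat \<M> e s ((ExS ^^ Suc n) \<phi>) \<longleftrightarrow> (\<exists>X S. sat \<M> e (\<lambda>i. if i < n then S i else case_nat X s (i - n)) \<phi>)"
    using Suc by simp
  also have "\<dots> \<longleftrightarrow> (\<exists>S. sat \<M> e (\<lambda>i. if i < Suc n then S i else s (i - Suc n)) \<phi>)"
  proof
    show "\<exists>X S. sat \<M> e (\<lambda>i. if i < n then S i else case_nat X s (i - n)) \<phi> \<Longrightarrow>
      \<exists>S. sat \<M> e (\<lambda>i. if i < Suc n then S i else s (i - Suc n)) \<phi>"
      unfolding * by (elim exE) (rule exI)
    assume "\<exists>S. sat \<M> e (\<lambda>i. if i < Suc n then S i else s (i - Suc n)) \<phi>"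
    then obtain S where S: "sat \<M> e (\<lambda>i. if i < Suc n then S i else s (i - Suc n)) \<phi>" by blast
    have "(\<lambda>i. if i < n then S i else case_nat (S n) s (i - n)) = (\<lambda>i. if i < Suc n then S i else s (i - Suc n))"
      unfolding * by (auto simp: fun_eq_iff less_Suc_eq)
    with S show "\<exists>X S. sat \<M> e (\<lambda>i. if i < n then S i else case_nat X s (i - n)) \<phi>" by metis
  qed
  finally show ?case .
qed simp

section \<open>Meaning of the object-level formulas in a model\<close>

context rca_model
begin

lemma val_Pr [simp]: "val \<M> e (Pr t u) = pr (val \<M> e t) (val \<M> e u)"
  by (simp add: Pr_def pr_def)

lemma sat_BAll: "sat \<M> e s (BAll t \<phi>) \<longleftrightarrow> (\<forall>x. x \<prec> val \<M> e t \<longrightarrow> sat \<M> (case_nat x e) s \<phi>)"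
  by (simp add: BAll_def)

lemma sat_BEx: "sat \<M> e s (BEx t \<phi>) \<longleftrightarrow> (\<exists>x. x \<prec> val \<M> e t \<and> sat \<M> (case_nat x e) s \<phi>)"
  by (simp add: BEx_def)

lemmas sat_bounded = sat_BAll sat_BEx numeral_2_eq_2 numeral_3_eq_3

lemma sat_Elem [simp]: "sat \<M> e s (Elem t c) \<longleftrightarrow> elem (val \<M> e t) (val \<M> e c)"
  by (simp add: Elem_def elem_def Let_def sat_bounded pow2_def two_def)

lemma sat_Entry [simp]: "sat \<M> e s (Entry t i a) \<longleftrightarrow> entry (val \<M> e t) (val \<M> e i) (val \<M> e a)"
  by (simp add: Entry_def entry_def)

lemma sat_IsSeq [simp]: "sat \<M> e s (IsSeq t l) \<longleftrightarrow> seq (val \<M> e t) (val \<M> e l)"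
  unfolding IsSeq_def seq_def by (simp add: sat_bounded) blast

lemma sat_Graph [simp]: "sat \<M> e s (Graph n t u) \<longleftrightarrow> graph n (val \<M> e t) (val \<M> e u)"
proof (induction n arbitrary: e t u)
  case (Suc n)
  then show ?case by (simp add: sat_bounded) blast
qed simp

lemma sat_Decreasing [simp]: "sat \<M> e s (Decreasing Q t l) \<longleftrightarrow> decr (s Q) (val \<M> e t) (val \<M> e l)"
  unfolding Decreasing_def decr_def by (simp add: sat_bounded) blast

lemma sat_Tot: "sat \<M> e s (Tot n) \<longleftrightarrow> total n"
  by (simp add: Tot_def total_def)

lemma sat_IsRel: "sat \<M> e s (IsRel Q) \<longleftrightarrow> (\<forall>p. p \<triangleleft> s Q \<longrightarrow> (\<exists>x y. p = pr y x))"
  unfolding IsRel_def by simp blast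

lemma sat_Deterministic:
  "sat \<M> e s (Deterministic Q) \<longleftrightarrow> (\<forall>x y z. pr y x \<triangleleft> s Q \<and> pr z x \<triangleleft> s Q \<longrightarrow> y = z)"
  by (simp add: Deterministic_def)

lemma sat_BoundedBy: "sat \<M> e s (BoundedBy n Q) \<longleftrightarrow> bounded_by n (s Q)"
  by (simp add: BoundedBy_def bounded_by_def le_def disj_imp)

lemma sat_IsTransClosure:
  "sat \<M> e s (IsTransClosure P R) \<longleftrightarrow> (\<forall>p. p \<triangleleft> s P \<longrightarrow> (\<exists>x y. p = pr y x)) \<and>
    (\<forall>x y. pr y x \<triangleleft> s P \<longleftrightarrow>
      (\<exists>w n. decr (s R) w (n \<oplus> \<one> \<oplus> \<one>) \<and> entry w \<zero> x \<and> entry w (n \<oplus> \<one>) y))"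
  by (simp add: IsTransClosure_def sat_IsRel)  blast

lemma sat_CoveredBy: "sat \<M> e s (CoveredBy P Qs) \<longleftrightarrow> (\<forall>p. p \<triangleleft> s P \<longrightarrow> (\<exists>i\<in>set Qs. p \<triangleleft> s i))"
  by (simp add: CoveredBy_def sat_Disj)

lemma sat_decomposition:
  assumes "total k"
  shows "sat \<M> e s (AllS (IsRel 0 \<^bold>\<and> Deterministic 0 \<^bold>\<and> BoundedBy k 0 \<^bold>\<longrightarrow>
      AllS (IsTransClosure 0 1 \<^bold>\<longrightarrow>
        (ExS ^^ (k + 2))
          (CoveredBy (k + 2) [0..<k + 2] \<^bold>\<and>
           Conj (map (\<lambda>i. IsRel i \<^bold>\<and> BoundedBy 0 i) [0..<k + 2])))))"
proof -
  define \<chi> where "\<chi> = (ExS ^^ (k + 2))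
      (CoveredBy (k + 2) [0..<k + 2] \<^bold>\<and> Conj (map (\<lambda>i. IsRel i \<^bold>\<and> BoundedBy 0 i) [0..<k + 2]))"
  have "sat \<M> e (case_nat P (case_nat R s)) \<chi>"
    if R: "\<forall>x y z. pr y x \<triangleleft> R \<and> pr z x \<triangleleft> R \<longrightarrow> y = z" "bounded_by k R"
      and P: "\<forall>p. p \<triangleleft> P \<longrightarrow> (\<exists>x y. p = pr y x)"
        "\<forall>x y. pr y x \<triangleleft> P \<longleftrightarrow> (\<exists>w n. decr R w (n \<oplus> \<one> \<oplus> \<one>) \<and> entry w \<zero> x \<and> entry w (n \<oplus> \<one>) y)"
    for R P
  proof -
    interpret deterministic_bounded \<M> R P k
      by unfold_locales (use assms R P(2) in blast)+
    obtain S where "\<And>i p. i < k + 2 \<Longrightarrow> p \<triangleleft> S i \<Longrightarrow> \<exists>x y. p = pr y x"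
      "\<And>i. i < k + 2 \<Longrightarrow> bounded_by 0 (S i)" "\<And>p. p \<triangleleft> P \<Longrightarrow> \<exists>i<k + 2. p \<triangleleft> S i"
      using decomposition P(1) by blast
    then show ?thesis unfolding \<chi>_def sat_ExS_power
      \<comment> \<open>Inside the quantifier prefix the indices below \<open>k + 2\<close> refer to
        \<open>S\<close> and the index \<open>k + 2\<close> refers to \<open>P\<close>.\<close>
      by (intro exI[of _ S]) (auto simp: sat_CoveredBy sat_Conj sat_IsRel sat_BoundedBy Bex_def simp del: upt_Suc)
  qed
  then show ?thesis unfolding \<chi>_def[symmetric]
    by (simp add: sat_IsRel sat_Deterministic sat_BoundedBy sat_IsTransClosure) blast
qed

end

theorem theorem8p10:
  fixes k :: nat
  shows "RCA0star \<union> {Tot k} \<turnstile>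
    AllS (IsRel 0 \<^bold>\<and> Deterministic 0 \<^bold>\<and> BoundedBy k 0 \<^bold>\<longrightarrow>
      AllS (IsTransClosure 0 1 \<^bold>\<longrightarrow>
        (ExS ^^ (k + 2))
          (CoveredBy (k + 2) [0..<k + 2] \<^bold>\<and>
           Conj (map (\<lambda>i. IsRel i \<^bold>\<and> BoundedBy 0 i) [0..<k + 2]))))"
  unfolding proves_def
proof (rule ccontr)
  assume "\<not> derives (RCA0star \<union> {Tot k}) [] (AllS (IsRel 0 \<^bold>\<and> Deterministic 0 \<^bold>\<and> BoundedBy k 0 \<^bold>\<longrightarrow>
      AllS (IsTransClosure 0 1 \<^bold>\<longrightarrow>
        (ExS ^^ (k + 2))
          (CoveredBy (k + 2) [0..<k + 2] \<^bold>\<and>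
           Conj (map (\<lambda>i. IsRel i \<^bold>\<and> BoundedBy 0 i) [0..<k + 2])))))" (is "\<not> derives _ [] ?\<phi>")
  moreover have "basic_axioms \<subseteq> RCA0star \<union> {Tot k}" by (auto simp: RCA0star_def)
  ultimately have "\<exists>\<M> :: (nat, nat) struct.
    (\<forall>\<psi>\<in>RCA0star \<union> {Tot k}. \<forall>e s. sat \<M> e s \<psi>) \<and> (\<exists>e s. \<not> sat \<M> e s ?\<phi>)"
    by (rule completeness)
  then obtain \<M> :: "(nat, nat) struct" and e s where
    \<M>: "\<And>\<psi> e s. \<psi> \<in> RCA0star \<union> {Tot k} \<Longrightarrow> sat \<M> e s \<psi>" and "\<not> sat \<M> e s ?\<phi>"
    by blast
  interpret rca_model \<M>
    by unfold_locales (simp add: \<M>)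
  have "total k" using \<M>[of "Tot k"] by (simp add: sat_Tot)
  then have "sat \<M> e s ?\<phi>" by (rule sat_decomposition)
  with \<open>\<not> sat \<M> e s ?\<phi>\<close> show False by contradiction
qed

end
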